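(* Consider the Weighted $k$-Server problem on a uniform metric restricted to instances with exactly two distinct server weights. For any constant $\varepsilon>0$ and any constant $c<2$, it is UG-hard (i.e., hard assuming the Unique Games Conjecture) to obtain a polynomial-time $N^{1/2-\varepsilon}$-approximation algorithm for this problem, even when the algorithm is allowed $c$-resource augmentation, where $N$ denotes the size of the input (including the length of the request sequence). Here the approximation ratio compares the cost of the algorithm's solution (which may use the augmented numbers of servers) with the optimal cost of the original instance.
   Context: Weighted $k$-Server on the uniform metric: there is a set of $n$ points $V=\{1,\dots,n\}$ with $d(v,v')=1$ for all $v\neq v'$, and $k$ servers, server $i$ having weight $w_i\ge 0$. A request sequence $\sigma_1,\dots,\sigma_T\in V$ is given. A solution is a map $f:[k]\times\{0,\dots,T\}\to V$ giving the position of each server at each time, where the initial positions $f(i,0)$ are part of the input, such that for each $t\in[T]$ some server $i_t$ has $f(i_t,t)=\sigma_t$. Its cost is $\frac12\sum_{i=1}^k w_i\sum_{t=1}^T \mathbb{1}[f(i,t)\neq f(i,t-1)]$, to be minimized. If the set of weights $\{w_1,\dots,w_k\}$ has $\ell$ distinct values $W_1,\dots,W_\ell$ (the weight classes), let $k_j$ be the number of servers of weight $W_j$. For $c\ge 1$ (or a constant $c$), an algorithm uses $c$-resource augmentation if it uses $\lfloor c k_j\rfloor$ servers of weight $W_j$ for each $j\in[\ell]$. *)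

theory Defs
  imports Complex_Main
begin

section \<open>Polynomial time: deterministic multitape Turing machines\<close>

datatype move = MLeft | MStay | MRight

text \<open>
  Working states are \<open>0, \<dots>, states M - 1\<close> with start state \<open>0\<close>; the number \<open>states M\<close> itself is
  the halting state. Tape symbols are \<open>0, \<dots>, symbols M - 1\<close>, where \<open>0\<close> is the blank, \<open>1\<close> the
  bit \<open>False\<close> and \<open>2\<close> the bit \<open>True\<close>. Tapes are infinite in both directions.
\<close>

record tm =
  tapes :: nat
  states :: nat
  symbols :: nat
  delta :: "nat \<Rightarrow> nat list \<Rightarrow> nat \<times> (nat \<times> move) list"

definition tm_wf :: "tm \<Rightarrow> bool" where
  "tm_wf M \<longleftrightarrow> tapes M \<ge> 1 \<and> symbols M \<ge> 3 \<and>
     (\<forall>q s. q < states M \<and> length s = tapes M \<and> (\<forall>a\<in>set s. a < symbols M) \<longrightarrow>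
        fst (delta M q s) \<le> states M \<and>
        length (snd (delta M q s)) = tapes M \<and>
        (\<forall>a\<in>set (snd (delta M q s)). fst a < symbols M))"

type_synonym tape = "(int \<Rightarrow> nat) \<times> int"

type_synonym config = "nat \<times> tape list"

definition tape_read :: "tape \<Rightarrow> nat" where
  "tape_read tp = fst tp (snd tp)"

fun shift :: "move \<Rightarrow> int" where
  "shift MLeft = - 1"
| "shift MStay = 0"
| "shift MRight = 1"

definition tape_act :: "nat \<times> move \<Rightarrow> tape \<Rightarrow> tape" where
  "tape_act a tp = ((fst tp)(snd tp := fst a), snd tp + shift (snd a))"

definition tm_step :: "tm \<Rightarrow> config \<Rightarrow> config" where
  "tm_step M C =
     (if fst C < states M
      then (let r = delta M (fst C) (map tape_read (snd C))
            in (fst r, map2 tape_act (snd r) (snd C)))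
      else C)"

definition bit_sym :: "bool \<Rightarrow> nat" where
  "bit_sym b = (if b then 2 else 1)"

definition blank_tape :: tape where
  "blank_tape = (\<lambda>_. 0, 0)"

definition input_tape :: "bool list \<Rightarrow> tape" where
  "input_tape x =
     (\<lambda>i. if 0 \<le> i \<and> i < int (length x) then bit_sym (x ! nat i) else 0, 0)"

definition tm_init :: "tm \<Rightarrow> bool list \<Rightarrow> config" where
  "tm_init M x = (0, input_tape x # replicate (tapes M - 1) blank_tape)"

text \<open>The output is read off the first tape, from cell \<open>0\<close> up to the first blank.\<close>

definition tm_outputs :: "config \<Rightarrow> bool list \<Rightarrow> bool" where
  "tm_outputs C y \<longleftrightarrow>
     (\<forall>i<length y. fst (hd (snd C)) (int i) = bit_sym (y ! i)) \<and>
     fst (hd (snd C)) (int (length y)) = 0"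

definition polytime :: "(bool list \<Rightarrow> bool list) \<Rightarrow> bool" where
  "polytime f \<longleftrightarrow>
     (\<exists>M k. tm_wf M \<and>
        (\<forall>x. \<exists>t \<le> length x ^ k + k.
           fst ((tm_step M ^^ t) (tm_init M x)) = states M \<and>
           tm_outputs ((tm_step M ^^ t) (tm_init M x)) (f x)))"


section \<open>Complexity classes and NP-hardness of search problems\<close>

definition str_pair :: "bool list \<Rightarrow> bool list \<Rightarrow> bool list" where
  "str_pair x y = concat (map (\<lambda>b. [True, b]) x) @ False # y"

definition class_P :: "bool list set set" where
  "class_P = {L. polytime (\<lambda>x. [x \<in> L])}"

definition class_NP :: "bool list set set" where
  "class_NP = {L. \<exists>V\<in>class_P. \<exists>k. \<forall>x.
     x \<in> L \<longleftrightarrow> (\<exists>y. length y \<le> length x ^ k + k \<and> str_pair x y \<in> V)}"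

text \<open>
  Hardness of promise problems is with respect to polynomial-time many-one reductions. The sets of
  YES and NO strings may overlap; this only makes hardness easier.
\<close>

definition NP_hard_promise :: "bool list set \<Rightarrow> bool list set \<Rightarrow> bool" where
  "NP_hard_promise Yes No \<longleftrightarrow>
     (\<forall>L\<in>class_NP. \<exists>f. polytime f \<and>
        (\<forall>x. (x \<in> L \<longrightarrow> f x \<in> Yes) \<and> (x \<notin> L \<longrightarrow> f x \<in> No)))"

text \<open>
  A search problem consists of a set \<open>D\<close> of input strings and a relation \<open>R\<close> between inputs and
  acceptable outputs. The reduction asks one query \<open>f x \<in> D\<close>, and from \<open>x\<close> and any acceptable
  answer \<open>y\<close> the question \<open>x \<in> L\<close> is decided in polynomial time. So a gap-producing many-one
  reduction for an optimization problem gives NP-hardness of the search for approximate solutions.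
\<close>

definition NP_hard_search :: "bool list set \<Rightarrow> (bool list \<Rightarrow> bool list \<Rightarrow> bool) \<Rightarrow> bool" where
  "NP_hard_search D R \<longleftrightarrow>
     (\<forall>L\<in>class_NP. \<exists>f. \<exists>V\<in>class_P. polytime f \<and>
        (\<forall>x. f x \<in> D \<and> (\<forall>y. R (f x) y \<longrightarrow> (str_pair x y \<in> V \<longleftrightarrow> x \<in> L))))"

definition polytime_solvable :: "bool list set \<Rightarrow> (bool list \<Rightarrow> bool list \<Rightarrow> bool) \<Rightarrow> bool" where
  "polytime_solvable D R \<longleftrightarrow> (\<exists>A. polytime A \<and> (\<forall>x\<in>D. R x (A x)))"


section \<open>Prefix-free binary encodings\<close>

fun bits :: "nat \<Rightarrow> bool list" where
  "bits n = (if n = 0 then [] else odd n # bits (n div 2))"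

declare bits.simps [simp del]

definition enc_nat :: "nat \<Rightarrow> bool list" where
  "enc_nat n = concat (map (\<lambda>b. [True, b]) (bits n)) @ [False]"

definition enc_list :: "('a \<Rightarrow> bool list) \<Rightarrow> 'a list \<Rightarrow> bool list" where
  "enc_list e xs = concat (map (\<lambda>a. True # e a) xs) @ [False]"

text \<open>Used for nonnegative rationals only.\<close>

definition enc_rat :: "rat \<Rightarrow> bool list" where
  "enc_rat r = enc_nat (nat (fst (quotient_of r))) @ enc_nat (nat (snd (quotient_of r)))"


section \<open>The Unique Games Conjecture\<close>

text \<open>
  A unique game with \<open>q\<close> labels is a bipartite multigraph whose edges carry permutations of the
  labels \<open>{..<q}\<close>: the list entry \<open>(u, v, \<pi>)\<close> is an edge between the left vertex \<open>u\<close> and the right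
  vertex \<open>v\<close>, satisfied by the labelings \<open>a\<close> (left) and \<open>b\<close> (right) if \<open>\<pi> ! a u = b v\<close>.
\<close>

type_synonym unique_game = "(nat \<times> nat \<times> nat list) list"

definition ug_wf :: "nat \<Rightarrow> unique_game \<Rightarrow> bool" where
  "ug_wf q G \<longleftrightarrow> q \<ge> 1 \<and> G \<noteq> [] \<and>
     (\<forall>(u, v, \<pi>) \<in> set G. distinct \<pi> \<and> set \<pi> = {..<q})"

definition ug_frac :: "unique_game \<Rightarrow> (nat \<Rightarrow> nat) \<Rightarrow> (nat \<Rightarrow> nat) \<Rightarrow> real" where
  "ug_frac G a b =
     real (length (filter (\<lambda>(u, v, \<pi>). \<pi> ! a u = b v) G)) / real (length G)"

definition ug_value :: "nat \<Rightarrow> unique_game \<Rightarrow> real" where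
  "ug_value q G = Sup {ug_frac G a b | a b. range a \<subseteq> {..<q} \<and> range b \<subseteq> {..<q}}"

definition enc_ug :: "unique_game \<Rightarrow> bool list" where
  "enc_ug = enc_list (\<lambda>(u, v, \<pi>). enc_nat u @ enc_nat v @ enc_list enc_nat \<pi>)"

definition unique_games_conjecture :: bool where
  "unique_games_conjecture \<longleftrightarrow>
     (\<forall>\<zeta> \<delta> :: real. \<zeta> > 0 \<and> \<delta> > 0 \<longrightarrow>
        (\<exists>q. NP_hard_promise
               {enc_ug G | G. ug_wf q G \<and> ug_value q G \<ge> 1 - \<zeta>}
               {enc_ug G | G. ug_wf q G \<and> ug_value q G \<le> \<delta>}))"


section \<open>Weighted k-Server on the uniform metric\<close>

text \<open>
  The points are \<open>1, \<dots>, points I\<close>, at mutual distance \<open>1\<close>. A server is a pair of its weight and its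
  initial position; server \<open>i \<in> {1..k}\<close> of the usual numbering is the list entry with index \<open>i - 1\<close>,
  and likewise \<open>\<sigma>\<^sub>t\<close> is the entry of \<open>requests I\<close> with index \<open>t - 1\<close>.
\<close>

type_synonym server = "rat \<times> nat"

record wks =
  points :: nat
  servers :: "server list"
  requests :: "nat list"

definition wks_wf :: "wks \<Rightarrow> bool" where
  "wks_wf I \<longleftrightarrow>
     (\<forall>(w, v) \<in> set (servers I). w \<ge> 0 \<and> v \<in> {1..points I}) \<and>
     set (requests I) \<subseteq> {1..points I}"

definition weights :: "wks \<Rightarrow> rat set" where
  "weights I = fst ` set (servers I)"

definition wks_solution :: "wks \<Rightarrow> (nat \<Rightarrow> nat \<Rightarrow> nat) \<Rightarrow> bool" where
  "wks_solution I f \<longleftrightarrow>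
     (\<forall>i<length (servers I). \<forall>t\<le>length (requests I). f i t \<in> {1..points I}) \<and>
     (\<forall>i<length (servers I). f i 0 = snd (servers I ! i)) \<and>
     (\<forall>t\<in>{1..length (requests I)}. \<exists>i<length (servers I). f i t = requests I ! (t - 1))"

definition wks_cost :: "wks \<Rightarrow> (nat \<Rightarrow> nat \<Rightarrow> nat) \<Rightarrow> real" where
  "wks_cost I f =
     1 / 2 * (\<Sum>i<length (servers I). of_rat (fst (servers I ! i)) *
                (\<Sum>t = 1..length (requests I). of_bool (f i t \<noteq> f i (t - 1))))"

definition wks_opt :: "wks \<Rightarrow> real" where
  "wks_opt I = Inf {wks_cost I f | f. wks_solution I f}"

definition class_size :: "wks \<Rightarrow> rat \<Rightarrow> nat" where
  "class_size I w = count_list (map fst (servers I)) w"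

definition add_servers :: "wks \<Rightarrow> server list \<Rightarrow> wks" where
  "add_servers I xs = I\<lparr>servers := servers I @ xs\<rparr>"

text \<open>
  Resource augmentation adds servers \<open>xs\<close> so that every weight class grows from \<open>k\<^sub>j\<close> to
  \<open>\<lfloor>c k\<^sub>j\<rfloor>\<close> (hence no new weight appears). The original servers keep their initial positions; those
  of the additional servers are chosen by the algorithm.
\<close>

definition augmentation :: "real \<Rightarrow> wks \<Rightarrow> server list \<Rightarrow> bool" where
  "augmentation c I xs \<longleftrightarrow>
     wks_wf (add_servers I xs) \<and>
     (\<forall>w. int (class_size (add_servers I xs) w) = \<lfloor>c * real (class_size I w)\<rfloor>)"

definition enc_server :: "server \<Rightarrow> bool list" where
  "enc_server = (\<lambda>(w, v). enc_rat w @ enc_nat v)"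

definition enc_wks :: "wks \<Rightarrow> bool list" where
  "enc_wks I =
     enc_nat (points I) @ enc_list enc_server (servers I) @ enc_list enc_nat (requests I)"

text \<open>
  The answer lists the additional servers and, for every server of the augmented instance, its
  positions at times \<open>0, \<dots>, T\<close>.
\<close>

definition enc_answer :: "wks \<Rightarrow> server list \<Rightarrow> (nat \<Rightarrow> nat \<Rightarrow> nat) \<Rightarrow> bool list" where
  "enc_answer I xs f =
     enc_list enc_server xs @
     enc_list (\<lambda>i. enc_list (\<lambda>t. enc_nat (f i t)) [0..<length (requests I) + 1])
       [0..<length (servers (add_servers I xs))]"

definition two_weight_instances :: "bool list set" where
  "two_weight_instances = {enc_wks I | I. wks_wf I \<and> card (weights I) = 2}"

text \<open>
  \<open>wks_approx c \<rho> x y\<close>: \<open>y\<close> is a \<open>c\<close>-resource-augmented solution for the instance \<open>x\<close> whose cost is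
  at most \<open>\<rho> N\<close> times the unaugmented optimum, with \<open>N\<close> the length of \<open>x\<close> in bits.
\<close>

definition wks_approx :: "real \<Rightarrow> (nat \<Rightarrow> real) \<Rightarrow> bool list \<Rightarrow> bool list \<Rightarrow> bool" where
  "wks_approx c \<rho> x y \<longleftrightarrow>
     (\<exists>I xs f. wks_wf I \<and> x = enc_wks I \<and> y = enc_answer I xs f \<and>
        augmentation c I xs \<and> wks_solution (add_servers I xs) f \<and>
        wks_cost (add_servers I xs) f \<le> \<rho> (length x) * wks_opt I)"

end

(*
  A unique game with labels {..<q} yields a covering problem. A point is a pair of a sample w of L
  edges at a common left vertex and a string y in {0,1}^Q. An edge f of w turns (w, y) into the set
  of labels f(a) with y_a = 1 of the right vertex of f, and every family of h such occurrences at the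
  same right vertex that hits each label at most k times is a set to be covered. A nearly perfect
  labeling gives a good cover: for most w, take the strings with a 0 at the label of w; they are half
  of all, and each other point hits the label of the right vertex, so at most k points of each set
  stay uncovered. Conversely, let a cover miss a constant fraction of the points and leave less than
  h points of each set uncovered. If no probability vector on the labels of a right vertex made
  almost all uncovered points there heavy, multiplicative weights would pick h light points forming a
  set. For most samples the average over the edges of w of these vectors, pulled back to the left
  vertex, is then large on a constant fraction of the cube, so by the second moment two of them
  correlate, and labels drawn from the vectors satisfy a constant fraction of the edges.

  In the k-server instance, heavy servers of weight R sit on the cover (about half of the points),
  k servers of weight 1 serve the uncovered points, and in each of R phases every set is requested R
  times; the cost is of order R. A solution of cost below R^2 has a phase without heavy moves, and in
  it every set has a repetition without any move, which gives a static cover with c-fold resources.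
  Since c < 2, the heavy servers then still miss a constant fraction of the points. For R a large
  power of the number of points and sets the input has size about R^2, so the gap R is N^(1/2 - o(1)).

  Polynomial-time computability of the reduction is derived in a class of functions on binary trees
  that is closed under folds of polynomially bounded size and is compiled to Turing machines over
  stacks; Turing machines are in turn simulated in this class, so that it contains every
  polynomial-time function.
*)
theory Submission
  imports Defs "HOL-Computational_Algebra.Polynomial"
begin

section \<open>Tape programs, stacks, and a function class that coincides with polynomial
  time\<close>

section \<open>Structured tape programs\<close>

text \<open>The bound 2 on the augmentation enters once for each kind of server. Heavy servers: a
  good cover takes a fraction slightly above 1/2 of the points, so \<open>c\<close> times as many
  servers must still miss a constant fraction. Cheap servers: \<open>h\<close> exceeds
  \<open>c\<close> times \<open>k\<close>, yet the bad set of \<open>h\<close> points must hit no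
  label more than \<open>k\<close> times, while each of its points hits with probability up to about
  1/2. Both demands reduce to the one inequality \<open>c * (1/2 + \<eta>) < 1\<close>.

  The conjecture supplies the reduction to unique games only as an abstract polynomial-time
  function, and the construction has to be composed with it. Machines are therefore simulated inside
  a class of functions that is visibly closed under composition, instead of composing machines.

  The reduction receives a solution and not a number. It decides the language by computing the cost
  of this solution in unary, which stays polynomial because the weight \<open>R\<close> is a fixed
  power of the number of samples and sets.\<close>

datatype com =
    Wr nat nat
  | Mv nat move
  | Seq com com (infixr ";;" 60)
  | Br nat com com com
  | Lp nat com com

type_synonym tapes = "nat \<Rightarrow> tape"

definition wr :: "nat \<Rightarrow> nat \<Rightarrow> tapes \<Rightarrow> tapes" where
  "wr i a T = T(i := ((fst (T i))(snd (T i) := a), snd (T i)))"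

definition mv :: "nat \<Rightarrow> move \<Rightarrow> tapes \<Rightarrow> tapes" where
  "mv i m T = T(i := (fst (T i), snd (T i) + shift m))"

text \<open>The number counts the steps of the compiled machine exactly: a write, a move and a test
  of the scanned symbol cost one step each.\<close>

inductive exec :: "com \<Rightarrow> tapes \<Rightarrow> nat \<Rightarrow> tapes \<Rightarrow> bool" where
  Wr: "exec (Wr i a) T 1 (wr i a T)"
| Mv: "exec (Mv i m) T 1 (mv i m T)"
| Seq: "exec c T t T' \<Longrightarrow> exec d T' t' T'' \<Longrightarrow> exec (c ;; d) T (t + t') T''"
| Br0: "tape_read (T i) = 0 \<Longrightarrow> exec c0 T t T' \<Longrightarrow> exec (Br i c0 c1 c2) T (Suc t) T'"
| Br1: "tape_read (T i) = 1 \<Longrightarrow> exec c1 T t T' \<Longrightarrow> exec (Br i c0 c1 c2) T (Suc t) T'"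
| Br2: "tape_read (T i) > 1 \<Longrightarrow> exec c2 T t T' \<Longrightarrow> exec (Br i c0 c1 c2) T (Suc t) T'"
| Lp0: "tape_read (T i) = 0 \<Longrightarrow> exec (Lp i c1 c2) T 1 T"
| Lp1: "tape_read (T i) = 1 \<Longrightarrow> exec c1 T t T' \<Longrightarrow> exec (Lp i c1 c2) T' t' T''
        \<Longrightarrow> exec (Lp i c1 c2) T (Suc (t + t')) T''"
| Lp2: "tape_read (T i) > 1 \<Longrightarrow> exec c2 T t T' \<Longrightarrow> exec (Lp i c1 c2) T' t' T''
        \<Longrightarrow> exec (Lp i c1 c2) T (Suc (t + t')) T''"

text \<open>A control state of a compiled program is a path into its syntax tree.\<close>

type_synonym path = "nat list"

text \<open>A sequence has no control state of its own but starts inside its first component, so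
  composing programs costs no step.\<close>

fun entry :: "com \<Rightarrow> path" where
  "entry (c ;; d) = 0 # entry c"
| "entry _ = []"

text \<open>A machine step writes on every tape; an idle tape rewrites the symbol it has just
  read.\<close>

definition stay :: "(nat \<Rightarrow> nat) \<Rightarrow> nat \<Rightarrow> nat \<times> move" where
  "stay r = (\<lambda>j. (r j, MStay))"

text \<open>A step of the child program \<open>k\<close> as seen by its parent: the next state is
  prefixed with \<open>k\<close>, and \<open>e\<close> is where the parent continues once the child
  has halted.\<close>

definition sub :: "nat \<Rightarrow> path option \<Rightarrow> path option \<times> 'b \<Rightarrow> path option \<times> 'b" where
  "sub k e x = (case fst x of None \<Rightarrow> e | Some q \<Rightarrow> Some (k # q), snd x)"

definition sel :: "nat \<Rightarrow> 'a \<Rightarrow> 'a \<Rightarrow> 'a \<Rightarrow> 'a" where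
  "sel a x y z = (if a = 0 then x else if a = 1 then y else z)"

fun nxt :: "com \<Rightarrow> path \<Rightarrow> (nat \<Rightarrow> nat) \<Rightarrow> path option \<times> (nat \<Rightarrow> nat \<times> move)" where
  "nxt (Wr i a) q r = (None, (stay r)(i := (a, MStay)))"
| "nxt (Mv i m) q r = (None, (stay r)(i := (r i, m)))"
| "nxt (c ;; d) (k # q) r =
     (if k = 0 then sub 0 (Some (1 # entry d)) (nxt c q r) else sub 1 None (nxt d q r))"
| "nxt (Br i c0 c1 c2) [] r =
     (Some (sel (r i) (0 # entry c0) (1 # entry c1) (2 # entry c2)), stay r)"
| "nxt (Br i c0 c1 c2) (k # q) r = sub k None (sel k (nxt c0 q r) (nxt c1 q r) (nxt c2 q r))"
| "nxt (Lp i c1 c2) [] r =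
     (sel (r i) None (Some (1 # entry c1)) (Some (2 # entry c2)), stay r)"
| "nxt (Lp i c1 c2) (k # q) r = sub k (Some []) (if k = 1 then nxt c1 q r else nxt c2 q r)"
| "nxt _ _ r = (None, stay r)"

fun paths :: "com \<Rightarrow> path set" where
  "paths (c ;; d) = (#) 0 ` paths c \<union> (#) 1 ` paths d"
| "paths (Br i c0 c1 c2) = insert [] ((#) 0 ` paths c0 \<union> (#) 1 ` paths c1 \<union> (#) 2 ` paths c2)"
| "paths (Lp i c1 c2) = insert [] ((#) 1 ` paths c1 \<union> (#) 2 ` paths c2)"
| "paths _ = {[]}"

lemma finite_paths [simp]: "finite (paths c)"
  by (induction c) auto

lemma entry_paths [simp]: "entry c \<in> paths c"
  by (induction c) auto

lemma sub_SomeD: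
  "fst (sub k e x) = Some q \<Longrightarrow> fst x = None \<and> e = Some q \<or> (\<exists>p. fst x = Some p \<and> q = k # p)"
  by (auto simp: sub_def split: option.splits)

lemma nxt_paths: "q \<in> paths c \<Longrightarrow> fst (nxt c q r) = Some q' \<Longrightarrow> q' \<in> paths c"
proof (induction c arbitrary: q q')
  case (Seq c d)
  from Seq.prems(1) consider p where "q = 0 # p" "p \<in> paths c" | p where "q = 1 # p" "p \<in> paths d"
    by auto
  then show ?case by cases (use Seq in \<open>auto dest!: sub_SomeD\<close>)
next
  case (Br i c0 c1 c2)
  from Br.prems(1) consider "q = []" | p where "q = 0 # p" "p \<in> paths c0"
    | p where "q = 1 # p" "p \<in> paths c1" | p where "q = 2 # p" "p \<in> paths c2"
    by auto
  then show ?case by cases (use Br in \<open>auto simp: sel_def dest!: sub_SomeD split: if_splits\<close>)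
next
  case (Lp i c1 c2)
  from Lp.prems(1) consider "q = []" | p where "q = 1 # p" "p \<in> paths c1"
    | p where "q = 2 # p" "p \<in> paths c2"
    by auto
  then show ?case by cases (use Lp in \<open>auto simp: sel_def dest!: sub_SomeD split: if_splits\<close>)
qed auto

definition reads :: "tapes \<Rightarrow> nat \<Rightarrow> nat" where
  "reads T = (\<lambda>j. tape_read (T j))"

definition acts :: "(nat \<Rightarrow> nat \<times> move) \<Rightarrow> tapes \<Rightarrow> tapes" where
  "acts A T = (\<lambda>j. tape_act (A j) (T j))"

lemma act_stay: "tape_act (tape_read x, MStay) x = x"
  by (simp add: tape_act_def tape_read_def prod_eq_iff)

lemma acts_stay [simp]: "acts (stay (reads T)) T = T"
  by (rule ext) (simp add: acts_def stay_def reads_def act_stay)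

inductive run :: "com \<Rightarrow> path \<Rightarrow> tapes \<Rightarrow> nat \<Rightarrow> tapes \<Rightarrow> bool" for c where
  last: "nxt c q (reads T) = (None, A) \<Longrightarrow> run c q T 1 (acts A T)"
| more: "nxt c q (reads T) = (Some q', A) \<Longrightarrow> run c q' (acts A T) t T' \<Longrightarrow> run c q T (Suc t) T'"

lemma run_Seq2: "run d q T t T' \<Longrightarrow> run (c ;; d) (1 # q) T t T'"
proof (induction rule: run.induct)
  case (last q T A)
  then show ?case using run.last[of "c ;; d" "1 # q" T A] by (simp add: sub_def)
next
  case (more q T q' A t T')
  then show ?case by (intro run.more[where q' = "1 # q'" and A = A]) (auto simp: sub_def)
qed

lemma run_Seq:
  "run c q T t T' \<Longrightarrow> run d (entry d) T' t' T'' \<Longrightarrow> run (c ;; d) (0 # q) T (t + t') T''"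
proof (induction rule: run.induct)
  case (last q T A)
  then show ?case
    using run.more[of "c ;; d" "0 # q" T "1 # entry d" A t' T''] run_Seq2[of d "entry d" _ t' T'' c]
    by (simp add: sub_def)
next
  case (more q T q' A t T')
  then have "run (c ;; d) (0 # q') (acts A T) (t + t') T''" by simp
  from run.more[OF _ this, of "0 # q"] show ?case using more.hyps by (simp add: sub_def)
qed

lemma run_sub:
  assumes "\<And>q r. nxt e (k # q) r = sub k None (nxt c q r)"
  shows "run c q T t T' \<Longrightarrow> run e (k # q) T t T'"
proof (induction rule: run.induct)
  case (last q T A)
  then show ?case using run.last[of e "k # q" T A] by (simp add: sub_def assms)
next
  case (more q T q' A t T')
  then show ?case by (intro run.more[where q' = "k # q'" and A = A]) (auto simp: sub_def assms)
qed

lemma run_loop: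
  assumes "\<And>q r. nxt e (k # q) r = sub k (Some []) (nxt c q r)"
  shows "run c q T t T' \<Longrightarrow> run e [] T' t' T'' \<Longrightarrow> run e (k # q) T (t + t') T''"
proof (induction rule: run.induct)
  case (last q T A)
  then show ?case using run.more[of e "k # q" T "[]" A t' T''] by (simp add: sub_def assms)
next
  case (more q T q' A t T')
  then have "run e (k # q') (acts A T) (t + t') T''" by simp
  from run.more[OF _ this, of "k # q"] show ?case using more.hyps by (simp add: sub_def assms)
qed

lemma exec_run: "exec c T t T' \<Longrightarrow> run c (entry c) T t T'"
proof (induction rule: exec.induct)
  case (Wr i a T)
  have "acts ((stay (reads T))(i := (a, MStay))) T = wr i a T"
    by (rule ext) (auto simp: acts_def wr_def tape_act_def stay_def reads_def tape_read_def prod_eq_iff)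
  then show ?case using run.last[of "Wr i a" "[]" T "(stay (reads T))(i := (a, MStay))"] by simp
next
  case (Mv i m T)
  have "acts ((stay (reads T))(i := (reads T i, m))) T = mv i m T"
    by (rule ext) (auto simp: acts_def mv_def tape_act_def stay_def reads_def tape_read_def prod_eq_iff)
  then show ?case using run.last[of "Mv i m" "[]" T "(stay (reads T))(i := (reads T i, m))"] by simp
next
  case (Seq c T t T' d t' T'')
  then show ?case using run_Seq by simp
next
  case (Br0 T i c0 t T' c1 c2)
  have "run (Br i c0 c1 c2) (0 # entry c0) T t T'"
    by (rule run_sub[OF _ Br0.IH]) (simp add: sel_def)
  moreover have "reads T i = 0" using Br0.hyps by (simp add: reads_def)
  ultimately show ?case
    by (auto intro!: run.more[where q' = "0 # entry c0" and A = "stay (reads T)"] simp: sel_def)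
next
  case (Br1 T i c1 t T' c0 c2)
  have "run (Br i c0 c1 c2) (1 # entry c1) T t T'"
    by (rule run_sub[OF _ Br1.IH]) (simp add: sel_def)
  moreover have "reads T i = Suc 0" using Br1.hyps by (simp add: reads_def)
  ultimately show ?case
    by (auto intro!: run.more[where q' = "1 # entry c1" and A = "stay (reads T)"] simp: sel_def)
next
  case (Br2 T i c2 t T' c0 c1)
  have "run (Br i c0 c1 c2) (2 # entry c2) T t T'"
    by (rule run_sub[OF _ Br2.IH]) (simp add: sel_def)
  moreover have "reads T i > Suc 0" using Br2.hyps by (simp add: reads_def)
  ultimately show ?case
    by (auto intro!: run.more[where q' = "2 # entry c2" and A = "stay (reads T)"] simp: sel_def)
next
  case (Lp0 T i c1 c2)
  then have "reads T i = 0" by (simp add: reads_def)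
  then show ?case using run.last[of "Lp i c1 c2" "[]" T "stay (reads T)"] by (simp add: sel_def)
next
  case (Lp1 T i c1 t T' c2 t' T'')
  have "run (Lp i c1 c2) (1 # entry c1) T (t + t') T''"
    by (rule run_loop[OF _ Lp1.IH(1)]) (use Lp1.IH(2) in simp_all)
  moreover have "reads T i = Suc 0" using Lp1.hyps by (simp add: reads_def)
  ultimately show ?case
    by (auto intro!: run.more[where q' = "1 # entry c1" and A = "stay (reads T)"] simp: sel_def)
next
  case (Lp2 T i c2 t T' c1 t' T'')
  have "run (Lp i c1 c2) (2 # entry c2) T (t + t') T''"
    by (rule run_loop[OF _ Lp2.IH(1)]) (use Lp2.IH(2) in simp_all)
  moreover have "reads T i > Suc 0" using Lp2.hyps by (simp add: reads_def)
  ultimately show ?case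
    by (auto intro!: run.more[where q' = "2 # entry c2" and A = "stay (reads T)"] simp: sel_def)
qed

fun fits :: "nat \<Rightarrow> com \<Rightarrow> bool" where
  "fits K (Wr i a) \<longleftrightarrow> i < K \<and> a < 3"
| "fits K (Mv i m) \<longleftrightarrow> i < K"
| "fits K (c ;; d) \<longleftrightarrow> fits K c \<and> fits K d"
| "fits K (Br i c0 c1 c2) \<longleftrightarrow> i < K \<and> fits K c0 \<and> fits K c1 \<and> fits K c2"
| "fits K (Lp i c1 c2) \<longleftrightarrow> i < K \<and> fits K c1 \<and> fits K c2"

lemma fits_mono: "fits K c \<Longrightarrow> K \<le> K' \<Longrightarrow> fits K' c"
  by (induction c) auto

lemma nxt_symbols:
  "fits K c \<Longrightarrow> (\<And>j. r j < 3) \<Longrightarrow> fst (snd (nxt c q r) j) < 3"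
  by (induction c q r rule: nxt.induct) (auto simp: sub_def sel_def stay_def split: if_splits)

text \<open>Programs act on infinitely many tapes, the machine on the first \<open>K\<close> only.
  \<open>compile\<close> feeds the symbol 0 for all others; by this locality the replacement changes
  neither the control nor the tapes that exist.\<close>

lemma nxt_local:
  "fits K c \<Longrightarrow> (\<And>j. j < K \<Longrightarrow> r j = r' j) \<Longrightarrow>
     fst (nxt c q r) = fst (nxt c q r') \<and> (\<forall>j<K. snd (nxt c q r) j = snd (nxt c q r') j)"
  by (induction c q r rule: nxt.induct) (auto simp: sub_def sel_def stay_def split: if_splits)

text \<open>The entry comes first because a machine starts in state 0.\<close>

definition enumeration :: "com \<Rightarrow> path list" where
  "enumeration c = entry c # (SOME xs. distinct xs \<and> set xs = paths c - {entry c})"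

lemma enumeration: "distinct (enumeration c)" "set (enumeration c) = paths c"
proof -
  have "\<exists>xs. distinct xs \<and> set xs = paths c - {entry c}"
    using finite_distinct_list[of "paths c - {entry c}"] by auto
  from someI_ex[OF this] show "distinct (enumeration c)" "set (enumeration c) = paths c"
    unfolding enumeration_def by (auto simp: insert_absorb)
qed

definition code_of :: "com \<Rightarrow> path \<Rightarrow> nat" where
  "code_of c q = (THE i. i < length (enumeration c) \<and> enumeration c ! i = q)"

lemma code_of:
  assumes "q \<in> paths c"
  shows "code_of c q < length (enumeration c)" "enumeration c ! code_of c q = q"
proof -
  obtain i where i: "i < length (enumeration c)" "enumeration c ! i = q"
    using assms enumeration by (metis in_set_conv_nth)
  have "code_of c q = i" unfolding code_of_def
    by (rule the_equality) (use i enumeration nth_eq_iff_index_eq in blast)+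
  with i show "code_of c q < length (enumeration c)" "enumeration c ! code_of c q = q" by auto
qed

lemma code_of_entry: "code_of c (entry c) = 0"
  unfolding code_of_def
  by (rule the_equality, simp add: enumeration_def)
     (metis enumeration(1) enumeration_def length_greater_0_conv list.distinct(1) nth_Cons_0 nth_eq_iff_index_eq)

definition compile :: "nat \<Rightarrow> com \<Rightarrow> tm" where
  "compile K c = \<lparr>tapes = K, states = length (enumeration c), symbols = 3,
     delta = (\<lambda>q s. let x = nxt c (enumeration c ! q) (\<lambda>j. if j < K then s ! j else 0)
       in (case fst x of None \<Rightarrow> length (enumeration c) | Some q' \<Rightarrow> code_of c q',
           map (snd x) [0..<K]))\<rparr>"

lemma compile_wf:
  assumes "fits K c" "K \<ge> 1"
  shows "tm_wf (compile K c)"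
proof -
  have *: "fst (delta (compile K c) q s) \<le> states (compile K c) \<and>
        length (snd (delta (compile K c) q s)) = tapes (compile K c) \<and>
        (\<forall>a\<in>set (snd (delta (compile K c) q s)). fst a < symbols (compile K c))"
    if q: "q < states (compile K c)" and s: "length s = tapes (compile K c)"
      "\<forall>a\<in>set s. a < symbols (compile K c)" for q s
  proof -
    define r where "r = (\<lambda>j. if j < K then s ! j else 0)"
    have r3: "r j < 3" for j
      using s nth_mem[of j s] by (auto simp: r_def compile_def)
    have q': "enumeration c ! q \<in> paths c"
      using q enumeration(2) nth_mem by (force simp: compile_def)
    have "fst (snd (nxt c (enumeration c ! q) r) j) < 3" for j
      by (rule nxt_symbols[OF assms(1) r3])
    moreover have "code_of c q' < length (enumeration c)"
      if "fst (nxt c (enumeration c ! q) r) = Some q'" for q'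
      by (rule code_of[OF nxt_paths[OF q' that]])
    ultimately show ?thesis
      by (auto simp: compile_def Let_def r_def[symmetric] less_imp_le split: option.splits)
  qed
  have "tapes (compile K c) \<ge> 1" "symbols (compile K c) \<ge> 3"
    using assms(2) by (simp_all add: compile_def)
  then show ?thesis unfolding tm_wf_def
  proof (intro conjI[OF _ conjI])
    show "\<forall>q s. q < states (compile K c) \<and> length s = tapes (compile K c) \<and>
        (\<forall>a\<in>set s. a < symbols (compile K c)) \<longrightarrow>
        fst (delta (compile K c) q s) \<le> states (compile K c) \<and>
        length (snd (delta (compile K c) q s)) = tapes (compile K c) \<and>
        (\<forall>a\<in>set (snd (delta (compile K c) q s)). fst a < symbols (compile K c))"
      by (intro allI impI, elim conjE, rule *)
  qed
qed

lemma compile_step: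
  assumes "fits K c" "q \<in> paths c" "nxt c q (reads T) = (q', A)"
  shows "tm_step (compile K c) (code_of c q, map T [0..<K]) =
     (case q' of None \<Rightarrow> length (enumeration c) | Some p \<Rightarrow> code_of c p, map (acts A T) [0..<K])"
proof -
  define r where "r = (\<lambda>j. if j < K then map (tape_read \<circ> T) [0..<K] ! j else 0)"
  have r: "j < K \<Longrightarrow> r j = reads T j" for j by (simp add: r_def reads_def)
  have *: "fst (nxt c q r) = q'" "\<And>j. j < K \<Longrightarrow> snd (nxt c q r) j = A j"
    using nxt_local[of K c r "reads T" q, OF assms(1) r] assms(3) by auto
  have "map2 tape_act (map (snd (nxt c q r)) [0..<K]) (map T [0..<K]) = map (acts A T) [0..<K]"
    by (rule nth_equalityI) (auto simp: acts_def *(2))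
  then show ?thesis using code_of[OF assms(2)] *(1) unfolding r_def
    by (simp add: tm_step_def compile_def Let_def)
qed

lemma compile_run:
  assumes "fits K c"
  shows "run c q T t T' \<Longrightarrow> q \<in> paths c \<Longrightarrow>
     (tm_step (compile K c) ^^ t) (code_of c q, map T [0..<K]) =
       (length (enumeration c), map T' [0..<K])"
proof (induction rule: run.induct)
  case (last q T A)
  then show ?case using compile_step[OF assms] by simp
next
  case (more q T q' A t T')
  have "q' \<in> paths c" using nxt_paths[OF more.prems] more.hyps(1) by (metis fst_conv)
  note IH = more.IH[OF this]
  have "tm_step (compile K c) (code_of c q, map T [0..<K]) = (code_of c q', map (acts A T) [0..<K])"
    using compile_step[OF assms more.prems more.hyps(1)] by simp
  then show ?case using IH by (simp only: funpow_Suc_right o_apply)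
qed

definition init_tapes :: "bool list \<Rightarrow> tapes" where
  "init_tapes x = (\<lambda>j. if j = 0 then input_tape x else blank_tape)"

lemma poly_nat_mono: "m \<le> n \<Longrightarrow> poly (p :: nat poly) m \<le> poly p n"
  by (induction p) (simp_all add: mult_le_mono)

text \<open>For n at least 2 the constant factor \<open>a\<close> satisfies a <= 2^a <= n^a and is
  absorbed by the exponent; the values at 0 and 1 are absorbed by the additive constant. The shape
  n^k + k is the one demanded by \<open>polytime\<close>.\<close>

lemma poly_nat_power_bound: "\<exists>k. \<forall>n. poly (p :: nat poly) n \<le> n ^ k + k"
proof -
  define a where "a = sum (coeff p) {..degree p} + 2"
  have *: "poly p n \<le> a * n ^ degree p" if "n \<ge> 1" for n
  proof -
    have "poly p n = (\<Sum>i\<le>degree p. coeff p i * n ^ i)" by (rule poly_altdef)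
    also have "\<dots> \<le> (\<Sum>i\<le>degree p. coeff p i * n ^ degree p)"
      by (intro sum_mono mult_left_mono power_increasing) (use that in auto)
    also have "\<dots> \<le> a * n ^ degree p" by (simp add: a_def sum_distrib_right)
    finally show ?thesis .
  qed
  define k where "k = degree p + a + poly p 0 + poly p 1"
  have "poly p n \<le> n ^ k + k" for n
  proof (cases "n \<ge> 2")
    case True
    have "a \<le> 2 ^ a" by (simp add: less_imp_le)
    also have "\<dots> \<le> n ^ a" using True by (simp add: power_mono)
    finally have "a * n ^ degree p \<le> n ^ a * n ^ degree p" by simp
    also have "\<dots> = n ^ (a + degree p)" by (simp add: power_add)
    also have "\<dots> \<le> n ^ k" using True by (intro power_increasing) (auto simp: k_def)
    finally show ?thesis using *[of n] True by simp
  next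
    case False
    then have "n = 0 \<or> n = 1" by auto
    then show ?thesis by (auto simp: k_def)
  qed
  then show ?thesis by blast
qed

lemma polytimeI:
  fixes p :: "nat poly"
  assumes "fits K c" "K \<ge> 1"
    and "\<And>x. \<exists>t T. t \<le> poly p (length x) \<and> exec c (init_tapes x) t T \<and>
      (\<forall>i<length (f x). fst (T 0) (int i) = bit_sym (f x ! i)) \<and>
      fst (T 0) (int (length (f x))) = 0"
  shows "polytime f"
proof -
  obtain k where k: "\<And>n. poly p n \<le> n ^ k + k" using poly_nat_power_bound by blast
  have "\<exists>t \<le> length x ^ k + k.
      fst ((tm_step (compile K c) ^^ t) (tm_init (compile K c) x)) = states (compile K c) \<and>
      tm_outputs ((tm_step (compile K c) ^^ t) (tm_init (compile K c) x)) (f x)" for x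
  proof -
    obtain t T where t: "t \<le> poly p (length x)" "exec c (init_tapes x) t T"
      "\<forall>i<length (f x). fst (T 0) (int i) = bit_sym (f x ! i)"
      "fst (T 0) (int (length (f x))) = 0" using assms(3) by blast
    have "map (init_tapes x) [0..<K] = input_tape x # replicate (K - 1) blank_tape"
      using assms(2) by (intro nth_equalityI) (auto simp: init_tapes_def nth_Cons split: nat.splits)
    then have "tm_init (compile K c) x = (code_of c (entry c), map (init_tapes x) [0..<K])"
      by (simp add: tm_init_def code_of_entry compile_def)
    then have "(tm_step (compile K c) ^^ t) (tm_init (compile K c) x) =
        (length (enumeration c), map T [0..<K])"
      using compile_run[OF assms(1) exec_run[OF t(2)]] by simp
    moreover have "hd (map T [0..<K]) = T 0" using assms(2) by (simp add: hd_map)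
    ultimately show ?thesis using t(3,4) le_trans[OF t(1) k]
      by (intro exI[of _ t]) (simp add: tm_outputs_def compile_def)
  qed
  then show ?thesis unfolding polytime_def
    using compile_wf[OF assms(1,2)] by (intro exI[of _ "compile K c"] exI[of _ k]) blast
qed

section \<open>Stacks on tapes\<close>

text \<open>A tape is read as the stack of bits from the head to the first blank on its right; cells to the
  left of the head are free.\<close>

primrec stk :: "tape \<Rightarrow> bool list \<Rightarrow> bool" where
  "stk tp [] \<longleftrightarrow> tape_read tp = 0"
| "stk tp (b # xs) \<longleftrightarrow> tape_read tp = bit_sym b \<and> stk (fst tp, snd tp + 1) xs"

lemma stk_upd: "j < snd tp \<Longrightarrow> stk ((fst tp)(j := a), snd tp) xs \<longleftrightarrow> stk tp xs"
proof (induction xs arbitrary: tp)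
  case (Cons b xs)
  then show ?case using Cons.IH[of "(fst tp, snd tp + 1)"] by (simp add: tape_read_def)
qed (simp add: tape_read_def)

type_synonym stacks = "nat \<Rightarrow> bool list"

definition holds :: "tapes \<Rightarrow> stacks \<Rightarrow> bool" where
  "holds T S \<longleftrightarrow> (\<forall>i\<ge>1. stk (T i) (S i))"

text \<open>Tape \<open>0\<close> is reserved for input and output.\<close>

definition runs_io :: "com \<Rightarrow> nat \<Rightarrow> tape \<Rightarrow> stacks \<Rightarrow> tape \<Rightarrow> stacks \<Rightarrow> bool" where
  "runs_io c t u S u' S' \<longleftrightarrow> (\<forall>T. holds T S \<longrightarrow> T 0 = u \<longrightarrow>
     (\<exists>t'\<le>t. \<exists>T'. exec c T t' T' \<and> holds T' S' \<and> T' 0 = u'))"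

text \<open>Tape 0 keeps its content, whatever it is. The time is only an upper bound, so that both
  branches of a test can be given the same one.\<close>

definition runs :: "com \<Rightarrow> nat \<Rightarrow> stacks \<Rightarrow> stacks \<Rightarrow> bool" where
  "runs c t S S' \<longleftrightarrow> (\<forall>u. runs_io c t u S u S')"

definition push :: "nat \<Rightarrow> bool \<Rightarrow> com" where
  "push i b = Mv i MLeft ;; Wr i (bit_sym b)"

definition pop :: "nat \<Rightarrow> com" where
  "pop i = Mv i MRight"

definition loop :: "nat \<Rightarrow> com \<Rightarrow> com \<Rightarrow> com" where
  "loop i c d = Lp i (pop i ;; c) (pop i ;; d)"

definition branch :: "nat \<Rightarrow> com \<Rightarrow> com \<Rightarrow> com" where
  "branch i c d = Br i (pop i) (pop i ;; c) (pop i ;; d)"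

definition nop :: com where
  "nop = Mv 1 MStay"

lemma runs_io_mono: "runs_io c t u S u' S' \<Longrightarrow> t \<le> t' \<Longrightarrow> runs_io c t' u S u' S'"
  unfolding runs_io_def using le_trans by blast

lemma runs_mono: "runs c t S S' \<Longrightarrow> t \<le> t' \<Longrightarrow> runs c t' S S'"
  unfolding runs_def using runs_io_mono by blast

lemma runs_conseq: "runs c t S S1 \<Longrightarrow> S1 = S' \<Longrightarrow> t \<le> t' \<Longrightarrow> runs c t' S S'"
  using runs_mono by blast

lemma runs_io_Seq:
  assumes "runs_io c t u S u' S'" "runs_io d t' u' S' u'' S''"
  shows "runs_io (c ;; d) (t + t') u S u'' S''"
  unfolding runs_io_def
proof (intro allI impI)
  fix T assume "holds T S" "T 0 = u"
  then obtain v T' where v: "v \<le> t" "exec c T v T'" "holds T' S'" "T' 0 = u'"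
    using assms(1) unfolding runs_io_def by blast
  then obtain w T'' where w: "w \<le> t'" "exec d T' w T''" "holds T'' S''" "T'' 0 = u''"
    using assms(2) unfolding runs_io_def by blast
  have "exec (c ;; d) T (v + w) T''" by (rule exec.Seq[OF v(2) w(2)])
  with v w show "\<exists>v\<le>t + t'. \<exists>T'. exec (c ;; d) T v T' \<and> holds T' S'' \<and> T' 0 = u''"
    by (intro exI[of _ "v + w"] exI[of _ T''] conjI) simp_all
qed

lemma runs_Seq: "runs c t S S' \<Longrightarrow> runs d t' S' S'' \<Longrightarrow> runs (c ;; d) (t + t') S S''"
  unfolding runs_def using runs_io_Seq by blast

lemma runs_nop: "runs nop 1 S S"
proof -
  have "mv 1 MStay T = T" for T by (rule ext) (simp add: mv_def)
  then show ?thesis unfolding runs_def runs_io_def nop_def by (metis exec.Mv order_refl)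
qed

lemma runs_pop:
  assumes "i \<ge> 1" "S i = b # xs"
  shows "runs (pop i) 1 S (S(i := xs))"
  unfolding runs_def runs_io_def pop_def
proof (intro allI impI)
  fix T u assume "holds T S" "T 0 = u"
  with assms have "holds (mv i MRight T) (S(i := xs))" unfolding holds_def mv_def by fastforce
  then show "\<exists>t'\<le>1. \<exists>T'. exec (Mv i MRight) T t' T' \<and> holds T' (S(i := xs)) \<and> T' 0 = u"
    using assms(1) exec.Mv[of i MRight T] \<open>T 0 = u\<close>
    by (intro exI[of _ "1::nat"] conjI exI[of _ "mv i MRight T"]) (simp_all add: mv_def)
qed

lemma runs_push:
  assumes "i \<ge> 1"
  shows "runs (push i b) 2 S (S(i := b # S i))"
  unfolding runs_def runs_io_def push_def
proof (intro allI impI)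
  fix T u assume T: "holds T S" "T 0 = u"
  define T' where "T' = wr i (bit_sym b) (mv i MLeft T)"
  have "T' i = ((fst (T i))(snd (T i) - 1 := bit_sym b), snd (T i) - 1)"
    by (simp add: T'_def wr_def mv_def)
  then have "stk (T' i) (b # S i)"
    using T assms stk_upd[of "snd (T i) - 1" "T i" "bit_sym b" "S i"] by (simp add: tape_read_def holds_def)
  moreover have "j \<noteq> i \<Longrightarrow> T' j = T j" for j by (simp add: T'_def wr_def mv_def)
  ultimately have "holds T' (S(i := b # S i))" "T' 0 = u"
    using T assms by (auto simp: holds_def)
  moreover have "exec (Mv i MLeft ;; Wr i (bit_sym b)) T (1 + 1) T'"
    unfolding T'_def by (rule exec.Seq[OF exec.Mv exec.Wr])
  ultimately show "\<exists>t'\<le>2. \<exists>T'. exec (Mv i MLeft ;; Wr i (bit_sym b)) T t' T' \<and>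
      holds T' (S(i := b # S i)) \<and> T' 0 = u"
    by (intro exI[of _ "1 + 1 :: nat"] exI[of _ T'] conjI) simp_all
qed

lemma holds_read:
  assumes "holds T S" "i \<ge> 1"
  shows "S i = [] \<Longrightarrow> tape_read (T i) = 0"
    and "S i = b # xs \<Longrightarrow> tape_read (T i) = (if b then 2 else 1)"
  using assms unfolding holds_def by (auto simp: bit_sym_def dest!: spec[of _ i])

lemma runs_loop_Nil:
  assumes "i \<ge> 1" "S i = []"
  shows "runs (loop i c d) 1 S S"
  unfolding runs_def runs_io_def loop_def
proof (intro allI impI)
  fix T u assume "holds T S" "T 0 = u"
  from exec.Lp0[of T i, OF holds_read(1)[OF this(1) assms]]
  show "\<exists>t'\<le>1. \<exists>T'. exec (Lp i (pop i ;; c) (pop i ;; d)) T t' T' \<and> holds T' S \<and> T' 0 = u"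
    using \<open>holds T S\<close> \<open>T 0 = u\<close> by blast
qed

lemma runs_io_loop_Cons:
  assumes "i \<ge> 1" "S i = b # xs" "runs_io (if b then d else c) t u (S(i := xs)) u' S'"
    and "runs_io (loop i c d) t' u' S' u'' S''"
  shows "runs_io (loop i c d) (t + t' + 2) u S u'' S''"
  unfolding runs_io_def
proof (intro allI impI)
  fix T assume T: "holds T S" "T 0 = u"
  have "runs_io (pop i) 1 u S u (S(i := xs))" using runs_pop[of i S, OF assms(1,2)] unfolding runs_def by blast
  from runs_io_Seq[OF this assms(3)]
  obtain v T' where v: "v \<le> 1 + t" "exec (pop i ;; (if b then d else c)) T v T'" "holds T' S'" "T' 0 = u'"
    using T unfolding runs_io_def by blast
  obtain w T'' where w: "w \<le> t'" "exec (loop i c d) T' w T''" "holds T'' S''" "T'' 0 = u''"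
    using v(3,4) assms(4) unfolding runs_io_def by blast
  have "exec (loop i c d) T (Suc (v + w)) T''"
    using v(2) w(2) holds_read(2)[OF T(1) assms(1,2)] unfolding loop_def
    by (cases b) (auto intro: exec.Lp1 exec.Lp2)
  with v w show "\<exists>v\<le>t + t' + 2. \<exists>T'. exec (loop i c d) T v T' \<and> holds T' S'' \<and> T' 0 = u''"
    by (intro exI[of _ "Suc (v + w)"] exI[of _ T''] conjI) simp_all
qed

lemma runs_io_branch:
  assumes "i \<ge> 1" "S i = b # xs" "runs_io (if b then d else c) t u (S(i := xs)) u' S'"
  shows "runs_io (branch i c d) (t + 2) u S u' S'"
  unfolding runs_io_def
proof (intro allI impI)
  fix T assume T: "holds T S" "T 0 = u"
  have "runs_io (pop i) 1 u S u (S(i := xs))" using runs_pop[of i S, OF assms(1,2)] unfolding runs_def by blast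
  from runs_io_Seq[OF this assms(3)]
  obtain v T' where v: "v \<le> 1 + t" "exec (pop i ;; (if b then d else c)) T v T'" "holds T' S'" "T' 0 = u'"
    using T unfolding runs_io_def by blast
  have "exec (branch i c d) T (Suc v) T'"
    using v(2) holds_read(2)[OF T(1) assms(1,2)] unfolding branch_def
    by (cases b) (auto intro: exec.Br1 exec.Br2)
  with v show "\<exists>v\<le>t + 2. \<exists>T'. exec (branch i c d) T v T' \<and> holds T' S' \<and> T' 0 = u'"
    by (intro exI[of _ "Suc v"] exI[of _ T'] conjI) simp_all
qed

lemma runs_loop_Cons:
  assumes "i \<ge> 1" "S i = b # xs" "runs (if b then d else c) t (S(i := xs)) S'"
    and "runs (loop i c d) t' S' S''"
  shows "runs (loop i c d) (t + t' + 2) S S''"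
  using assms runs_io_loop_Cons unfolding runs_def by blast

lemma runs_branch:
  assumes "i \<ge> 1" "S i = b # xs" "runs (if b then d else c) t (S(i := xs)) S'"
  shows "runs (branch i c d) (t + 2) S S'"
  using assms runs_io_branch unfolding runs_def by blast

lemma runs_loop_True:
  assumes "i \<ge> 1" "S i = True # xs" "runs d t (S(i := xs)) S'" "runs (loop i c d) t' S' S''"
  shows "runs (loop i c d) (t + t' + 2) S S''"
  using runs_loop_Cons[of i S True xs] assms by simp

lemma runs_loop_False:
  assumes "i \<ge> 1" "S i = False # xs" "runs c t (S(i := xs)) S'" "runs (loop i c d) t' S' S''"
  shows "runs (loop i c d) (t + t' + 2) S S''"
  using runs_loop_Cons[of i S False xs] assms by simp

definition move_all :: "nat \<Rightarrow> nat \<Rightarrow> com" where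
  "move_all a b = loop a (push b False) (push b True)"

definition move_all2 :: "nat \<Rightarrow> nat \<Rightarrow> nat \<Rightarrow> com" where
  "move_all2 a b c = loop a (push b False ;; push c False) (push b True ;; push c True)"

definition clear :: "nat \<Rightarrow> com" where
  "clear a = loop a nop nop"

primrec push_list :: "nat \<Rightarrow> bool list \<Rightarrow> com" where
  "push_list i [] = nop"
| "push_list i (b # xs) = push_list i xs ;; push i b"

lemma runs_move_all:
  assumes "a \<ge> 1" "b \<ge> 1" "a \<noteq> b"
  shows "S a = xs \<Longrightarrow> S b = ys \<Longrightarrow> runs (move_all a b) (4 * length xs + 1) S (S(a := [], b := rev xs @ ys))"
proof (induction xs arbitrary: S ys)
  case Nil
  then show ?case unfolding move_all_def
    by (intro runs_conseq[OF runs_loop_Nil]) (use assms in \<open>auto simp: fun_upd_idem\<close>)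
next
  case (Cons x xs)
  have 1: "runs (if x then push b True else push b False) 2 (S(a := xs)) (S(a := xs, b := x # ys))"
    using runs_push[of b x "S(a := xs)"] Cons.prems assms by (cases x) auto
  have "runs (move_all a b) (4 * length xs + 1) (S(a := xs, b := x # ys))
      (S(a := xs, b := x # ys, a := [], b := rev xs @ x # ys))"
    by (rule Cons.IH) (use assms in auto)
  with 1 have "runs (move_all a b) (2 + (4 * length xs + 1) + 2) S
      (S(a := xs, b := x # ys, a := [], b := rev xs @ x # ys))"
    unfolding move_all_def using runs_loop_Cons[of a S x xs, OF assms(1) Cons.prems(1)] by blast
  then show ?case by (rule runs_conseq) (use assms in \<open>auto simp: fun_eq_iff\<close>)
qed

lemma runs_move_all2:
  assumes "a \<ge> 1" "b \<ge> 1" "c \<ge> 1" "a \<noteq> b" "a \<noteq> c" "b \<noteq> c"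
  shows "S a = xs \<Longrightarrow> S b = ys \<Longrightarrow> S c = zs \<Longrightarrow>
    runs (move_all2 a b c) (6 * length xs + 1) S (S(a := [], b := rev xs @ ys, c := rev xs @ zs))"
proof (induction xs arbitrary: S ys zs)
  case Nil
  then show ?case unfolding move_all2_def
    by (intro runs_conseq[OF runs_loop_Nil]) (use assms in \<open>auto simp: fun_upd_idem\<close>)
next
  case (Cons x xs)
  have 1: "runs (if x then push b True ;; push c True else push b False ;; push c False) (2 + 2)
      (S(a := xs)) (S(a := xs, b := x # ys, c := x # zs))"
    using runs_Seq[OF runs_push[of b x "S(a := xs)"] runs_push[of c x]] Cons.prems assms
    by (cases x) auto
  have "runs (move_all2 a b c) (6 * length xs + 1) (S(a := xs, b := x # ys, c := x # zs))
      (S(a := xs, b := x # ys, c := x # zs, a := [], b := rev xs @ x # ys, c := rev xs @ x # zs))"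
    by (rule Cons.IH) (use assms in auto)
  with 1 have "runs (move_all2 a b c) ((2 + 2) + (6 * length xs + 1) + 2) S
      (S(a := xs, b := x # ys, c := x # zs, a := [], b := rev xs @ x # ys, c := rev xs @ x # zs))"
    unfolding move_all2_def using runs_loop_Cons[of a S x xs, OF assms(1) Cons.prems(1)] by blast
  then show ?case by (rule runs_conseq) (use assms in \<open>auto simp: fun_eq_iff\<close>)
qed

lemma runs_clear:
  assumes "a \<ge> 1"
  shows "S a = xs \<Longrightarrow> runs (clear a) (3 * length xs + 1) S (S(a := []))"
proof (induction xs arbitrary: S)
  case Nil
  then show ?case unfolding clear_def
    by (intro runs_conseq[OF runs_loop_Nil]) (use assms in \<open>auto simp: fun_upd_idem\<close>)
next
  case (Cons x xs)
  have IH: "runs (clear a) (3 * length xs + 1) (S(a := xs)) (S(a := xs, a := []))"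
    by (rule Cons.IH) simp
  have "runs (if x then nop else nop) 1 (S(a := xs)) (S(a := xs))"
    using runs_nop by simp
  from runs_loop_Cons[of a S x xs, OF assms Cons.prems(1) this IH[unfolded clear_def]]
  have "runs (clear a) (1 + (3 * length xs + 1) + 2) S (S(a := xs, a := []))"
    by (simp only: clear_def)
  then show ?case by (rule runs_conseq) auto
qed

lemma runs_push_list:
  assumes "i \<ge> 1"
  shows "runs (push_list i xs) (2 * length xs + 1) S (S(i := xs @ S i))"
proof (induction xs)
  case Nil
  then show ?case using runs_nop by simp
next
  case (Cons b xs)
  show ?case
    by (rule runs_conseq, simp, rule runs_Seq[OF Cons runs_push[OF assms]]) auto
qed

section \<open>Binary trees as universal data\<close>

datatype dat = Leaf | Node dat dat

primrec code :: "dat \<Rightarrow> bool list" where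
  "code Leaf = [False]"
| "code (Node x y) = True # code x @ code y"

text \<open>Moves one tree code from stack \<open>a\<close> to stack \<open>b\<close>, reversed.
  Stack \<open>d\<close> holds in unary the number of subtrees still to be read: every round takes
  one away, and a node adds two.\<close>

definition split_code :: "nat \<Rightarrow> nat \<Rightarrow> nat \<Rightarrow> com" where
  "split_code a d b = push d True ;;
     loop d nop (branch a (push b False) (push b True ;; push d True ;; push d True))"

text \<open>Stated with a continuation: \<open>t\<close> and \<open>S''\<close> stand for the rest
  of the loop after this subtree. In this form the two induction hypotheses for a node can be
  chained.\<close>

lemma runs_split_loop:
  assumes "a \<ge> 1" "b \<ge> 1" "d \<ge> 1" "a \<noteq> b" "a \<noteq> d" "b \<noteq> d"
  shows "S a = code x @ r \<Longrightarrow> S d = True # ds \<Longrightarrow> S b = ys \<Longrightarrow>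
    runs (loop d nop (branch a (push b False) (push b True ;; push d True ;; push d True))) t
      (S(a := r, b := rev (code x) @ ys, d := ds)) S'' \<Longrightarrow>
    runs (loop d nop (branch a (push b False) (push b True ;; push d True ;; push d True)))
      (t + 10 * length (code x)) S S''"
proof (induction x arbitrary: S r ds ys t)
  case Leaf
  have eq: "S(a := r, b := rev (code Leaf) @ ys, d := ds) = S(d := ds, a := r, b := False # ys)"
    using assms by (auto simp: fun_eq_iff)
  have "runs (branch a (push b False) (push b True ;; push d True ;; push d True)) (2 + 2)
      (S(d := ds)) (S(d := ds, a := r, b := False # ys))"
    by (rule runs_branch) (use Leaf assms in \<open>auto intro!: runs_conseq[OF runs_push]\<close>)
  then have "runs (loop d nop (branch a (push b False) (push b True ;; push d True ;; push d True)))
      ((2 + 2) + t + 2) S S''"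
    by (rule runs_loop_True[of d S ds, OF assms(3) Leaf.prems(2)]) (use Leaf.prems(4) in \<open>simp only: eq\<close>)
  then show ?case by (rule runs_mono) simp
next
  case (Node x y)
  let ?body = "branch a (push b False) (push b True ;; push d True ;; push d True)"
  let ?l = "loop d nop ?body"
  let ?S1 = "S(d := True # True # ds, a := code x @ code y @ r, b := True # ys)"
  have 1: "runs ?body (2 + (2 + 2) + 2) (S(d := ds)) ?S1"
    by (rule runs_branch, use Node.prems assms in \<open>auto\<close>)
       (use Node.prems assms in \<open>auto intro!: runs_conseq[OF runs_Seq[OF runs_push runs_Seq[OF runs_push runs_push]]] simp: fun_eq_iff\<close>)
  let ?S2 = "?S1(a := code y @ r, b := rev (code x) @ True # ys, d := True # ds)"
  have S3: "?S2(a := r, b := rev (code y) @ rev (code x) @ True # ys, d := ds)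
      = S(a := r, b := rev (code (Node x y)) @ ys, d := ds)"
    using assms by (auto simp: fun_eq_iff)
  have "runs ?l (t + 10 * length (code y)) ?S2 S''"
  proof (rule Node.IH(2)[of _ r ds "rev (code x) @ True # ys"])
    show "runs ?l t (?S2(a := r, b := rev (code y) @ rev (code x) @ True # ys, d := ds)) S''"
      unfolding S3 by (rule Node.prems(4))
  qed (use assms in auto)
  then have "runs ?l (t + 10 * length (code y) + 10 * length (code x)) ?S1 S''"
    by (rule Node.IH(1)[of _ "code y @ r" "True # ds" "True # ys", rotated 3]) (use assms in auto)
  from runs_loop_True[of d S ds, OF assms(3) Node.prems(2) 1 this]
  have "runs ?l ((2 + (2 + 2) + 2) + (t + 10 * length (code y) + 10 * length (code x)) + 2) S S''" .
  then show ?case by (rule runs_mono) simp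
qed

lemma runs_split_code:
  assumes "a \<ge> 1" "b \<ge> 1" "d \<ge> 1" "a \<noteq> b" "a \<noteq> d" "b \<noteq> d"
    and "S a = code x @ r" "S d = []" "S b = ys"
  shows "runs (split_code a d b) (10 * length (code x) + 3) S (S(a := r, b := rev (code x) @ ys))"
proof -
  let ?S1 = "S(d := [True])"
  have "runs (loop d nop (branch a (push b False) (push b True ;; push d True ;; push d True))) 1
      (?S1(a := r, b := rev (code x) @ ys, d := [])) (?S1(a := r, b := rev (code x) @ ys, d := []))"
    by (rule runs_loop_Nil) (use assms in auto)
  from runs_split_loop[OF assms(1-6) _ _ _ this]
  have "runs (loop d nop (branch a (push b False) (push b True ;; push d True ;; push d True)))
      (1 + 10 * length (code x)) ?S1 (?S1(a := r, b := rev (code x) @ ys, d := []))"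
    using assms by auto
  from runs_Seq[OF runs_push this[folded assms(8)]] show ?thesis
    unfolding split_code_def using assms by (auto intro: runs_conseq simp: fun_eq_iff)
qed

lemma fits_simps [simp]:
  "fits K (push i b) \<longleftrightarrow> i < K"
  "fits K (pop i) \<longleftrightarrow> i < K"
  "fits K (loop i c d) \<longleftrightarrow> i < K \<and> fits K c \<and> fits K d"
  "fits K (branch i c d) \<longleftrightarrow> i < K \<and> fits K c \<and> fits K d"
  "fits K nop \<longleftrightarrow> 1 < K"
  "fits K (clear i) \<longleftrightarrow> 1 < K \<and> i < K"
  "fits K (move_all i j) \<longleftrightarrow> i < K \<and> j < K"
  "fits K (move_all2 i j l) \<longleftrightarrow> i < K \<and> j < K \<and> l < K"
  "fits K (split_code i j l) \<longleftrightarrow> 1 < K \<and> i < K \<and> j < K \<and> l < K"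
  by (auto simp: push_def pop_def loop_def branch_def nop_def clear_def move_all_def move_all2_def
      split_code_def bit_sym_def)

lemma fits_push_list [simp]: "i < K \<Longrightarrow> 1 < K \<Longrightarrow> fits K (push_list i xs)"
  by (induction xs) auto

text \<open>Moving a stack reverses it; the detour over the empty stack \<open>t\<close> restores
  the order.\<close>

definition transfer :: "nat \<Rightarrow> nat \<Rightarrow> nat \<Rightarrow> com" where
  "transfer a t b = move_all a t ;; move_all t b"

definition copy :: "nat \<Rightarrow> nat \<Rightarrow> nat \<Rightarrow> com" where
  "copy a t b = move_all a t ;; move_all2 t a b"

definition take_code :: "nat \<Rightarrow> nat \<Rightarrow> nat \<Rightarrow> nat \<Rightarrow> com" where
  "take_code a d t b = split_code a d t ;; move_all t b"

lemma fits_simps2 [simp]: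
  "fits K (transfer a t b) \<longleftrightarrow> a < K \<and> t < K \<and> b < K"
  "fits K (copy a t b) \<longleftrightarrow> a < K \<and> t < K \<and> b < K"
  "fits K (take_code a d t b) \<longleftrightarrow> 1 < K \<and> a < K \<and> d < K \<and> t < K \<and> b < K"
  by (auto simp: transfer_def copy_def take_code_def)

lemma runs_transfer:
  assumes "a \<ge> 1" "b \<ge> 1" "t \<ge> 1" "a \<noteq> b" "a \<noteq> t" "b \<noteq> t"
    and "S a = xs" "S t = []" "S b = ys" "S' = S(a := [], b := xs @ ys)" "8 * length xs + 2 \<le> n"
  shows "runs (transfer a t b) n S S'"
proof -
  have "runs (transfer a t b) ((4 * length xs + 1) + (4 * length (rev xs) + 1)) S
      (S(a := [], t := rev xs @ [], t := [], b := rev (rev xs) @ ys))"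
    unfolding transfer_def by (rule runs_Seq[OF runs_move_all runs_move_all]) (use assms in auto)
  then show ?thesis by (rule runs_conseq) (use assms in \<open>auto simp: fun_eq_iff\<close>)
qed

lemma runs_copy:
  assumes "a \<ge> 1" "b \<ge> 1" "t \<ge> 1" "a \<noteq> b" "a \<noteq> t" "b \<noteq> t"
    and "S a = xs" "S t = []" "S b = ys" "S' = S(b := xs @ ys)" "10 * length xs + 2 \<le> n"
  shows "runs (copy a t b) n S S'"
proof -
  have "runs (copy a t b) ((4 * length xs + 1) + (6 * length (rev xs) + 1)) S
      (S(a := [], t := rev xs @ [], t := [], a := rev (rev xs) @ [], b := rev (rev xs) @ ys))"
    unfolding copy_def by (rule runs_Seq[OF runs_move_all runs_move_all2]) (use assms in auto)
  then show ?thesis by (rule runs_conseq) (use assms in \<open>auto simp: fun_eq_iff\<close>)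
qed

lemma runs_take_code:
  assumes "a \<ge> 1" "b \<ge> 1" "t \<ge> 1" "d \<ge> 1" "a \<noteq> b" "a \<noteq> t" "a \<noteq> d" "b \<noteq> t" "b \<noteq> d" "t \<noteq> d"
    and "S a = code x @ r" "S t = []" "S d = []" "S b = ys" "S' = S(a := r, b := code x @ ys)"
    and "14 * length (code x) + 4 \<le> n"
  shows "runs (take_code a d t b) n S S'"
proof -
  have "runs (take_code a d t b)
      ((10 * length (code x) + 3) + (4 * length (rev (code x)) + 1)) S
      (S(a := r, t := rev (code x) @ [], t := [], b := rev (rev (code x)) @ ys))"
    unfolding take_code_def by (rule runs_Seq[OF runs_split_code runs_move_all]) (use assms in auto)
  then show ?thesis by (rule runs_conseq) (use assms in \<open>auto simp: fun_eq_iff\<close>)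
qed

lemma runs_push': "i \<ge> 1 \<Longrightarrow> S i = xs \<Longrightarrow> S' = S(i := b # xs) \<Longrightarrow> 2 \<le> n \<Longrightarrow> runs (push i b) n S S'"
  using runs_push runs_mono by blast

lemma runs_pop': "i \<ge> 1 \<Longrightarrow> S i = b # xs \<Longrightarrow> S' = S(i := xs) \<Longrightarrow> 1 \<le> n \<Longrightarrow> runs (pop i) n S S'"
  using runs_pop runs_mono by blast

lemma runs_clear': "i \<ge> 1 \<Longrightarrow> S i = xs \<Longrightarrow> S' = S(i := []) \<Longrightarrow> 3 * length xs + 1 \<le> n \<Longrightarrow> runs (clear i) n S S'"
  using runs_clear runs_mono by blast

section \<open>Representable types and polynomial-time functions between them\<close>

text \<open>All types share the prefix-free code of binary trees, so that one set of stack programs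
  serves them all; injectivity allows equality to be decided on codes.\<close>

class rep =
  fixes rp :: "'a \<Rightarrow> dat"
  assumes rp_inject: "rp x = rp y \<Longrightarrow> x = y"

lemma rp_eq [simp]: "rp x = rp y \<longleftrightarrow> x = y"
  using rp_inject by auto

instantiation bool :: rep
begin
definition rp_bool :: "bool \<Rightarrow> dat" where "rp_bool b = (if b then Node Leaf Leaf else Leaf)"
instance by standard (auto simp: rp_bool_def split: if_splits)
end

instantiation nat :: rep
begin
primrec rp_nat :: "nat \<Rightarrow> dat" where
  "rp_nat 0 = Leaf"
| "rp_nat (Suc n) = Node Leaf (rp_nat n)"
instance
proof
  show "rp x = rp y \<Longrightarrow> x = y" for x y :: nat
  proof (induction x arbitrary: y)
    case 0 then show ?case by (cases y) auto
  next
    case (Suc x) then show ?case by (cases y) auto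
  qed
qed
end

instantiation list :: (rep) rep
begin
primrec rp_list :: "'a list \<Rightarrow> dat" where
  "rp_list [] = Leaf"
| "rp_list (x # xs) = Node (rp x) (rp_list xs)"
instance
proof
  show "rp x = rp y \<Longrightarrow> x = y" for x y :: "'a list"
  proof (induction x arbitrary: y)
    case Nil then show ?case by (cases y) auto
  next
    case (Cons a x) then show ?case by (cases y) auto
  qed
qed
end

instantiation prod :: (rep, rep) rep
begin
definition rp_prod :: "'a \<times> 'b \<Rightarrow> dat" where "rp_prod x = Node (rp (fst x)) (rp (snd x))"
instance by standard (auto simp: rp_prod_def prod_eq_iff)
end

definition sz :: "'a::rep \<Rightarrow> nat" where
  "sz x = length (code (rp x))"

lemma sz_simps [simp]:
  "sz True = 3" "sz False = 1" "sz (0::nat) = 1" "sz (Suc n) = sz n + 2"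
  "sz ([] :: 'a::rep list) = 1" "sz (x # xs) = 1 + sz x + sz xs" "sz (x, y) = 1 + sz x + sz y"
  by (auto simp: sz_def rp_bool_def rp_prod_def)

lemma sz_nat: "sz (n :: nat) = 2 * n + 1"
  by (induction n) auto

lemma sz_append: "sz (xs @ ys) + 1 = sz xs + sz ys"
  by (induction xs) auto

lemma sz_list: "sz xs = length xs + sum_list (map sz xs) + 1"
  by (induction xs) auto

lemma length_le_sz: "length xs \<le> sz xs"
  by (simp add: sz_list)

lemma sz_rev [simp]: "sz (rev xs) = sz xs"
  by (simp add: sz_list rev_map[symmetric] sum_list_rev)

lemma sz_mem: "x \<in> set xs \<Longrightarrow> sz x \<le> sz xs"
  using member_le_sum_list[of "sz x" "map sz xs"] by (simp add: sz_list)

definition polybound :: "('a::rep \<Rightarrow> nat) \<Rightarrow> bool" where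
  "polybound B \<longleftrightarrow> (\<exists>p :: nat poly. \<forall>x. B x \<le> poly p (sz x))"

lemma polybound_mono: "polybound B \<Longrightarrow> (\<And>x. A x \<le> B x) \<Longrightarrow> polybound A"
  unfolding polybound_def by (meson order_trans)

lemma polybound_const [simp, intro]: "polybound (\<lambda>_. c)"
  unfolding polybound_def by (rule exI[of _ "[:c:]"]) simp

lemma polybound_sz [simp, intro]: "polybound sz"
  unfolding polybound_def by (rule exI[of _ "[:0, 1:]"]) simp

lemma polybound_add [intro]: "polybound A \<Longrightarrow> polybound B \<Longrightarrow> polybound (\<lambda>x. A x + B x)"
  unfolding polybound_def by (metis poly_add add_mono)

lemma polybound_mult [intro]: "polybound A \<Longrightarrow> polybound B \<Longrightarrow> polybound (\<lambda>x. A x * B x)"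
  unfolding polybound_def by (metis poly_mult mult_le_mono)

lemma polybound_comp:
  assumes "polybound B" "polybound (\<lambda>x. sz (f x))"
  shows "polybound (\<lambda>x. B (f x))"
proof -
  obtain p q :: "nat poly" where "\<And>x. B x \<le> poly p (sz x)" "\<And>x. sz (f x) \<le> poly q (sz x)"
    using assms unfolding polybound_def by blast
  then have "B (f x) \<le> poly (pcompose p q) (sz x)" for x
    unfolding poly_pcompose using poly_nat_mono order_trans by blast
  then show ?thesis unfolding polybound_def by blast
qed

definition clean :: "nat \<Rightarrow> stacks \<Rightarrow> bool" where
  "clean K S \<longleftrightarrow> (\<forall>i. 2 \<le> i \<and> i < K \<longrightarrow> S i = [])"

text \<open>The calling convention: stack 1 carries the argument and the result, the stacks from 2
  below \<open>K\<close> are empty before and after, and those from \<open>K\<close> on survive, so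
  that a caller can park data there. The size of the result is bounded separately instead of being
  derived from the running time.\<close>

definition PT :: "('a::rep \<Rightarrow> 'b::rep) \<Rightarrow> bool" where
  "PT f \<longleftrightarrow> (\<exists>c K B. fits K c \<and> 2 \<le> K \<and> polybound (\<lambda>x. sz (f x)) \<and> polybound B \<and>
     (\<forall>x S. S 1 = code (rp x) \<longrightarrow> clean K S \<longrightarrow> runs c (B x) S (S(1 := code (rp (f x))))))"

lemma PT_I:
  assumes "fits K c" "2 \<le> K" "polybound (\<lambda>x. sz (f x))" "polybound B"
    and "\<And>x S. S 1 = code (rp x) \<Longrightarrow> clean K S \<Longrightarrow> runs c (B x) S (S(1 := code (rp (f x))))"
  shows "PT f"
  unfolding PT_def using assms by blast

lemma PT_E:
  assumes "PT f"
  obtains c K B where "2 \<le> K" "\<And>K'. K \<le> K' \<Longrightarrow> fits K' c" "polybound B"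
    "\<And>x S S'. S 1 = code (rp x) \<Longrightarrow> clean K S \<Longrightarrow> S' = S(1 := code (rp (f x))) \<Longrightarrow> runs c (B x) S S'"
proof -
  obtain c K B where "fits K c" "2 \<le> K" "polybound B"
    "\<And>x S. S 1 = code (rp x) \<Longrightarrow> clean K S \<Longrightarrow> runs c (B x) S (S(1 := code (rp (f x))))"
    using assms unfolding PT_def by blast
  with that show thesis using fits_mono by metis
qed

lemma polybound_PT: "PT f \<Longrightarrow> polybound (\<lambda>x. sz (f x))"
  by (auto simp: PT_def)

text \<open>Functions with the same codes are computed by the same program, even across types. Thus
  consing is pairing, and a Boolean is a list of length at most one.\<close>

lemma PT_cong_rep:
  assumes "PT f" "\<And>x. rp (g x) = rp (f (h x))" "\<And>x. rp (h x) = rp x"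
  shows "PT g"
proof -
  obtain c K B where *: "fits K c" "2 \<le> K" "polybound (\<lambda>x. sz (f x))" "polybound B"
    "\<And>x S. S 1 = code (rp x) \<Longrightarrow> clean K S \<Longrightarrow> runs c (B x) S (S(1 := code (rp (f x))))"
    using assms(1) unfolding PT_def by blast
  have h: "polybound (\<lambda>x. sz (h x))"
    using polybound_sz by (rule polybound_mono) (simp add: sz_def assms)
  show ?thesis
  proof (rule PT_I[OF *(1,2)])
    show "polybound (\<lambda>x. sz (g x))"
      using polybound_comp[OF *(3) h] by (rule polybound_mono) (simp add: sz_def assms)
    show "polybound (\<lambda>x. B (h x))" by (rule polybound_comp[OF *(4) h])
    show "runs c (B (h x)) S (S(1 := code (rp (g x))))" if "S 1 = code (rp x)" "clean K S" for S x
      using *(5)[of S "h x"] that assms by simp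
  qed
qed

section \<open>Closure under composition, pairing, case distinction and bounded recursion\<close>

lemma PT_id: "PT (\<lambda>x. x)"
proof (rule PT_I[where c = nop and K = 2 and B = "\<lambda>_. 1"])
  show "runs nop 1 S (S(1 := code (rp x)))" if "S 1 = code (rp x)" for S and x :: 'a
    using runs_nop[of S] that[symmetric] by simp
qed auto

lemma PT_comp:
  assumes "PT f" "PT g"
  shows "PT (\<lambda>x. g (f x))"
proof -
  obtain c K B where c: "2 \<le> K" "\<And>K'. K \<le> K' \<Longrightarrow> fits K' c" "polybound B"
    "\<And>x S S'. S 1 = code (rp x) \<Longrightarrow> clean K S \<Longrightarrow> S' = S(1 := code (rp (f x))) \<Longrightarrow> runs c (B x) S S'"
    by (rule PT_E[OF assms(1)]) (rule that)
  obtain d L A where d: "2 \<le> L" "\<And>K'. L \<le> K' \<Longrightarrow> fits K' d" "polybound A"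
    "\<And>x S S'. S 1 = code (rp x) \<Longrightarrow> clean L S \<Longrightarrow> S' = S(1 := code (rp (g x))) \<Longrightarrow> runs d (A x) S S'"
    by (rule PT_E[OF assms(2)]) (rule that)
  note f = polybound_PT[OF assms(1)]
  show ?thesis
  proof (rule PT_I)
    show "fits (max K L) (c ;; d)" using c(2) d(2) by simp
    show "2 \<le> max K L" using c by simp
    show "polybound (\<lambda>x. sz (g (f x)))" by (rule polybound_comp[OF polybound_PT[OF assms(2)] f])
    show "polybound (\<lambda>x. B x + A (f x))" by (intro polybound_add c(3) polybound_comp[OF d(3) f])
    show "runs (c ;; d) (B x + A (f x)) S (S(1 := code (rp (g (f x)))))"
      if "S 1 = code (rp x)" "clean (max K L) S" for S x
      by (rule runs_Seq[OF c(4)[of S x "S(1 := code (rp (f x)))"] d(4)[of _ "f x"]]) (use that in \<open>auto simp: clean_def\<close>)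
  qed
qed

lemma PT_const: "PT (\<lambda>_ :: 'a::rep. y)"
proof (rule PT_I)
  let ?c = "clear 1 ;; push_list 1 (code (rp y))"
  show "fits 2 ?c" "2 \<le> (2::nat)" by auto
  show "polybound (\<lambda>x :: 'a. (3 * sz x + 1) + (2 * sz y + 1))"
    by (intro polybound_add polybound_mult) auto
  show "runs ?c ((3 * sz x + 1) + (2 * sz y + 1)) S (S(1 := code (rp y)))"
    if "S 1 = code (rp x)" for S and x :: 'a
    by (rule runs_Seq[OF runs_clear'])
      (use that runs_push_list[of 1 "code (rp y)" "S(1 := [])"] in \<open>auto simp: sz_def\<close>)
qed auto

text \<open>Both programs use scratch stacks below \<open>k\<close> only, so the argument waits on
  stack \<open>k\<close> and the first result on stack \<open>k+2\<close>.\<close>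

lemma PT_pair:
  assumes "PT f" "PT g"
  shows "PT (\<lambda>x. (f x, g x))"
proof -
  obtain c K B where c: "2 \<le> K" "\<And>K'. K \<le> K' \<Longrightarrow> fits K' c" "polybound B"
    "\<And>x S S'. S 1 = code (rp x) \<Longrightarrow> clean K S \<Longrightarrow> S' = S(1 := code (rp (f x))) \<Longrightarrow> runs c (B x) S S'"
    by (rule PT_E[OF assms(1)]) (rule that)
  obtain d L A where d: "2 \<le> L" "\<And>K'. L \<le> K' \<Longrightarrow> fits K' d" "polybound A"
    "\<And>x S S'. S 1 = code (rp x) \<Longrightarrow> clean L S \<Longrightarrow> S' = S(1 := code (rp (g x))) \<Longrightarrow> runs d (A x) S S'"
    by (rule PT_E[OF assms(2)]) (rule that)
  note f = polybound_PT[OF assms(1)] and g = polybound_PT[OF assms(2)]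
  define k where "k = max K L"
  have k: "k \<ge> 2" "K \<le> k" "L \<le> k" using c(1) d(1) by (auto simp: k_def)
  let ?c = "copy 1 (k+1) k ;; c ;; transfer 1 (k+1) (k+2) ;; transfer k (k+1) 1 ;; d ;;
    transfer (k+2) (k+1) 1 ;; push 1 True"
  let ?B = "\<lambda>x. (10 * sz x + 2) + (B x + ((8 * sz (f x) + 2) + ((8 * sz x + 2) + (A x +
    ((8 * sz (f x) + 2) + 2)))))"
  show ?thesis
  proof (rule PT_I)
    show "fits (k+3) ?c" using c(2) d(2) k by simp
    show "2 \<le> k+3" by simp
    show "polybound (\<lambda>x. sz (f x, g x))"
      unfolding sz_simps by (intro polybound_add polybound_const f g)
    show "polybound ?B" using f g c(3) d(3) by (intro polybound_add polybound_mult) auto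
    show "runs ?c (?B x) S (S(1 := code (rp (f x, g x))))"
      if S: "S 1 = code (rp x)" "clean (k+3) S" for S x
    proof -
      have e: "\<And>i. 2 \<le> i \<Longrightarrow> i < k+3 \<Longrightarrow> S i = []" using S by (auto simp: clean_def)
      let ?F = "code (rp (f x))" and ?G = "code (rp (g x))" and ?X = "code (rp x)"
      have 1: "runs (copy 1 (k+1) k) (10 * sz x + 2) S (S(k := ?X))"
        by (rule runs_copy) (use S e k in \<open>auto simp: sz_def\<close>)
      have 2: "runs c (B x) (S(k := ?X)) (S(k := ?X, 1 := ?F))"
        by (rule c(4)) (use S e k in \<open>auto simp: clean_def\<close>)
      have 3: "runs (transfer 1 (k+1) (k+2)) (8 * sz (f x) + 2) (S(k := ?X, 1 := ?F))
          (S(k := ?X, 1 := [], k+2 := ?F))"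
        by (rule runs_transfer) (use S e k in \<open>auto simp: sz_def fun_eq_iff\<close>)
      have 4: "runs (transfer k (k+1) 1) (8 * sz x + 2) (S(k := ?X, 1 := [], k+2 := ?F)) (S(k+2 := ?F))"
        by (rule runs_transfer) (use S e k in \<open>auto simp: sz_def fun_eq_iff\<close>)
      have 5: "runs d (A x) (S(k+2 := ?F)) (S(k+2 := ?F, 1 := ?G))"
        by (rule d(4)) (use S e k in \<open>auto simp: clean_def\<close>)
      have 6: "runs (transfer (k+2) (k+1) 1) (8 * sz (f x) + 2) (S(k+2 := ?F, 1 := ?G)) (S(1 := ?F @ ?G))"
        by (rule runs_transfer) (use S e k in \<open>auto simp: sz_def fun_eq_iff\<close>)
      have 7: "runs (push 1 True) 2 (S(1 := ?F @ ?G)) (S(1 := code (rp (f x, g x))))"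
        by (rule runs_push') (auto simp: rp_prod_def)
      show ?thesis by (rule runs_Seq[OF 1 runs_Seq[OF 2 runs_Seq[OF 3 runs_Seq[OF 4 runs_Seq[OF 5
        runs_Seq[OF 6 7]]]]]])
    qed
  qed
qed

lemma PT_fst0: "PT (fst :: 'a::rep \<times> 'b::rep \<Rightarrow> 'a)"
proof (rule PT_I)
  let ?c = "pop 1 ;; take_code 1 2 3 4 ;; clear 1 ;; transfer 4 3 1"
  show "fits 5 ?c" "2 \<le> (5::nat)" by auto
  show "polybound (\<lambda>x :: 'a \<times> 'b. sz (fst x))"
    using polybound_sz by (rule polybound_mono) (auto simp: split_paired_all)
  show "polybound (\<lambda>x :: 'a \<times> 'b. 1 + ((14 * sz x + 4) + ((3 * sz x + 1) + (8 * sz x + 2))))"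
    by (intro polybound_add polybound_mult) auto
  show "runs ?c (1 + ((14 * sz x + 4) + ((3 * sz x + 1) + (8 * sz x + 2)))) S (S(1 := code (rp (fst x))))"
    if S: "S 1 = code (rp x)" "clean 5 S" for S and x :: "'a \<times> 'b"
  proof -
    obtain a b where x: "x = (a, b)" by force
    have e: "S 2 = []" "S 3 = []" "S 4 = []" using S by (auto simp: clean_def)
    let ?F = "code (rp a)" and ?G = "code (rp b)"
    have 1: "runs (pop 1) 1 S (S(1 := ?F @ ?G))"
      by (rule runs_pop') (use S x in \<open>auto simp: rp_prod_def\<close>)
    have 2: "runs (take_code 1 2 3 4) (14 * sz x + 4) (S(1 := ?F @ ?G)) (S(1 := ?G, 4 := ?F))"
      by (rule runs_take_code) (use S e x in \<open>auto simp: fun_eq_iff sz_def rp_prod_def\<close>)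
    have 3: "runs (clear 1) (3 * sz x + 1) (S(1 := ?G, 4 := ?F)) (S(1 := [], 4 := ?F))"
      by (rule runs_clear') (use S e x in \<open>auto simp: fun_eq_iff sz_def rp_prod_def\<close>)
    have 4: "runs (transfer 4 3 1) (8 * sz x + 2) (S(1 := [], 4 := ?F)) (S(1 := ?F))"
      by (rule runs_transfer) (use S e x in \<open>auto simp: fun_eq_iff sz_def rp_prod_def\<close>)
    show ?thesis using runs_Seq[OF 1 runs_Seq[OF 2 runs_Seq[OF 3 4]]] x by simp
  qed
qed

lemma PT_snd0: "PT (snd :: 'a::rep \<times> 'b::rep \<Rightarrow> 'b)"
proof (rule PT_I)
  let ?c = "pop 1 ;; take_code 1 2 3 4 ;; clear 4"
  show "fits 5 ?c" "2 \<le> (5::nat)" by auto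
  show "polybound (\<lambda>x :: 'a \<times> 'b. sz (snd x))"
    using polybound_sz by (rule polybound_mono) (auto simp: split_paired_all)
  show "polybound (\<lambda>x :: 'a \<times> 'b. 1 + ((14 * sz x + 4) + (3 * sz x + 1)))"
    by (intro polybound_add polybound_mult) auto
  show "runs ?c (1 + ((14 * sz x + 4) + (3 * sz x + 1))) S (S(1 := code (rp (snd x))))"
    if S: "S 1 = code (rp x)" "clean 5 S" for S and x :: "'a \<times> 'b"
  proof -
    obtain a b where x: "x = (a, b)" by force
    have e: "S 2 = []" "S 3 = []" "S 4 = []" using S by (auto simp: clean_def)
    let ?F = "code (rp a)" and ?G = "code (rp b)"
    have 1: "runs (pop 1) 1 S (S(1 := ?F @ ?G))"
      by (rule runs_pop') (use S x in \<open>auto simp: rp_prod_def\<close>)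
    have 2: "runs (take_code 1 2 3 4) (14 * sz x + 4) (S(1 := ?F @ ?G)) (S(1 := ?G, 4 := ?F))"
      by (rule runs_take_code) (use S e x in \<open>auto simp: fun_eq_iff sz_def rp_prod_def\<close>)
    have 3: "runs (clear 4) (3 * sz x + 1) (S(1 := ?G, 4 := ?F)) (S(1 := ?G))"
      by (rule runs_clear') (use S e x in \<open>auto simp: fun_eq_iff sz_def rp_prod_def\<close>)
    show ?thesis using runs_Seq[OF 1 runs_Seq[OF 2 3]] x by simp
  qed
qed

lemma PT_fst: "PT f \<Longrightarrow> PT (\<lambda>x. fst (f x))"
  using PT_comp PT_fst0 by blast

lemma PT_snd: "PT f \<Longrightarrow> PT (\<lambda>x. snd (f x))"
  using PT_comp PT_snd0 by blast

lemma PT_Cons: "PT f \<Longrightarrow> PT g \<Longrightarrow> PT (\<lambda>x. f x # g x)"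
  by (rule PT_cong_rep[OF PT_pair[of f g], where h = "\<lambda>x. x"]) (auto simp: rp_prod_def)

text \<open>Behind the node bit of the pair, the first bit of the list code tells the cases apart.
  What follows a cons needs just two node bits in front to become the code of
  \<open>((y, ys), snd p)\<close>.\<close>

lemma PT_case0:
  fixes g :: "'b::rep \<Rightarrow> 'c::rep" and h :: "('a::rep \<times> 'a list) \<times> 'b \<Rightarrow> 'c"
  assumes "PT g" "PT h"
  shows "PT (\<lambda>p. case fst p of [] \<Rightarrow> g (snd p) | y # ys \<Rightarrow> h ((y, ys), snd p))"
    (is "PT ?f")
proof -
  obtain c K B where c: "2 \<le> K" "\<And>K'. K \<le> K' \<Longrightarrow> fits K' c" "polybound B"
    "\<And>x S S'. S 1 = code (rp x) \<Longrightarrow> clean K S \<Longrightarrow> S' = S(1 := code (rp (g x))) \<Longrightarrow> runs c (B x) S S'"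
    by (rule PT_E[OF assms(1)]) (rule that)
  obtain d L A where d: "2 \<le> L" "\<And>K'. L \<le> K' \<Longrightarrow> fits K' d" "polybound A"
    "\<And>x S S'. S 1 = code (rp x) \<Longrightarrow> clean L S \<Longrightarrow> S' = S(1 := code (rp (h x))) \<Longrightarrow> runs d (A x) S S'"
    by (rule PT_E[OF assms(2)]) (rule that)
  obtain p q :: "nat poly" where p: "\<And>x. B x \<le> poly p (sz x)" and q: "\<And>x. A x \<le> poly q (sz x)"
    using c(3) d(3) unfolding polybound_def by blast
  obtain p' q' :: "nat poly" where p': "\<And>x. sz (g x) \<le> poly p' (sz x)" and q': "\<And>x. sz (h x) \<le> poly q' (sz x)"
    using polybound_PT[OF assms(1)] polybound_PT[OF assms(2)] unfolding polybound_def by blast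
  let ?c = "pop 1 ;; branch 1 c (push 1 True ;; push 1 True ;; d)"
  let ?B = "\<lambda>x :: 'a list \<times> 'b. 1 + (poly p (sz x) + (2 + (2 + poly q (sz x))) + 2)"
  show ?thesis
  proof (rule PT_I)
    show "fits (max K L) ?c" using c(1,2) d(1,2) by auto
    show "2 \<le> max K L" using c by simp
    show "polybound (\<lambda>x. sz (?f x))"
      unfolding polybound_def
    proof (intro exI allI)
      fix x :: "'a list \<times> 'b"
      show "sz (?f x) \<le> poly (p' + q') (sz x)"
      proof (cases "fst x")
        case Nil
        then have "?f x = g (snd x)" by simp
        also have "sz (g (snd x)) \<le> poly p' (sz x)"
          using p' poly_nat_mono[of "sz (snd x)" "sz x" p'] by (cases x) (simp, meson order_trans)
        finally show ?thesis by simp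
      next
        case (Cons y ys)
        then have "?f x = h ((y, ys), snd x)" by simp
        also have "sz (h ((y, ys), snd x)) \<le> poly q' (sz x)"
          using q'[of "((y, ys), snd x)"] Cons by (cases x) simp
        finally show ?thesis by simp
      qed
    qed
    show "polybound ?B" unfolding polybound_def
      by (rule exI[of _ "[:1:] + (p + ([:2:] + ([:2:] + q)) + [:2:])"]) simp
    show "runs ?c (?B x) S (S(1 := code (rp (?f x))))"
      if S: "S 1 = code (rp x)" "clean (max K L) S" for S and x :: "'a list \<times> 'b"
    proof -
      obtain l z where x: "x = (l, z)" by force
      have 1: "runs (pop 1) 1 S (S(1 := code (rp l) @ code (rp z)))"
        by (rule runs_pop') (use S x in \<open>auto simp: rp_prod_def\<close>)
      have 2: "runs (branch 1 c (push 1 True ;; push 1 True ;; d))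
        (poly p (sz x) + (2 + (2 + poly q (sz x))) + 2) (S(1 := code (rp l) @ code (rp z)))
        (S(1 := code (rp (?f x))))"
      proof (cases l)
        case Nil
        have "runs c (poly p (sz x)) (S(1 := code (rp z))) (S(1 := code (rp (?f x))))"
          by (rule runs_mono[OF c(4)[of _ z]])
            (use S x Nil p[of z] poly_nat_mono[of "sz z" "sz x" p] in \<open>auto simp: clean_def intro: order_trans\<close>)
        then have "runs c (poly p (sz x) + (2 + (2 + poly q (sz x)))) (S(1 := code (rp z))) (S(1 := code (rp (?f x))))"
          by (rule runs_mono) simp
        then show ?thesis
          by (intro runs_branch[where b = False and xs = "code (rp z)"]) (use Nil in auto)
      next
        case (Cons y ys)
        have "runs d (poly q (sz x)) (S(1 := code (rp ((y, ys), z)))) (S(1 := code (rp (?f x))))"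
          by (rule runs_mono[OF d(4)[of _ "((y, ys), z)"]])
            (use S x Cons q[of "((y, ys), z)"] in \<open>auto simp: clean_def intro: order_trans\<close>)
        then have "runs (push 1 True ;; push 1 True ;; d) (2 + (2 + poly q (sz x)))
            (S(1 := code (rp y) @ code (rp ys) @ code (rp z))) (S(1 := code (rp (?f x))))"
          by (intro runs_Seq[OF runs_push'[where S' = "S(1 := True # code (rp y) @ code (rp ys) @ code (rp z))"]
                runs_Seq[OF runs_push']])
             (auto simp: rp_prod_def)
        then have "runs (push 1 True ;; push 1 True ;; d) (poly p (sz x) + (2 + (2 + poly q (sz x))))
            (S(1 := code (rp y) @ code (rp ys) @ code (rp z))) (S(1 := code (rp (?f x))))"
          by (rule runs_mono) simp
        then show ?thesis
          by (intro runs_branch[where b = True and xs = "code (rp y) @ code (rp ys) @ code (rp z)"])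
             (use Cons in auto)
      qed
      show ?thesis by (rule runs_Seq[OF 1 2])
    qed
  qed
qed

lemma PT_case_list:
  assumes "PT l" "PT g" "PT (\<lambda>p. h (snd p) (fst (fst p)) (snd (fst p)))"
  shows "PT (\<lambda>x. case l x of [] \<Rightarrow> g x | y # ys \<Rightarrow> h x y ys)"
  using PT_comp[OF PT_pair[OF assms(1) PT_id] PT_case0[OF assms(2,3)]]
  by (simp cong: list.case_cong)

text \<open>The recursion principle of the class. The bound on all intermediate states is essential:
  a fold that doubles its state in each step leaves polynomial time.\<close>

lemma PT_fold:
  fixes h :: "'a::rep \<Rightarrow> 's::rep \<Rightarrow> 'b::rep \<Rightarrow> 's"
  assumes h: "PT (\<lambda>p. h (fst p) (fst (snd p)) (snd (snd p)))" and s: "PT s" and l: "PT l"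
    and bound: "polybound A" "\<And>x n. n \<le> length (l x) \<Longrightarrow> sz (foldl (h x) (s x) (take n (l x))) \<le> A x"
  shows "PT (\<lambda>x. foldl (h x) (s x) (l x))"
proof -
  obtain c K B where c: "2 \<le> K" "\<And>K'. K \<le> K' \<Longrightarrow> fits K' c" "polybound B"
    "\<And>x S S'. S 1 = code (rp x) \<Longrightarrow> clean K S \<Longrightarrow>
       S' = S(1 := code (rp (h (fst x) (fst (snd x)) (snd (snd x))))) \<Longrightarrow> runs c (B x) S S'"
    by (rule PT_E[OF h]) (rule that)
  obtain p :: "nat poly" where p: "\<And>x. B x \<le> poly p (sz x)"
    using c(3) unfolding polybound_def by blast
  obtain d L E where d: "2 \<le> L" "\<And>K'. L \<le> K' \<Longrightarrow> fits K' d" "polybound E"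
    "\<And>x S S'. S 1 = code (rp x) \<Longrightarrow> clean L S \<Longrightarrow> S' = S(1 := code (rp (x, s x, l x))) \<Longrightarrow> runs d (E x) S S'"
    by (rule PT_E[OF PT_pair[OF PT_id PT_pair[OF s l]]]) (rule that)
  define k where "k = max K L"
  have k: "k \<ge> 2" "K \<le> k" "L \<le> k" using c(1) d(1) by (auto simp: k_def)
  \<comment> \<open>Stack \<open>k\<close> keeps \<open>x\<close>, stack \<open>k+1\<close> the
    remaining list and stack \<open>1\<close> the current state \<open>t\<close>. The body assembles
    the code of \<open>(x, t, y)\<close> on stack \<open>1\<close> and calls
    \<open>c\<close>.\<close>
  let ?body = "transfer 1 (k+2) (k+4) ;; take_code (k+1) (k+2) (k+3) 1 ;; transfer (k+4) (k+2) 1 ;;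
    push 1 True ;; copy k (k+2) 1 ;; push 1 True ;; c"
  let ?prep = "take_code 1 (k+2) (k+3) k ;; pop 1 ;; take_code 1 (k+2) (k+3) (k+4) ;;
    transfer 1 (k+2) (k+1) ;; transfer (k+4) (k+2) 1"
  let ?c = "d ;; pop 1 ;; ?prep ;; loop (k+1) nop ?body ;; clear k"
  \<comment> \<open>Bounds the size of \<open>(x, t, y)\<close> for every intermediate state
    \<open>t\<close> and list entry \<open>y\<close>; \<open>D\<close> bounds one round.\<close>
  define M where "M x = 2 + sz x + A x + sz (l x)" for x
  define D where "D x = (8 * M x + 2) + ((14 * M x + 4) + ((8 * M x + 2) + (2 + ((10 * M x + 2) + (2 + poly p (M x))))))" for x
  let ?P = "\<lambda>x. (14 * M x + 4) + (1 + ((14 * M x + 4) + ((8 * M x + 2) + (8 * M x + 2))))"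
  let ?B = "\<lambda>x. E x + (1 + (?P x + ((length (l x) * (D x + 2) + 4) + (3 * sz x + 1))))"
  have M: "polybound M" unfolding M_def
    by (intro polybound_add polybound_const polybound_sz bound polybound_PT l)
  have D: "polybound D"
  proof -
    obtain q :: "nat poly" where q: "\<And>x. M x \<le> poly q (sz x)" using M unfolding polybound_def by blast
    have "poly p (M x) \<le> poly (pcompose p q) (sz x)" for x
      unfolding poly_pcompose by (rule poly_nat_mono[OF q])
    then have "polybound (\<lambda>x. poly p (M x))" unfolding polybound_def by blast
    with M show ?thesis unfolding D_def by (intro polybound_add polybound_mult polybound_const)
  qed
  have iter: "runs (loop (k+1) nop ?body) (length ys * (D x + 2) + 4) (S(1 := code (rp t), k+1 := code (rp ys)))
      (S(1 := code (rp (foldl (h x) t ys)), k+1 := []))"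
    if "\<And>i. i \<noteq> 1 \<Longrightarrow> i \<noteq> k \<Longrightarrow> i < k+5 \<Longrightarrow> i > 1 \<Longrightarrow> S i = []" "S k = code (rp x)"
      "\<And>n. n \<le> length ys \<Longrightarrow> sz (foldl (h x) t (take n ys)) \<le> A x" "sz ys \<le> sz (l x)" for S x t ys
    using that(3,4)
  proof (induction ys arbitrary: t)
    case Nil
    let ?S = "S(1 := code (rp t), k+1 := code (rp ([] :: 'b list)))"
    have "runs nop 1 (?S(k+1 := [])) (?S(k+1 := []))" by (rule runs_nop)
    moreover have "runs (loop (k+1) nop ?body) 1 (?S(k+1 := [])) (?S(k+1 := []))"
      by (rule runs_loop_Nil) auto
    ultimately have "runs (loop (k+1) nop ?body) (1 + 1 + 2) ?S (?S(k+1 := []))"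
      by (intro runs_loop_False[of _ _ "[]"]) auto
    then show ?case by (rule runs_conseq) (auto simp: fun_eq_iff)
  next
    case (Cons y ys)
    let ?T = "code (rp t)" and ?Y = "code (rp y)" and ?Z = "code (rp ys)" and ?X = "code (rp x)"
    let ?S = "S(1 := ?T, k+1 := code (rp (y # ys)))"
    have e: "\<And>i. i \<noteq> k \<Longrightarrow> i < k+5 \<Longrightarrow> i > 1 \<Longrightarrow> S i = []" using that(1) by auto
    have m: "length ?T \<le> M x" "length ?X \<le> M x" "length ?Y \<le> M x" "length ?Z \<le> M x" "2 + sz x + sz t + sz y \<le> M x"
      using Cons.prems(1)[of 0] Cons.prems(2) by (auto simp: M_def sz_def)
    have 1: "runs (transfer 1 (k+2) (k+4)) (8 * M x + 2) (S(1 := ?T, k+1 := ?Y @ ?Z))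
        (S(1 := [], k+1 := ?Y @ ?Z, k+4 := ?T))"
      by (rule runs_transfer) (use e k m in \<open>auto simp: fun_eq_iff\<close>)
    have 2: "runs (take_code (k+1) (k+2) (k+3) 1) (14 * M x + 4) (S(1 := [], k+1 := ?Y @ ?Z, k+4 := ?T))
        (S(1 := ?Y, k+1 := ?Z, k+4 := ?T))"
      by (rule runs_take_code[where x = "rp y" and r = ?Z and ys = "[]"]) (use e k m in \<open>auto simp: fun_eq_iff\<close>)
    have 3: "runs (transfer (k+4) (k+2) 1) (8 * M x + 2) (S(1 := ?Y, k+1 := ?Z, k+4 := ?T))
        (S(1 := ?T @ ?Y, k+1 := ?Z))"
      by (rule runs_transfer[where xs = ?T and ys = ?Y]) (use e k m in \<open>auto simp: fun_eq_iff\<close>)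
    have 4: "runs (push 1 True) 2 (S(1 := ?T @ ?Y, k+1 := ?Z)) (S(1 := True # ?T @ ?Y, k+1 := ?Z))"
      by (rule runs_push') (use k in \<open>auto simp: fun_eq_iff\<close>)
    have 5: "runs (copy k (k+2) 1) (10 * M x + 2) (S(1 := True # ?T @ ?Y, k+1 := ?Z))
        (S(1 := ?X @ True # ?T @ ?Y, k+1 := ?Z))"
      by (rule runs_copy[where xs = ?X and ys = "True # ?T @ ?Y"]) (use e k m that(2) in \<open>auto simp: fun_eq_iff\<close>)
    have 6: "runs (push 1 True) 2 (S(1 := ?X @ True # ?T @ ?Y, k+1 := ?Z))
        (S(1 := code (rp (x, t, y)), k+1 := ?Z))"
      by (rule runs_push') (use k in \<open>auto simp: fun_eq_iff rp_prod_def\<close>)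
    have "B (x, t, y) \<le> poly p (M x)"
      using p[of "(x, t, y)"] poly_nat_mono[of "sz (x, t, y)" "M x" p] m(5) by (auto intro: order_trans)
    then have 7: "runs c (poly p (M x)) (S(1 := code (rp (x, t, y)), k+1 := ?Z))
        (S(1 := code (rp (h x t y)), k+1 := ?Z))"
      by (intro runs_mono[OF c(4)[of _ "(x, t, y)"]]) (use e k in \<open>auto simp: fun_eq_iff clean_def\<close>)
    have "runs ?body (D x) (?S(k+1 := ?Y @ ?Z)) (S(1 := code (rp (h x t y)), k+1 := ?Z))"
      unfolding D_def fun_upd_upd
      by (rule runs_Seq[OF 1 runs_Seq[OF 2 runs_Seq[OF 3 runs_Seq[OF 4 runs_Seq[OF 5 runs_Seq[OF 6 7]]]]]])
    moreover have "runs (loop (k+1) nop ?body) (length ys * (D x + 2) + 4) (S(1 := code (rp (h x t y)), k+1 := ?Z))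
        (S(1 := code (rp (foldl (h x) (h x t y) ys)), k+1 := []))"
      by (rule Cons.IH) (use Cons.prems(1)[of "Suc _"] Cons.prems(2) in auto)
    ultimately have "runs (loop (k+1) nop ?body) (D x + (length ys * (D x + 2) + 4) + 2) ?S
        (S(1 := code (rp (foldl (h x) (h x t y) ys)), k+1 := []))"
      by (intro runs_loop_True[of _ _ "?Y @ ?Z"]) auto
    then show ?case by (rule runs_conseq) (auto simp: fun_eq_iff)
  qed
  show ?thesis
  proof (rule PT_I)
    show "fits (k+5) ?c" using c(2) d(2) k by simp
    show "2 \<le> k+5" by simp
    show "polybound (\<lambda>x. sz (foldl (h x) (s x) (l x)))"
      using bound(1)
    proof (rule polybound_mono)
      show "sz (foldl (h x) (s x) (l x)) \<le> A x" for x using bound(2)[of "length (l x)" x] by simp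
    qed
    have "polybound (\<lambda>x. length (l x))"
      using polybound_PT[OF l] by (rule polybound_mono) (rule length_le_sz)
    with M D d(3) show "polybound ?B"
      by (intro polybound_add polybound_mult polybound_const polybound_sz)
    show "runs ?c (?B x) S (S(1 := code (rp (foldl (h x) (s x) (l x)))))"
      if S: "S 1 = code (rp x)" "clean (k+5) S" for S x
    proof -
      have e: "\<And>i. 2 \<le> i \<Longrightarrow> i < k+5 \<Longrightarrow> S i = []" using S by (auto simp: clean_def)
      let ?T = "code (rp (s x))" and ?Y = "code (rp (l x))" and ?X = "code (rp x)"
      have m: "length ?T \<le> M x" "length ?X \<le> M x" "length ?Y \<le> M x"
        using bound(2)[of 0 x] by (auto simp: M_def sz_def)
      have 1: "runs d (E x) S (S(1 := code (rp (x, s x, l x))))"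
        by (rule d(4)) (use S e k in \<open>auto simp: clean_def\<close>)
      have 2: "runs (pop 1) 1 (S(1 := code (rp (x, s x, l x)))) (S(1 := ?X @ True # ?T @ ?Y))"
        by (rule runs_pop') (auto simp: rp_prod_def)
      have 3: "runs (take_code 1 (k+2) (k+3) k) (14 * M x + 4) (S(1 := ?X @ True # ?T @ ?Y))
          (S(1 := True # ?T @ ?Y, k := ?X))"
        by (rule runs_take_code[where x = "rp x" and r = "True # ?T @ ?Y" and ys = "[]"]) (use e k m in \<open>auto simp: fun_eq_iff\<close>)
      have 4: "runs (pop 1) 1 (S(1 := True # ?T @ ?Y, k := ?X)) (S(1 := ?T @ ?Y, k := ?X))"
        by (rule runs_pop') (use k in \<open>auto simp: fun_eq_iff\<close>)
      have 5: "runs (take_code 1 (k+2) (k+3) (k+4)) (14 * M x + 4) (S(1 := ?T @ ?Y, k := ?X))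
          (S(1 := ?Y, k := ?X, k+4 := ?T))"
        by (rule runs_take_code[where x = "rp (s x)" and r = ?Y and ys = "[]"]) (use e k m in \<open>auto simp: fun_eq_iff\<close>)
      have 6: "runs (transfer 1 (k+2) (k+1)) (8 * M x + 2) (S(1 := ?Y, k := ?X, k+4 := ?T))
          (S(1 := [], k := ?X, k+4 := ?T, k+1 := ?Y))"
        by (rule runs_transfer[where xs = ?Y and ys = "[]"]) (use e k m in \<open>auto simp: fun_eq_iff\<close>)
      have 7: "runs (transfer (k+4) (k+2) 1) (8 * M x + 2) (S(1 := [], k := ?X, k+4 := ?T, k+1 := ?Y))
          ((S(k := ?X))(1 := ?T, k+1 := ?Y))"
        by (rule runs_transfer[where xs = ?T and ys = "[]"]) (use e k m in \<open>auto simp: fun_eq_iff\<close>)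
      have P: "runs ?prep (?P x) (S(1 := ?X @ True # ?T @ ?Y)) ((S(k := ?X))(1 := ?T, k+1 := ?Y))"
        by (rule runs_Seq[OF 3 runs_Seq[OF 4 runs_Seq[OF 5 runs_Seq[OF 6 7]]]])
      have 8: "runs (loop (k+1) nop ?body) (length (l x) * (D x + 2) + 4) ((S(k := ?X))(1 := ?T, k+1 := ?Y))
          ((S(k := ?X))(1 := code (rp (foldl (h x) (s x) (l x))), k+1 := []))"
        by (rule iter) (use e bound(2) in auto)
      have 9: "runs (clear k) (3 * sz x + 1) ((S(k := ?X))(1 := code (rp (foldl (h x) (s x) (l x))), k+1 := []))
          (S(1 := code (rp (foldl (h x) (s x) (l x)))))"
        by (rule runs_clear') (use e k in \<open>auto simp: fun_eq_iff sz_def\<close>)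
      show ?thesis
        by (rule runs_Seq[OF 1 runs_Seq[OF 2 runs_Seq[OF P runs_Seq[OF 8 9]]]])
    qed
  qed
qed

named_theorems PT_intros

lemmas [PT_intros] = PT_id PT_const PT_pair PT_fst PT_snd PT_Cons PT_case_list

lemma PT_if [PT_intros]:
  assumes "PT b" "PT f" "PT g"
  shows "PT (\<lambda>x. if b x then f x else g x)"
proof -
  have "PT (\<lambda>b. if b then [False] else [])"
    by (rule PT_cong_rep[OF PT_id, where h = "\<lambda>b :: bool. b"]) (auto simp: rp_bool_def)
  then have l: "PT (\<lambda>x. if b x then [False] else [])" by (rule PT_comp[OF assms(1)])
  have "PT (\<lambda>x. case (if b x then [False] else []) of [] \<Rightarrow> g x | _ # _ \<Rightarrow> f x)"
    by (intro PT_case_list[where h = "\<lambda>x _ _. f x"] l assms PT_comp[OF _ assms(2)] PT_intros)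
  then show ?thesis by (rule back_subst[where P = PT]) auto
qed

lemma PT_not [PT_intros]:
  assumes "PT b"
  shows "PT (\<lambda>x. \<not> b x)"
proof -
  have "PT (\<lambda>x. if b x then False else True)" by (intro PT_if PT_const assms)
  also have "(\<lambda>x. if b x then False else True) = (\<lambda>x. \<not> b x)" by auto
  finally show ?thesis .
qed

lemma PT_conj [PT_intros]:
  assumes "PT b" "PT c"
  shows "PT (\<lambda>x. b x \<and> c x)"
proof -
  have "PT (\<lambda>x. if b x then c x else False)" by (intro PT_if PT_const assms)
  also have "(\<lambda>x. if b x then c x else False) = (\<lambda>x. b x \<and> c x)" by auto
  finally show ?thesis .
qed

text \<open>Additive growth per step sums to a polynomial over the length of the list. The invariant
  serves folds whose growth is controlled on reachable states only, such as machine
  configurations.\<close>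

lemma PT_fold_incr:
  assumes h: "PT (\<lambda>p. h (fst p) (fst (snd p)) (snd (snd p)))" and s: "PT s" and l: "PT l"
    and D: "polybound D"
    and I: "\<And>x. I x (s x)" "\<And>x t y. y \<in> set (l x) \<Longrightarrow> I x t \<Longrightarrow> I x (h x t y)"
    and incr: "\<And>x t y. y \<in> set (l x) \<Longrightarrow> I x t \<Longrightarrow> sz (h x t y) \<le> sz t + D x"
  shows "PT (\<lambda>x. foldl (h x) (s x) (l x))"
proof (rule PT_fold[OF h s l, where A = "\<lambda>x. sz (s x) + length (l x) * D x"])
  have "polybound (\<lambda>x. length (l x))"
    using polybound_PT[OF l] by (rule polybound_mono) (rule length_le_sz)
  with polybound_PT[OF s] D show "polybound (\<lambda>x. sz (s x) + length (l x) * D x)"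
    by (intro polybound_add polybound_mult)
  show "sz (foldl (h x) (s x) (take n (l x))) \<le> sz (s x) + length (l x) * D x"
    if "n \<le> length (l x)" for x n
  proof -
    have "I x (foldl (h x) (s x) (take n (l x))) \<and>
        sz (foldl (h x) (s x) (take n (l x))) \<le> sz (s x) + n * D x"
      using that
    proof (induction n)
      case (Suc n)
      then have "l x ! n \<in> set (l x)" by simp
      from I(2)[OF this] incr[OF this] Suc show ?case
        by (force simp: take_Suc_conv_app_nth)
    qed (simp add: I)
    moreover have "n * D x \<le> length (l x) * D x" using that by simp
    ultimately show ?thesis by linarith
  qed
qed

lemma PT_elem_bound:
  fixes h :: "'a::rep \<Rightarrow> 'b::rep \<Rightarrow> 'c::rep"
  assumes "PT (\<lambda>p. h (fst p) (snd p))" "PT l"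
  obtains D where "polybound D" "\<And>x y. y \<in> set (l x) \<Longrightarrow> sz (h x y) \<le> D x"
proof -
  obtain p :: "nat poly" where p: "\<And>x. sz (h (fst x) (snd x)) \<le> poly p (sz x)"
    using polybound_PT[OF assms(1)] unfolding polybound_def by blast
  obtain q :: "nat poly" where q: "\<And>x. sz (l x) \<le> poly q (sz x)"
    using polybound_PT[OF assms(2)] unfolding polybound_def by blast
  show thesis
  proof (rule that)
    show "polybound (\<lambda>x :: 'a. poly (pcompose p ([:1, 1:] + q)) (sz x))"
      unfolding polybound_def by blast
    show "sz (h x y) \<le> poly (pcompose p ([:1, 1:] + q)) (sz x)" if "y \<in> set (l x)" for x y
    proof -
      have "sz (h x y) \<le> poly p (sz (x, y))" using p[of "(x, y)"] by simp
      also have "\<dots> \<le> poly p (1 + sz x + poly q (sz x))"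
        by (rule poly_nat_mono) (use sz_mem[OF that] q[of x] in simp)
      finally show ?thesis by (simp add: poly_pcompose)
    qed
  qed
qed

lemma PT_rev [PT_intros]:
  assumes "PT l"
  shows "PT (\<lambda>x. rev (l x))"
proof -
  have "PT (\<lambda>x. foldl (\<lambda>t y. y # t) [] (l x))"
  proof (rule PT_fold_incr[where D = "\<lambda>x. 1 + sz (l x)" and I = "\<lambda>_ _. True"])
    show "PT (\<lambda>p. snd (snd p) # fst (snd p))" by (intro PT_intros)
    show "polybound (\<lambda>x. 1 + sz (l x))" by (intro polybound_add polybound_const polybound_PT assms)
  qed (auto intro!: PT_intros assms dest: sz_mem)
  also have "(\<lambda>x. foldl (\<lambda>t y. y # t) [] (l x)) = (\<lambda>x. rev (l x))"
    by (rule ext) (simp add: foldl_conv_fold rev_conv_fold)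
  finally show ?thesis .
qed

lemma PT_append [PT_intros]:
  assumes "PT l" "PT m"
  shows "PT (\<lambda>x. l x @ m x)"
proof -
  have "PT (\<lambda>x. foldl (\<lambda>t y. y # t) (m x) (rev (l x)))"
  proof (rule PT_fold_incr[where D = "\<lambda>x. 1 + sz (l x)" and I = "\<lambda>_ _. True"])
    show "PT (\<lambda>p. snd (snd p) # fst (snd p))" by (intro PT_intros)
    show "polybound (\<lambda>x. 1 + sz (l x))" by (intro polybound_add polybound_const polybound_PT assms)
  qed (auto intro!: PT_intros assms dest: sz_mem)
  also have "(\<lambda>x. foldl (\<lambda>t y. y # t) (m x) (rev (l x))) = (\<lambda>x. l x @ m x)"
    by (rule ext) (simp add: foldl_conv_fold fold_Cons_rev)
  finally show ?thesis .
qed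

lemma PT_map [PT_intros]:
  assumes h: "PT (\<lambda>p. h (fst p) (snd p))" and l: "PT l"
  shows "PT (\<lambda>x. map (h x) (l x))"
proof -
  obtain D where D: "polybound D" "\<And>x y. y \<in> set (l x) \<Longrightarrow> sz (h x y) \<le> D x"
    using PT_elem_bound[OF h l] by metis
  have "PT (\<lambda>x. foldl (\<lambda>t y. h x y # t) [] (l x))"
  proof (rule PT_fold_incr[where D = "\<lambda>x. 1 + D x" and I = "\<lambda>_ _. True"])
    have "PT (\<lambda>p. h (fst p) (snd (snd p)))"
      using PT_comp[OF _ h, of "\<lambda>p. (fst p, snd (snd p))"] by (simp add: PT_intros)
    then show "PT (\<lambda>p. h (fst p) (snd (snd p)) # fst (snd p))" by (intro PT_intros)
    show "polybound (\<lambda>x. 1 + D x)" by (intro polybound_add polybound_const D)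
  qed (auto intro!: PT_intros l dest: D(2))
  then have "PT (\<lambda>x. rev (foldl (\<lambda>t y. h x y # t) [] (l x)))" by (rule PT_rev)
  moreover have "rev (foldl (\<lambda>t y. h x y # t) s ys) = rev s @ map (h x) ys" for x s ys
    by (induction ys arbitrary: s) auto
  ultimately show ?thesis by simp
qed

lemma PT_filter [PT_intros]:
  assumes b: "PT (\<lambda>p. b (fst p) (snd p))" and l: "PT l"
  shows "PT (\<lambda>x. filter (b x) (l x))"
proof -
  have "PT (\<lambda>x. foldl (\<lambda>t y. if b x y then y # t else t) [] (l x))"
  proof (rule PT_fold_incr[where D = "\<lambda>x. 1 + sz (l x)" and I = "\<lambda>_ _. True"])
    have "PT (\<lambda>p. b (fst p) (snd (snd p)))"
      using PT_comp[OF _ b, of "\<lambda>p. (fst p, snd (snd p))"] by (simp add: PT_intros)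
    then show "PT (\<lambda>p. if b (fst p) (snd (snd p)) then snd (snd p) # fst (snd p) else fst (snd p))"
      by (intro PT_intros)
    show "polybound (\<lambda>x. 1 + sz (l x))" by (intro polybound_add polybound_const polybound_PT l)
  qed (auto intro!: PT_intros l dest: sz_mem)
  then have "PT (\<lambda>x. rev (foldl (\<lambda>t y. if b x y then y # t else t) [] (l x)))" by (rule PT_rev)
  moreover have "rev (foldl (\<lambda>t y. if b x y then y # t else t) s ys) = rev s @ filter (b x) ys" for x s ys
    by (induction ys arbitrary: s) auto
  ultimately show ?thesis by simp
qed

lemma PT_concat [PT_intros]:
  assumes l: "PT l"
  shows "PT (\<lambda>x. concat (l x))"
proof -
  have "PT (\<lambda>x. foldl (\<lambda>t y. t @ y) [] (l x))"
  proof (rule PT_fold_incr[where D = "\<lambda>x. sz (l x)" and I = "\<lambda>_ _. True"])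
    show "PT (\<lambda>p. fst (snd p) @ snd (snd p))" by (intro PT_intros)
    show "sz (t @ y) \<le> sz t + sz (l x)" if "y \<in> set (l x)" for x t y
      using sz_append[of t y] sz_mem[OF that] by simp
  qed (auto intro!: PT_intros l polybound_PT)
  moreover have "foldl (\<lambda>t y. t @ y) s ys = s @ concat ys" for s and ys :: "'b list list"
    by (induction ys arbitrary: s) auto
  ultimately show ?thesis by simp
qed

lemma PT_zip [PT_intros]:
  fixes l :: "'a::rep \<Rightarrow> 'b::rep list" and m :: "'a \<Rightarrow> 'c::rep list"
  assumes l: "PT l" and m: "PT m"
  shows "PT (\<lambda>x. zip (l x) (m x))"
proof -
  let ?h = "\<lambda>t y. case snd t of [] \<Rightarrow> t | z # r \<Rightarrow> ((y, z) # fst t, r)"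
  have "PT (\<lambda>x. foldl ?h ([], m x) (l x))"
  proof (rule PT_fold_incr[where D = "\<lambda>x. 1 + sz (l x)" and I = "\<lambda>_ _. True"])
    show "PT (\<lambda>p. ?h (fst (snd p)) (snd (snd p)))" by (intro PT_intros)
    show "polybound (\<lambda>x. 1 + sz (l x))" by (intro polybound_add polybound_const polybound_PT l)
    show "sz (?h t y) \<le> sz t + (1 + sz (l x))" if "y \<in> set (l x)" for x t y
      using sz_mem[OF that] by (cases t) (auto split: list.split)
  qed (auto intro!: PT_intros l m)
  then have "PT (\<lambda>x. rev (fst (foldl ?h ([], m x) (l x))))" by (intro PT_intros)
  moreover have "rev (fst (foldl ?h (s, zs) ys)) = rev s @ zip ys zs" for s and ys :: "'b list" and zs :: "'c list"
  proof (induction ys arbitrary: s zs)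
    case (Cons y ys)
    show ?case
    proof (cases zs)
      case Nil
      have "foldl ?h (s, []) ys = (s, [])" by (induction ys) auto
      with Nil show ?thesis by simp
    qed (simp add: Cons.IH)
  qed simp
  ultimately show ?thesis by simp
qed

lemma PT_tl [PT_intros]: "PT l \<Longrightarrow> PT (\<lambda>x. tl (l x))"
  unfolding tl_def by (intro PT_intros)

definition same_bits :: "bool list \<Rightarrow> bool list \<Rightarrow> bool" where
  "same_bits xs ys = (let r = foldl (\<lambda>t x. case snd t of [] \<Rightarrow> (False, []) | y # r \<Rightarrow>
     (fst t \<and> (if x then y else \<not> y), r)) (True, ys) xs in fst r \<and> (case snd r of [] \<Rightarrow> True | _ # _ \<Rightarrow> False))"

lemma same_bits: "same_bits xs ys \<longleftrightarrow> xs = ys"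
proof -
  let ?h = "\<lambda>t x. case snd t of [] \<Rightarrow> (False, []) | y # r \<Rightarrow> (fst t \<and> (if x then y else \<not> y), r)"
  have "(fst (foldl ?h (b, ys) xs) \<and> snd (foldl ?h (b, ys) xs) = []) \<longleftrightarrow> b \<and> xs = ys" for b
  proof (induction xs arbitrary: b ys)
    case (Cons x xs)
    then show ?case by (cases ys) (auto split: if_splits)
  qed auto
  from this[of True] show ?thesis
    unfolding same_bits_def Let_def by (auto split: list.splits)
qed

lemma PT_same_bits:
  assumes "PT l" "PT m"
  shows "PT (\<lambda>x. same_bits (l x) (m x))"
  unfolding same_bits_def Let_def
proof (intro PT_intros)
  let ?h = "\<lambda>t x. case snd t of [] \<Rightarrow> (False, []) | y # r \<Rightarrow> (fst t \<and> (if x then y else \<not> y), r)"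
  show "PT (\<lambda>x. foldl ?h (True, m x) (l x))"
  proof (rule PT_fold_incr[where D = "\<lambda>x. 2" and I = "\<lambda>_ _. True"])
    show "PT (\<lambda>p. ?h (fst (snd p)) (snd (snd p)))" by (intro PT_intros)
    have b: "sz (c :: bool) \<le> 3" "sz c \<ge> 1" for c by (cases c; simp)+
    show "sz (?h t y) \<le> sz t + 2" if "y \<in> set (l x)" for x t y
      using b(1)[of "fst t \<and> _"] b(2)[of "fst t"] 
      by (cases t; cases "snd t") (auto intro: order_trans[OF b(1)] simp: le_diff_conv add.commute)
  qed (auto intro!: PT_intros assms)
  then show "PT (\<lambda>x. foldl ?h (True, m x) (l x))" .
qed

text \<open>Equality is decided on the bit codes, uniformly in the type.\<close>

lemma PT_code: "PT (\<lambda>x :: 'a::rep. code (rp x))"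
proof (rule PT_I)
  let ?d = "push 1 False ;; push 1 True" and ?e = "push 1 False ;; push 1 False ;; push 1 True ;; push 1 True"
  let ?c = "move_all 1 2 ;; push 1 False ;; loop 2 ?d ?e"
  show "fits 3 ?c" "2 \<le> (3::nat)" by auto
  have len: "sz bs \<le> 4 * length bs + 1" for bs :: "bool list"
  proof (induction bs)
    case (Cons b bs) then show ?case by (cases b) auto
  qed simp
  show "polybound (\<lambda>x :: 'a. sz (code (rp x)))"
  proof (rule polybound_mono)
    show "polybound (\<lambda>x :: 'a. 4 * sz x + 1)" by (intro polybound_add polybound_mult) auto
    show "sz (code (rp x)) \<le> 4 * sz x + 1" for x :: 'a
      using len[of "code (rp x)"] by (simp add: sz_def[of x])
  qed
  show "polybound (\<lambda>x :: 'a. (4 * sz x + 1) + (2 + (10 * sz x + 1)))"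
    by (intro polybound_add polybound_mult) auto
  have L: "runs (loop 2 ?d ?e) (10 * length bs + 1) (S(1 := code (rp cs), 2 := bs))
      (S(1 := code (rp (rev bs @ cs)), 2 := []))" for S bs and cs :: "bool list"
  proof (induction bs arbitrary: cs)
    case Nil
    show ?case by (rule runs_mono[OF runs_conseq[OF runs_loop_Nil]]) auto
  next
    case (Cons b bs)
    have st: "runs (if b then ?e else ?d) 8 (S(1 := code (rp cs), 2 := bs)) (S(1 := code (rp (b # cs)), 2 := bs))"
    proof (cases b)
      case True
      have "runs ?e (2+(2+(2+2))) (S(1 := code (rp cs), 2 := bs)) (S(1 := code (rp (b # cs)), 2 := bs))"
        by (rule runs_Seq[OF runs_push'[where S' = "S(1 := False # code (rp cs), 2 := bs)"]
              runs_Seq[OF runs_push'[where S' = "S(1 := False # False # code (rp cs), 2 := bs)"]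
              runs_Seq[OF runs_push'[where S' = "S(1 := True # False # False # code (rp cs), 2 := bs)"]
              runs_push']]])
          (use True in \<open>auto simp: fun_eq_iff rp_bool_def\<close>)
      with True show ?thesis by simp
    next
      case False
      have "runs ?d (2+2) (S(1 := code (rp cs), 2 := bs)) (S(1 := code (rp (b # cs)), 2 := bs))"
        by (rule runs_Seq[OF runs_push'[where S' = "S(1 := False # code (rp cs), 2 := bs)"] runs_push'])
          (use False in \<open>auto simp: fun_eq_iff rp_bool_def\<close>)
      with False show ?thesis by (auto elim: runs_mono)
    qed
    have "runs (loop 2 ?d ?e) (8 + (10 * length bs + 1) + 2) (S(1 := code (rp cs), 2 := b # bs))
        (S(1 := code (rp (rev bs @ b # cs)), 2 := []))"
      by (rule runs_loop_Cons[OF _ _ _ Cons.IH, where b = b and xs = bs])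
        (simp, simp, simp only: fun_upd_upd st)
    then show ?case by (rule runs_conseq) auto
  qed
  show "runs ?c ((4 * sz x + 1) + (2 + (10 * sz x + 1))) S (S(1 := code (rp (code (rp x)))))"
    if S: "S 1 = code (rp x)" "clean 3 S" for S and x :: 'a
  proof -
    have e: "S 2 = []" using S by (auto simp: clean_def)
    have 1: "runs (move_all 1 2) (4 * sz x + 1) S (S(1 := [], 2 := rev (code (rp x))))"
      by (rule runs_conseq[OF runs_move_all]) (use S e in \<open>auto simp: sz_def fun_eq_iff\<close>)
    have 2: "runs (push 1 False) 2 (S(1 := [], 2 := rev (code (rp x))))
        (S(1 := code (rp ([] :: bool list)), 2 := rev (code (rp x))))"
      by (rule runs_push') (auto simp: fun_eq_iff)
    have 3: "runs (loop 2 ?d ?e) (10 * sz x + 1) (S(1 := code (rp ([] :: bool list)), 2 := rev (code (rp x))))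
        (S(1 := code (rp (code (rp x)))))"
      by (rule runs_conseq[OF L]) (use e in \<open>auto simp: sz_def fun_eq_iff\<close>)
    show ?thesis by (rule runs_Seq[OF 1 runs_Seq[OF 2 3]])
  qed
qed

lemma code_prefix_free: "code x @ r = code y @ r' \<Longrightarrow> x = y \<and> r = r'"
proof (induction x arbitrary: y r r')
  case Leaf
  then show ?case by (cases y) auto
next
  case (Node a b)
  from Node.prems obtain c d where y: "y = Node c d" by (cases y) auto
  with Node.prems have "code a @ code b @ r = code c @ code d @ r'" by simp
  from Node.IH(1)[OF this] Node.IH(2) y show ?case by blast
qed

lemma PT_eq [PT_intros]:
  assumes "PT f" "PT g"
  shows "PT (\<lambda>x. f x = g x)"
proof -
  have "PT (\<lambda>x. same_bits (code (rp (f x))) (code (rp (g x))))"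
    by (intro PT_same_bits PT_comp[OF assms(1) PT_code] PT_comp[OF assms(2) PT_code])
  moreover have "same_bits (code (rp a)) (code (rp b)) \<longleftrightarrow> a = b" for a b :: 'b
    using code_prefix_free[of "rp a" "[]" "rp b" "[]"] by (auto simp: same_bits)
  ultimately show ?thesis by simp
qed

text \<open>On a finite domain any function is a constant table, however it is defined. This settles
  the transition function of a machine and the test whether \<open>h\<close> spots form a
  set.\<close>

lemma PT_finite:
  assumes "finite A"
  obtains g :: "'a::rep \<Rightarrow> 'b::rep" where "PT g" "\<And>x. x \<in> A \<Longrightarrow> g x = h x"
proof -
  have "\<exists>g. PT g \<and> (\<forall>x\<in>A. g x = h x)"
    using assms
  proof induction
    case empty
    show ?case using PT_const by blast
  next
    case (insert a A)
    then obtain g where g: "PT g" "\<forall>x\<in>A. g x = h x" by blast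
    have "PT (\<lambda>x. if x = a then h a else g x)" by (intro PT_intros g)
    with g show ?case by (intro exI[of _ "\<lambda>x. if x = a then h a else g x"]) auto
  qed
  with that show thesis by blast
qed

section \<open>Polynomial-time functions on bit strings\<close>

text \<open>Consing builds a list from its end, so the head first runs to the right end of the input
  and then reads backwards.\<close>

definition read_input :: com where
  "read_input = Lp 0 (Mv 0 MRight) (Mv 0 MRight) ;; Mv 0 MLeft ;; push 1 False ;;
     Lp 0 ((push 1 False ;; push 1 True) ;; Mv 0 MLeft)
       ((push 1 False ;; push 1 False ;; push 1 True ;; push 1 True) ;; Mv 0 MLeft) ;; Mv 0 MRight"

text \<open>The output overwrites the input from cell 0 on; the final blank cuts off the remains of
  a longer input.\<close>

definition write_output :: com where
  "write_output = loop 1 nop (branch 1 (Wr 0 1 ;; Mv 0 MRight) ((pop 1 ;; pop 1) ;; Wr 0 2 ;; Mv 0 MRight))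
     ;; Wr 0 0"

lemma runs_imp_io: "runs c t S S' \<Longrightarrow> runs_io c t u S u S'"
  unfolding runs_def by blast

lemma runs_io_Mv: "runs_io (Mv 0 m) 1 (g, p) S (g, p + shift m) S"
  unfolding runs_io_def
proof (intro allI impI)
  fix T assume "holds T S" "T 0 = (g, p)"
  then show "\<exists>t'\<le>1. \<exists>T'. exec (Mv 0 m) T t' T' \<and> holds T' S \<and> T' 0 = (g, p + shift m)"
    using exec.Mv[of 0 m T] by (intro exI[of _ "1::nat"] exI[of _ "mv 0 m T"]) (auto simp: mv_def holds_def)
qed

lemma runs_io_Wr: "runs_io (Wr 0 a) 1 (g, p) S (g(p := a), p) S"
  unfolding runs_io_def
proof (intro allI impI)
  fix T assume "holds T S" "T 0 = (g, p)"
  then show "\<exists>t'\<le>1. \<exists>T'. exec (Wr 0 a) T t' T' \<and> holds T' S \<and> T' 0 = (g(p := a), p)"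
    using exec.Wr[of 0 a T] by (intro exI[of _ "1::nat"] exI[of _ "wr 0 a T"]) (auto simp: wr_def holds_def)
qed

lemma runs_io_Lp_stop: "tape_read u = 0 \<Longrightarrow> runs_io (Lp 0 c d) 1 u S u S"
  unfolding runs_io_def using exec.Lp0 by blast

lemma runs_io_Lp_step:
  assumes "tape_read u = bit_sym b" "runs_io (if b then d else c) t u S u' S'"
    and "runs_io (Lp 0 c d) t' u' S' u'' S''"
  shows "runs_io (Lp 0 c d) (t + t' + 1) u S u'' S''"
  unfolding runs_io_def
proof (intro allI impI)
  fix T assume T: "holds T S" "T 0 = u"
  obtain v T' where v: "v \<le> t" "exec (if b then d else c) T v T'" "holds T' S'" "T' 0 = u'"
    using T assms(2) unfolding runs_io_def by blast
  obtain w T'' where w: "w \<le> t'" "exec (Lp 0 c d) T' w T''" "holds T'' S''" "T'' 0 = u''"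
    using v(3,4) assms(3) unfolding runs_io_def by blast
  have "exec (Lp 0 c d) T (Suc (v + w)) T''"
    using v(2) w(2) assms(1) T(2) by (cases b) (auto intro: exec.Lp1 exec.Lp2 simp: bit_sym_def)
  with v w show "\<exists>v\<le>t + t' + 1. \<exists>T'. exec (Lp 0 c d) T v T' \<and> holds T' S'' \<and> T' 0 = u''"
    by (intro exI[of _ "Suc (v + w)"] exI[of _ T''] conjI) simp_all
qed

lemma input_tape_cell:
  "i < length x \<Longrightarrow> fst (input_tape x) (int i) = bit_sym (x ! i)"
  "fst (input_tape x) (int (length x)) = 0" "fst (input_tape x) (- 1) = 0"
  by (auto simp: input_tape_def)

lemma runs_scan:
  "p \<le> length x \<Longrightarrow> runs_io (Lp 0 (Mv 0 MRight) (Mv 0 MRight)) (2 * (length x - p) + 1)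
     (fst (input_tape x), int p) S (fst (input_tape x), int (length x)) S"
proof (induction "length x - p" arbitrary: p)
  case 0
  then have "p = length x" by simp
  then show ?case
    using runs_io_Lp_stop[of "(fst (input_tape x), int p)"] by (simp add: tape_read_def input_tape_cell)
next
  case (Suc n)
  then have p: "p < length x" by simp
  have IH: "runs_io (Lp 0 (Mv 0 MRight) (Mv 0 MRight)) (2 * (length x - Suc p) + 1)
     (fst (input_tape x), int (Suc p)) S (fst (input_tape x), int (length x)) S"
    by (rule Suc.hyps(1)) (use Suc.hyps(2) p in auto)
  have st: "runs_io (if x ! p then Mv 0 MRight else Mv 0 MRight) 1 (fst (input_tape x), int p) S
      (fst (input_tape x), int (Suc p)) S"
    using runs_io_Mv[of MRight "fst (input_tape x)" "int p" S] by (simp add: add.commute)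
  have "runs_io (Lp 0 (Mv 0 MRight) (Mv 0 MRight)) (1 + (2 * (length x - Suc p) + 1) + 1)
     (fst (input_tape x), int p) S (fst (input_tape x), int (length x)) S"
    by (rule runs_io_Lp_step[OF _ st IH]) (use p in \<open>simp add: tape_read_def input_tape_cell\<close>)
  then show ?case by (rule runs_io_mono) (use p in simp)
qed

lemma runs_push_bit:
  fixes cs :: "bool list"
  shows "runs (if b then push 1 False ;; push 1 False ;; push 1 True ;; push 1 True
     else push 1 False ;; push 1 True) 8 (S(1 := code (rp cs))) (S(1 := code (rp (b # cs))))"
proof (cases b)
  case True
  have "runs (push 1 False ;; push 1 False ;; push 1 True ;; push 1 True) (2+(2+(2+2)))
      (S(1 := code (rp cs))) (S(1 := code (rp (b # cs))))"
    by (rule runs_Seq[OF runs_push'[where S' = "S(1 := False # code (rp cs))"]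
          runs_Seq[OF runs_push'[where S' = "S(1 := False # False # code (rp cs))"]
          runs_Seq[OF runs_push'[where S' = "S(1 := True # False # False # code (rp cs))"]
          runs_push']]])
      (use True in \<open>auto simp: fun_eq_iff rp_bool_def\<close>)
  with True show ?thesis by simp
next
  case False
  have "runs (push 1 False ;; push 1 True) (2+2) (S(1 := code (rp cs))) (S(1 := code (rp (b # cs))))"
    by (rule runs_Seq[OF runs_push'[where S' = "S(1 := False # code (rp cs))"] runs_push'])
      (use False in \<open>auto simp: fun_eq_iff rp_bool_def\<close>)
  then have "runs (push 1 False ;; push 1 True) 8 (S(1 := code (rp cs))) (S(1 := code (rp (b # cs))))"
    by (rule runs_mono) simp
  with False show ?thesis by simp
qed

lemma runs_read:
  fixes x :: "bool list"
  defines "c \<equiv> (push 1 False ;; push 1 True) ;; Mv 0 MLeft"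
    and "d \<equiv> (push 1 False ;; push 1 False ;; push 1 True ;; push 1 True) ;; Mv 0 MLeft"
  shows "p \<le> length x \<Longrightarrow> runs_io (Lp 0 c d) (10 * p + 1)
     (fst (input_tape x), int p - 1) (S(1 := code (rp (drop p x)))) (fst (input_tape x), -1) (S(1 := code (rp x)))"
proof (induction p)
  case 0
  then show ?case using runs_io_Lp_stop[of "(fst (input_tape x), -1)"]
    by (simp add: tape_read_def input_tape_cell)
next
  case (Suc p)
  have st: "runs_io (if x ! p then d else c) (8 + 1) (fst (input_tape x), int (Suc p) - 1)
      (S(1 := code (rp (drop (Suc p) x)))) (fst (input_tape x), int p - 1) (S(1 := code (rp (drop p x))))"
  proof -
    have "drop p x = x ! p # drop (Suc p) x" using Suc.prems by (simp add: Cons_nth_drop_Suc)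
    with runs_push_bit[of "x ! p" S "drop (Suc p) x"]
    have "runs (if x ! p then push 1 False ;; push 1 False ;; push 1 True ;; push 1 True
      else push 1 False ;; push 1 True) 8 (S(1 := code (rp (drop (Suc p) x)))) (S(1 := code (rp (drop p x))))"
      by simp
    from runs_io_Seq[OF runs_imp_io[OF this] runs_io_Mv[of MLeft "fst (input_tape x)" "int p"]]
    show ?thesis unfolding c_def d_def by (cases "x ! p") auto
  qed
  have "runs_io (Lp 0 c d) ((8 + 1) + (10 * p + 1) + 1)
     (fst (input_tape x), int (Suc p) - 1) (S(1 := code (rp (drop (Suc p) x)))) (fst (input_tape x), -1) (S(1 := code (rp x)))"
    by (rule runs_io_Lp_step[OF _ st Suc.IH])
      (use Suc.prems input_tape_cell(1)[of p x] in \<open>simp_all add: tape_read_def\<close>)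
  then show ?case by (rule runs_io_mono) simp
qed

lemma runs_read_input:
  assumes "S 1 = []"
  shows "runs_io read_input (12 * length x + 7) (input_tape x) S (fst (input_tape x), 0) (S(1 := code (rp x)))"
proof -
  let ?g = "fst (input_tape x)"
  have 1: "runs_io (Lp 0 (Mv 0 MRight) (Mv 0 MRight)) (2 * length x + 1) (input_tape x) S (?g, int (length x)) S"
    using runs_scan[of 0 x S] by (simp add: input_tape_def)
  have 2: "runs_io (Mv 0 MLeft) 1 (?g, int (length x)) S (?g, int (length x) - 1) S"
    using runs_io_Mv[of MLeft ?g "int (length x)"] by simp
  have 3: "runs_io (push 1 False) 2 (?g, int (length x) - 1) S (?g, int (length x) - 1)
      (S(1 := code (rp (drop (length x) x))))"
    by (rule runs_imp_io[OF runs_push']) (use assms in auto)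
  have 5: "runs_io (Mv 0 MRight) 1 (?g, -1) (S(1 := code (rp x))) (?g, 0) (S(1 := code (rp x)))"
    using runs_io_Mv[of MRight ?g "-1"] by simp
  have "runs_io read_input ((2 * length x + 1) + (1 + (2 + ((10 * length x + 1) + 1)))) (input_tape x) S (?g, 0)
      (S(1 := code (rp x)))"
    unfolding read_input_def
    by (rule runs_io_Seq[OF 1 runs_io_Seq[OF 2 runs_io_Seq[OF 3 runs_io_Seq[OF runs_read[OF le_refl] 5]]]])
  then show ?thesis by (rule runs_io_mono) simp
qed

lemma runs_write:
  defines "c \<equiv> branch 1 (Wr 0 1 ;; Mv 0 MRight) ((pop 1 ;; pop 1) ;; Wr 0 2 ;; Mv 0 MRight)"
  shows "\<exists>h. runs_io (loop 1 nop c) (10 * length y + 4) (g, p) (S(1 := code (rp (y :: bool list))))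
     (h, p + int (length y)) (S(1 := [])) \<and> (\<forall>i<length y. h (p + int i) = bit_sym (y ! i)) \<and> (\<forall>q<p. h q = g q)"
proof (induction y arbitrary: g p)
  case Nil
  let ?S = "S(1 := code (rp ([] :: bool list)))"
  have l: "runs (loop 1 nop c) 1 (?S(1 := [])) (?S(1 := []))" by (rule runs_loop_Nil) auto
  have st: "runs (loop 1 nop c) (1 + 1 + 2) ?S (?S(1 := []))"
    by (rule runs_loop_False[OF _ _ runs_nop l]) auto
  have "runs_io (loop 1 nop c) (10 * length ([] :: bool list) + 4) (g, p) ?S (g, p) (S(1 := []))"
    by (rule runs_imp_io, rule runs_conseq[OF st]) simp_all
  then have A: "runs_io (loop 1 nop c) (10 * length ([] :: bool list) + 4) (g, p) ?S
      (g, p + int (length ([] :: bool list))) (S(1 := []))" by simp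
  show ?case by (rule exI[of _ g], rule conjI[OF A]) simp
next
  case (Cons b y)
  obtain h where h: "runs_io (loop 1 nop c) (10 * length y + 4) (g(p := bit_sym b), p + 1) (S(1 := code (rp y)))
     (h, p + 1 + int (length y)) (S(1 := []))" "\<forall>i<length y. h (p + 1 + int i) = bit_sym (y ! i)"
     "\<forall>q<p + 1. h q = (g(p := bit_sym b)) q" using Cons by blast
  let ?S0 = "S(1 := code (rp b) @ code (rp y))"
  have w: "runs_io (Wr 0 (bit_sym b) ;; Mv 0 MRight) (1 + 1) (g, p) S' (g(p := bit_sym b), p + 1) S'" for S'
    using runs_io_Seq[OF runs_io_Wr[of "bit_sym b" g p S'] runs_io_Mv[of MRight]] by simp
  have st: "runs_io c (6 + 2) (g, p) ?S0 (g(p := bit_sym b), p + 1) (S(1 := code (rp y)))"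
  proof (cases b)
    case True
    have "runs (pop 1 ;; pop 1) (1 + 1) (S(1 := False # False # code (rp y))) (S(1 := code (rp y)))"
      by (rule runs_Seq[OF runs_pop'[where S' = "S(1 := False # code (rp y))"] runs_pop'])
        (auto simp: fun_eq_iff)
    from runs_io_mono[OF runs_io_Seq[OF runs_imp_io[OF this] w], of 6]
    have "runs_io ((pop 1 ;; pop 1) ;; Wr 0 2 ;; Mv 0 MRight) 6 (g, p) (?S0(1 := False # False # code (rp y)))
        (g(p := bit_sym b), p + 1) (S(1 := code (rp y)))"
      using True by (simp add: bit_sym_def)
    then show ?thesis unfolding c_def
      by (intro runs_io_branch[where b = True and xs = "False # False # code (rp y)"])
        (use True in \<open>auto simp: rp_bool_def\<close>)
  next
    case False
    from runs_io_mono[OF w, of 6 "S(1 := code (rp y))"]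
    have "runs_io (Wr 0 1 ;; Mv 0 MRight) 6 (g, p) (?S0(1 := code (rp y)))
        (g(p := bit_sym b), p + 1) (S(1 := code (rp y)))"
      using False by (simp add: bit_sym_def)
    then show ?thesis unfolding c_def
      by (intro runs_io_branch[where b = False and xs = "code (rp y)"])
        (use False in \<open>auto simp: rp_bool_def\<close>)
  qed
  have "runs_io (loop 1 nop c) ((6 + 2) + (10 * length y + 4) + 2) (g, p) (S(1 := code (rp (b # y))))
     (h, p + 1 + int (length y)) (S(1 := []))"
    by (rule runs_io_loop_Cons[OF _ _ _ h(1), where b = True and xs = "code (rp b) @ code (rp y)"])
       (simp, simp, simp only: if_True fun_upd_upd st)
  then have "runs_io (loop 1 nop c) ((6 + 2) + (10 * length y + 4) + 2) (g, p) (S(1 := code (rp (b # y))))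
     (h, p + int (length (b # y))) (S(1 := []))" by (simp add: add.assoc)
  moreover have "h (p + int i) = bit_sym ((b # y) ! i)" if "i < length (b # y)" for i
  proof (cases i)
    case 0 with h(3) show ?thesis by simp
  next
    case (Suc j)
    have "p + int i = p + 1 + int j" using Suc by simp
    moreover have "j < length y" using that Suc by simp
    ultimately show ?thesis using h(2)[rule_format, of j] Suc by (simp only: nth_Cons_Suc)
  qed
  moreover have "\<forall>q<p. h q = g q" using h(3) by simp
  ultimately have "runs_io (loop 1 nop c) (10 * length (b # y) + 4) (g, p) (S(1 := code (rp (b # y))))
     (h, p + int (length (b # y))) (S(1 := [])) \<and> (\<forall>i<length (b # y). h (p + int i) = bit_sym ((b # y) ! i)) \<and>
     (\<forall>q<p. h q = g q)"
    by (intro conjI allI impI) (rule runs_io_mono, assumption, simp_all)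
  then show ?case by blast
qed

theorem PT_imp_polytime:
  assumes "PT (f :: bool list \<Rightarrow> bool list)"
  shows "polytime f"
proof -
  obtain c K B where c: "2 \<le> K" "\<And>K'. K \<le> K' \<Longrightarrow> fits K' c" "polybound B"
    "\<And>x S S'. S 1 = code (rp x) \<Longrightarrow> clean K S \<Longrightarrow> S' = S(1 := code (rp (f x))) \<Longrightarrow> runs c (B x) S S'"
    by (rule PT_E[OF assms(1)]) (rule that)
  let ?c = "read_input ;; c ;; write_output"
  let ?B = "\<lambda>x. (12 * sz x + 7) + (B x + (10 * sz (f x) + 4 + 1))"
  have "polybound ?B" by (intro polybound_add polybound_mult polybound_const polybound_sz c(3) polybound_PT assms)
  then obtain p :: "nat poly" where p: "\<And>x. ?B x \<le> poly p (sz x)" unfolding polybound_def by blast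
  have len: "sz bs \<le> 4 * length bs + 1" for bs :: "bool list"
  proof (induction bs)
    case (Cons b bs) then show ?case by (cases b) auto
  qed simp
  show ?thesis
  proof (rule polytimeI[where K = K and p = "pcompose p [:1, 4:]"])
    show "fits K ?c" using c(1) c(2)[of K] by (simp add: read_input_def write_output_def)
    show "1 \<le> K" using c(1) by simp
    fix x
    let ?S = "\<lambda>_. [] :: bool list" and ?g = "fst (input_tape x)"
    have h0: "holds (init_tapes x) ?S" by (simp add: holds_def init_tapes_def blank_tape_def tape_read_def)
    obtain h where h: "runs_io (loop 1 nop (branch 1 (Wr 0 1 ;; Mv 0 MRight) ((pop 1 ;; pop 1) ;; Wr 0 2 ;; Mv 0 MRight)))
        (10 * length (f x) + 4) (?g, 0) (?S(1 := code (rp (f x)))) (h, 0 + int (length (f x))) (?S(1 := []))"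
        "\<forall>i<length (f x). h (0 + int i) = bit_sym (f x ! i)"
      using runs_write[of "f x" ?g 0 ?S] by blast
    have cr: "runs c (B x) (?S(1 := code (rp x))) (?S(1 := code (rp (f x))))"
      by (rule c(4)) (auto simp: clean_def fun_eq_iff)
    have "runs_io ?c ((12 * length x + 7) + (B x + ((10 * length (f x) + 4) + 1))) (input_tape x) ?S
        (h(0 + int (length (f x)) := 0), 0 + int (length (f x))) (?S(1 := []))"
      unfolding write_output_def
      by (rule runs_io_Seq[OF runs_read_input runs_io_Seq[OF runs_imp_io[OF cr] runs_io_Seq[OF h(1) runs_io_Wr]]]) simp
    then obtain t T where t: "t \<le> (12 * length x + 7) + (B x + ((10 * length (f x) + 4) + 1))"
      "exec ?c (init_tapes x) t T" "T 0 = (h(0 + int (length (f x)) := 0), 0 + int (length (f x)))"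
      using h0 unfolding runs_io_def by (auto simp: init_tapes_def)
    have "t \<le> ?B x" using t(1) length_le_sz[of x] length_le_sz[of "f x"] by linarith
    also have "\<dots> \<le> poly p (sz x)" by (rule p)
    also have "\<dots> \<le> poly p (1 + length x * 4)" by (rule poly_nat_mono) (use len[of x] in simp)
    finally have "t \<le> poly (pcompose p [:1, 4:]) (length x)" by (simp add: poly_pcompose)
    with t h(2) show "\<exists>t T. t \<le> poly (pcompose p [:1, 4:]) (length x) \<and> exec ?c (init_tapes x) t T \<and>
      (\<forall>i<length (f x). fst (T 0) (int i) = bit_sym (f x ! i)) \<and> fst (T 0) (int (length (f x))) = 0"
      by (intro exI[of _ t] exI[of _ T]) auto
  qed
qed

section \<open>Simulating a Turing machine by a polynomial-time function\<close>

instantiation move :: rep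
begin
fun rp_move :: "move \<Rightarrow> dat" where
  "rp_move MLeft = Leaf"
| "rp_move MStay = Node Leaf Leaf"
| "rp_move MRight = Node Leaf (Node Leaf Leaf)"
instance
proof
  show "rp x = rp y \<Longrightarrow> x = y" for x y :: move by (cases x; cases y) auto
qed
end

text \<open>A tape is split at the head into the cells to its left, nearest first, and the others; cells
  beyond the two lists are blank.\<close>

type_synonym ltape = "nat list \<times> nat list"

definition cell :: "nat list \<Rightarrow> nat \<Rightarrow> nat" where
  "cell xs j = (if j < length xs then xs ! j else 0)"

definition tape_rel :: "tape \<Rightarrow> ltape \<Rightarrow> bool" where
  "tape_rel u l \<longleftrightarrow> (\<forall>j. fst u (snd u + int j) = cell (snd l) j) \<and>
     (\<forall>j. fst u (snd u - 1 - int j) = cell (fst l) j)"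

definition lread :: "ltape \<Rightarrow> nat" where
  "lread l = (case snd l of [] \<Rightarrow> 0 | a # r \<Rightarrow> a)"

definition lact :: "nat \<times> move \<Rightarrow> ltape \<Rightarrow> ltape" where
  "lact a l = (if snd a = MStay then (fst l, fst a # tl (snd l))
     else if snd a = MRight then (fst a # fst l, tl (snd l))
     else (case fst l of [] \<Rightarrow> ([], 0 # fst a # tl (snd l)) | b # r \<Rightarrow> (r, b # fst a # tl (snd l))))"

lemma cell_simps [simp]:
  "cell [] j = 0" "cell (a # xs) 0 = a" "cell (a # xs) (Suc j) = cell xs j"
  by (auto simp: cell_def)

lemma cell_tl: "cell (tl xs) j = cell xs (Suc j)"
  by (cases xs) auto

lemma tape_rel_read: "tape_rel u l \<Longrightarrow> tape_read u = lread l"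
  unfolding tape_rel_def tape_read_def lread_def
  by (drule conjunct1, drule spec[of _ 0]) (auto simp: cell_def split: list.split)

lemma tape_rel_act:
  assumes "tape_rel u l"
  shows "tape_rel (tape_act a u) (lact a l)"
proof -
  obtain f p ls rs b m where *: "u = (f, p)" "l = (ls, rs)" "a = (b, m)" by (cases u; cases l; cases a)
  have r: "f (p + int j) = cell rs j" and l: "f (p - 1 - int j) = cell ls j" for j
    using assms * by (auto simp: tape_rel_def)
  have r': "f (p + 1 + int j) = cell (tl rs) j" for j
    using r[of "Suc j"] by (simp add: cell_tl ac_simps)
  have l0: "f (p - 1) = cell ls 0" using l[of 0] by simp
  have l': "f (p - 2 - int j) = cell (tl ls) j" for j
    using l[of "Suc j"] by (simp add: cell_tl algebra_simps)
  show ?thesis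
  proof (cases m)
    case MStay
    have "(f(p := b)) (p + int j) = cell (b # tl rs) j" for j
      using r'[of "j - 1"] by (cases j) (auto simp: ac_simps)
    moreover have "(f(p := b)) (p - 1 - int j) = cell ls j" for j using l[of j] by auto
    ultimately show ?thesis using MStay * by (simp add: tape_rel_def tape_act_def lact_def)
  next
    case MRight
    have "(f(p := b)) (p + 1 + int j) = cell (tl rs) j" for j using r'[of j] by auto
    moreover have "(f(p := b)) (p + 1 - 1 - int j) = cell (b # ls) j" for j
      using l[of "j - 1"] by (cases j) (auto simp: algebra_simps)
    ultimately show ?thesis using MRight * by (simp add: tape_rel_def tape_act_def lact_def)
  next
    case MLeft
    have "(f(p := b)) (p - 1 + int j) = cell (cell ls 0 # b # tl rs) j" for j
    proof (cases j)
      case (Suc i)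
      then show ?thesis using r'[of "i - 1"] by (cases i) (auto simp: ac_simps)
    qed (use l0 in simp)
    moreover have "(f(p := b)) (p - 1 - 1 - int j) = cell (tl ls) j" for j using l'[of j] by (auto simp: algebra_simps)
    ultimately show ?thesis using MLeft *
      by (cases ls) (simp_all add: tape_rel_def tape_act_def lact_def)
  qed
qed

lemma PT_comp2:
  assumes "PT (\<lambda>p. F (fst p) (snd p))" "PT f" "PT g"
  shows "PT (\<lambda>x. F (f x) (g x))"
  using PT_comp[OF PT_pair[OF assms(2,3)] assms(1)] by simp

lemma PT_lread [PT_intros]: "PT f \<Longrightarrow> PT (\<lambda>x. lread (f x))"
  unfolding lread_def by (intro PT_intros)

lemma PT_lact [PT_intros]: "PT f \<Longrightarrow> PT g \<Longrightarrow> PT (\<lambda>x. lact (f x) (g x))"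
  by (rule PT_comp2[of lact]) (unfold lact_def, intro PT_intros)

text \<open>A number in unary: numbers that only count repetitions are kept as lists, over which a
  fold can run.\<close>

primrec power_list :: "nat \<Rightarrow> 'a list \<Rightarrow> bool list" where
  "power_list 0 xs = [True]"
| "power_list (Suc k) xs = concat (map (\<lambda>_. power_list k xs) xs)"

lemma length_power_list [simp]: "length (power_list k xs) = length xs ^ k"
  by (induction k) (auto simp: length_concat o_def sum_list_triv)

lemma PT_power_list [PT_intros]:
  assumes "PT l"
  shows "PT (\<lambda>x. power_list k (l x))"
proof (induction k)
  case (Suc k)
  have "PT (\<lambda>p. power_list k (l (fst p)))" by (rule PT_comp[OF _ Suc]) (intro PT_intros)
  then show ?case unfolding power_list.simps by (intro PT_intros assms)
qed (simp add: PT_const)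

definition take_nonzero :: "nat list \<Rightarrow> bool list" where
  "take_nonzero xs = rev (snd (foldl (\<lambda>t a. if fst t \<and> a \<noteq> 0 then (True, (a = 2) # snd t) else (False, snd t))
     (True, []) xs))"

lemma take_nonzero:
  assumes "\<And>i. i < length y \<Longrightarrow> cell xs i = bit_sym (y ! i)" "cell xs (length y) = 0"
  shows "take_nonzero xs = y"
proof -
  let ?h = "\<lambda>t a. if fst t \<and> a \<noteq> 0 then (True, ((a::nat) = 2) # snd t) else (False, snd t)"
  have F: "foldl ?h (False, s) xs = (False, s)" for s xs by (induction xs) auto
  have "rev (snd (foldl ?h (True, s) xs)) = rev s @ y" for s
    using assms
  proof (induction y arbitrary: xs s)
    case Nil
    then show ?case by (cases xs) (auto simp: F simp del: neq0_conv)
  next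
    case (Cons b y)
    from Cons.prems(1)[of 0] have c0: "cell xs 0 = bit_sym b" by simp
    then obtain xs' where xs: "xs = bit_sym b # xs'" by (cases xs) (auto simp: bit_sym_def split: if_splits)
    have "rev (snd (foldl ?h (True, b # s) xs')) = rev (b # s) @ y"
      by (rule Cons.IH) (use Cons.prems(1)[of "Suc _"] Cons.prems(2) xs in auto)
    then show ?case using xs by (cases b) (auto simp: bit_sym_def)
  qed
  from this[of "[]"] show ?thesis by (simp add: take_nonzero_def)
qed

lemma sz_bool: "sz (b :: bool) \<le> 3" "1 \<le> sz b"
  by (cases b; simp)+

lemma PT_take_nonzero [PT_intros]:
  assumes "PT l"
  shows "PT (\<lambda>x. take_nonzero (l x))"
  unfolding take_nonzero_def
proof (intro PT_rev PT_snd)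
  let ?h = "\<lambda>t a. if fst t \<and> a \<noteq> 0 then (True, ((a::nat) = 2) # snd t) else (False, snd t)"
  show "PT (\<lambda>x. foldl ?h (True, []) (l x))"
  proof (rule PT_fold_incr[where D = "\<lambda>_. 6" and I = "\<lambda>_ _. True"])
    show "PT (\<lambda>p. ?h (fst (snd p)) (snd (snd p)))" by (intro PT_intros)
    show "sz (?h t a) \<le> sz t + 6" for t a
    proof (cases t)
      case (Pair b s)
      show ?thesis using sz_bool(1)[of "a = 2"] sz_bool(2)[of b] Pair by auto
    qed
  qed (auto intro!: PT_intros assms)
qed

definition drop_along :: "'b list \<Rightarrow> 'a list \<Rightarrow> 'a list" where
  "drop_along cs xs = foldl (\<lambda>t _. tl t) xs cs"

lemma drop_along: "drop_along cs xs = drop (length cs) xs"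
  unfolding drop_along_def by (induction cs arbitrary: xs) (auto simp: drop_Suc)

lemma sz_tl: "sz (tl xs) \<le> sz xs"
  by (cases xs) auto

lemma PT_drop_along [PT_intros]:
  assumes "PT c" "PT l"
  shows "PT (\<lambda>x. drop_along (c x) (l x))"
  unfolding drop_along_def
proof (rule PT_fold_incr[where D = "\<lambda>_. 0" and I = "\<lambda>_ _. True"])
  show "PT (\<lambda>p. tl (fst (snd p)))" by (intro PT_intros)
qed (auto intro!: PT_intros assms sz_tl)

text \<open>The step function looks the transition up in a finite table; in the halting state it rewrites
  the scanned symbols.\<close>

definition lstep :: "(nat \<times> nat list \<Rightarrow> nat \<times> (nat \<times> move) list) \<Rightarrow> nat \<times> ltape list \<Rightarrow> nat \<times> ltape list" where
  "lstep G c = (let r = G (fst c, map lread (snd c))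
     in (fst r, map (\<lambda>p. lact (fst p) (snd p)) (zip (snd r) (snd c))))"

lemma PT_lstep: "PT G \<Longrightarrow> PT (lstep G)"
  unfolding lstep_def Let_def by (intro PT_intros; (rule PT_comp[of _ G], intro PT_intros)?)

lemma PT_bit_sym [PT_intros]: "PT f \<Longrightarrow> PT (\<lambda>x. bit_sym (f x))"
  unfolding bit_sym_def by (intro PT_intros)

lemma foldl_const: "foldl (\<lambda>t _. h t) s xs = (h ^^ length xs) s"
  by (induction xs arbitrary: s) (simp_all add: funpow_Suc_right del: funpow.simps)

lemma sz_lact: "fst a < A \<Longrightarrow> sz (lact a l) \<le> sz l + (2 * A + 4)"
  using sz_tl[of "snd l"]
  by (cases l; cases a) (auto simp: lact_def sz_nat split: list.split)

lemma sz_map_lact: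
  "length as = length ts \<Longrightarrow> \<forall>a\<in>set as. fst a < A \<Longrightarrow>
     sz (map (\<lambda>p. lact (fst p) (snd p)) (zip as ts)) \<le> sz ts + length ts * (2 * A + 4)"
proof (induction as ts rule: list_induct2)
  case (Cons a as t ts)
  then show ?case using sz_lact[of a A t] by auto
qed simp

lemma cell_drop: "cell (drop n xs) i = cell xs (n + i)"
  by (auto simp: cell_def)

lemma cell_tape:
  assumes "tape_rel u (ls, rs)" "int (length ls) = int n + snd u"
  shows "cell (rev ls @ rs) (n + i) = fst u (int i)"
proof (cases "n + i < length ls")
  case True
  define j where "j = length ls - Suc (n + i)"
  have "fst u (snd u - 1 - int j) = cell ls j" using assms(1) by (simp add: tape_rel_def)
  moreover have "snd u - 1 - int j = int i" using assms(2) True by (simp add: j_def)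
  ultimately have "fst u (int i) = cell ls j" by simp
  also have "\<dots> = cell (rev ls @ rs) (n + i)" using True by (simp add: cell_def nth_append rev_nth j_def)
  finally show ?thesis ..
next
  case False
  define j where "j = n + i - length ls"
  have "fst u (snd u + int j) = cell rs j" using assms(1) by (simp add: tape_rel_def)
  moreover have "snd u + int j = int i" using assms(2) False by (simp add: j_def of_nat_diff)
  ultimately have "fst u (int i) = cell rs j" by simp
  also have "\<dots> = cell (rev ls @ rs) (n + i)" using False by (auto simp: cell_def nth_append j_def)
  finally show ?thesis ..
qed

lemma tm_step_halt: "fst C = states M \<Longrightarrow> (tm_step M ^^ n) C = C"
  by (induction n) (auto simp: tm_step_def)

definition lread_output :: "bool list \<Rightarrow> nat \<times> ltape list \<Rightarrow> bool list" where
  "lread_output cs c = (case snd c of [] \<Rightarrow> [] | l # _ \<Rightarrow> take_nonzero (drop_along cs (rev (fst l) @ snd l)))"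

text \<open>A fold over a clock of length n^k + k applies the step function. It may continue after
  the machine has halted, since a halted configuration is a fixed point. The step function keeps
  symbols and states in finite ranges, so a configuration grows by at most a constant per
  step.\<close>

theorem polytime_imp_PT:
  assumes "polytime f"
  shows "PT f"
proof -
  obtain M k where wf: "tm_wf M" and M: "\<And>x. \<exists>t \<le> length x ^ k + k.
      fst ((tm_step M ^^ t) (tm_init M x)) = states M \<and> tm_outputs ((tm_step M ^^ t) (tm_init M x)) (f x)"
    using assms unfolding polytime_def by blast
  define A K where "A = symbols M" and "K = tapes M"
  have K: "K \<ge> 1" and A: "A \<ge> 3" using wf by (auto simp: A_def K_def tm_wf_def)
  define dom where "dom = {..states M} \<times> {s. set s \<subseteq> {..<A} \<and> length s = K}"
  have fin: "finite dom" unfolding dom_def by (intro finite_cartesian_product finite_lists_length_eq) auto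
  obtain G where G: "PT G" "\<And>x. x \<in> dom \<Longrightarrow>
      G x = (if fst x < states M then delta M (fst x) (snd x) else (fst x, map (\<lambda>a. (a, MStay)) (snd x)))"
    by (rule PT_finite[OF fin]) (rule that)
  define inv where "inv c \<longleftrightarrow> fst c \<le> states M \<and> length (snd c) = K \<and>
      (\<forall>l\<in>set (snd c). set (fst l) \<subseteq> {..<A} \<and> set (snd l) \<subseteq> {..<A})" for c :: "nat \<times> ltape list"
  have in_dom: "(fst c, map lread (snd c)) \<in> dom" if "inv c" for c
  proof -
    have "lread l < A" if "set (snd l) \<subseteq> {..<A}" for l
      using that A by (auto simp: lread_def split: list.split)
    then show ?thesis using that by (auto simp: dom_def inv_def)
  qed
  have Gr: "fst (G x) \<le> states M \<and> length (snd (G x)) = K \<and> (\<forall>a\<in>set (snd (G x)). fst a < A)" if x: "x \<in> dom" for x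
  proof (cases "fst x < states M")
    case True
    have "length (snd x) = tapes M" "\<forall>a\<in>set (snd x). a < symbols M"
      using x by (auto simp: dom_def A_def K_def)
    with True wf have "fst (delta M (fst x) (snd x)) \<le> states M \<and> length (snd (delta M (fst x) (snd x))) = tapes M \<and>
        (\<forall>a\<in>set (snd (delta M (fst x) (snd x))). fst a < symbols M)" unfolding tm_wf_def by blast
    with True G(2)[OF x] show ?thesis by (simp add: A_def K_def)
  next
    case False
    with x G(2)[OF x] show ?thesis by (auto simp: dom_def)
  qed
  have inv_step: "inv (lstep G c)" if c: "inv c" for c
  proof -
    note r = Gr[OF in_dom[OF c]]
    have L: "set (fst (lact a l)) \<subseteq> {..<A} \<and> set (snd (lact a l)) \<subseteq> {..<A}"
      if "fst a < A" "set (fst l) \<subseteq> {..<A}" "set (snd l) \<subseteq> {..<A}" for a l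
      using that A
      by (cases "snd l") (auto simp: lact_def split: list.split)
    have "set (fst (lact (fst p) (snd p))) \<subseteq> {..<A} \<and> set (snd (lact (fst p) (snd p))) \<subseteq> {..<A}"
      if "p \<in> set (zip (snd (G (fst c, map lread (snd c)))) (snd c))" for p
    proof -
      have "fst p \<in> set (snd (G (fst c, map lread (snd c))))" "snd p \<in> set (snd c)"
        using that set_zip_leftD[of "fst p" "snd p"] set_zip_rightD[of "fst p" "snd p"] by simp_all
      with r c show ?thesis unfolding inv_def by (intro L) blast+
    qed
    then show ?thesis using r c by (auto simp: lstep_def inv_def Let_def)
  qed
  have incr: "sz (lstep G c) \<le> sz c + (2 * states M + 1 + K * (2 * A + 4))" if c: "inv c" for c
  proof -
    note r = Gr[OF in_dom[OF c]]
    have "sz (snd (lstep G c)) \<le> sz (snd c) + K * (2 * A + 4)"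
      using sz_map_lact[of "snd (G (fst c, map lread (snd c)))" "snd c" A] r c
      by (simp add: lstep_def Let_def inv_def)
    moreover have "sz (fst (lstep G c)) \<le> 2 * states M + 1"
      using r by (simp add: lstep_def Let_def sz_nat)
    ultimately show ?thesis by (cases c; cases "lstep G c") auto
  qed
  define clock where "clock x = power_list k x @ replicate k True" for x :: "bool list"
  have lc: "length (clock x) = length x ^ k + k" for x by (simp add: clock_def)
  \<comment> \<open>As many explicit blanks as the clock has ticks are laid out left of the input.
    They cannot be used up in that many steps, so cell 0 always has the index
    \<open>length (clock x)\<close> in the whole tape, and the output is found by dropping that many
    cells.\<close>
  define start where "start x = (0 :: nat, (map (\<lambda>_. 0 :: nat) (clock x), map bit_sym x) # replicate (K - 1) ([], []))"
    for x :: "bool list"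
  have start: "inv (start x)" for x
    using K A by (auto simp: inv_def start_def bit_sym_def)
  have PTc: "PT clock" unfolding clock_def by (intro PT_intros)
  have PTs: "PT start" unfolding start_def
    by (intro PT_pair PT_Cons PT_const PT_map PTc PT_id PT_bit_sym PT_snd)
  have PTf: "PT (\<lambda>x. foldl (\<lambda>c _. lstep G c) (start x) (clock x))"
  proof (rule PT_fold_incr[where D = "\<lambda>_. 2 * states M + 1 + K * (2 * A + 4)" and I = "\<lambda>_. inv"])
    show "PT (\<lambda>p. lstep G (fst (snd p)))" by (rule PT_comp[OF _ PT_lstep[OF G(1)]]) (intro PT_intros)
    show "sz (lstep G t) \<le> sz t + (2 * states M + 1 + K * (2 * A + 4))"
      if "y \<in> set (clock x)" "inv t" for x t and y :: bool
      by (rule incr[OF that(2)])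
  qed (auto intro: PTs PTc start inv_step)
  have "PT (\<lambda>p. lread_output (fst p) (snd p))" unfolding lread_output_def by (intro PT_intros)
  from PT_comp2[OF this PTc PTf]
  have "PT (\<lambda>x. lread_output (clock x) (foldl (\<lambda>c _. lstep G c) (start x) (clock x)))" .
  moreover have "lread_output (clock x) (foldl (\<lambda>c _. lstep G c) (start x) (clock x)) = f x" for x
  proof -
    define n where "n = length (clock x)"
    define rel where "rel C c t \<longleftrightarrow> inv c \<and> fst C = fst c \<and> list_all2 tape_rel (snd C) (snd c) \<and>
        int (length (fst (hd (snd c)))) = int n + snd (hd (snd C)) \<and> n \<le> length (fst (hd (snd c))) + t"
      for C :: config and c t
    have rel0: "rel (tm_init M x) (start x) 0"
    proof -
      have "tape_rel (input_tape x) (map (\<lambda>_. 0) (clock x), map bit_sym x)"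
        by (auto simp: tape_rel_def input_tape_def cell_def)
      moreover have "tape_rel blank_tape ([], [])" by (simp add: tape_rel_def blank_tape_def)
      then have "list_all2 tape_rel (replicate (K - 1) blank_tape) (replicate (K - 1) ([], []))"
        by (simp add: list_all2_conv_all_nth)
      moreover have "snd (input_tape x) = 0" by (simp add: input_tape_def)
      ultimately show ?thesis using start[of x]
        by (simp add: rel_def tm_init_def start_def n_def K_def)
    qed
    have step: "rel (tm_step M C) (lstep G c) (Suc t)" if r: "rel C c t" and t: "t < n" for C c t
    proof -
      have c: "inv c" "fst C = fst c" "list_all2 tape_rel (snd C) (snd c)"
        "int (length (fst (hd (snd c)))) = int n + snd (hd (snd C))" "n \<le> length (fst (hd (snd c))) + t"
        using r by (auto simp: rel_def)
      define as where "as = snd (G (fst c, map lread (snd c)))"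
      note Gd = Gr[OF in_dom[OF c(1)], folded as_def]
      have lens: "length (snd C) = K" "length (snd c) = K" "length as = K"
        using c(1,3) Gd by (auto simp: inv_def list_all2_lengthD)
      have reads: "map tape_read (snd C) = map lread (snd c)"
        using c(3) by (intro nth_equalityI) (auto simp: list_all2_conv_all_nth tape_rel_read)
      have eq: "tm_step M C = (fst (G (fst c, map lread (snd c))), map2 tape_act as (snd C))"
      proof (cases "fst C < states M")
        case True
        then show ?thesis using G(2)[OF in_dom[OF c(1)]] c(2)
          by (simp add: tm_step_def Let_def reads as_def)
      next
        case False
        have "as = map (\<lambda>u. (tape_read u, MStay)) (snd C)"
          using False c(2) G(2)[OF in_dom[OF c(1)]] reads[symmetric] by (simp add: as_def o_def)
        then have "map2 tape_act as (snd C) = snd C"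
          by (intro nth_equalityI) (auto simp: act_stay)
        moreover have "fst C = fst (G (fst c, map lread (snd c)))"
          using False c(2) G(2)[OF in_dom[OF c(1)]] by simp
        ultimately show ?thesis using False by (simp add: tm_step_def prod_eq_iff)
      qed
      have eq': "snd (lstep G c) = map (\<lambda>p. lact (fst p) (snd p)) (zip as (snd c))"
        by (simp add: lstep_def Let_def as_def)
      have l2: "list_all2 tape_rel (snd (tm_step M C)) (snd (lstep G c))"
        unfolding eq eq' using c(3) lens by (auto simp: list_all2_conv_all_nth tape_rel_act)
      obtain a as' u us l ls where h: "as = a # as'" "snd C = u # us" "snd c = l # ls"
        using lens K by (cases as; cases "snd C"; cases "snd c") auto
      have "fst l \<noteq> []" using c(5) t h by auto
      then have "int (length (fst (lact a l))) = int (length (fst l)) + shift (snd a)"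
        by (cases "snd a") (auto simp: lact_def of_nat_diff Suc_le_eq split: list.split)
      moreover have "snd (tape_act a u) = snd u + shift (snd a)" by (simp add: tape_act_def)
      moreover have "shift (snd a) \<ge> -1" by (cases "snd a") auto
      ultimately have "int (length (fst (hd (snd (lstep G c))))) = int n + snd (hd (snd (tm_step M C))) \<and>
          n \<le> length (fst (hd (snd (lstep G c)))) + Suc t"
        using c(4,5) h by (simp add: eq eq')
      then show ?thesis unfolding rel_def using inv_step[OF c(1)] l2
        by (simp add: eq lstep_def Let_def)
    qed
    have "t \<le> n \<Longrightarrow> rel ((tm_step M ^^ t) (tm_init M x)) ((lstep G ^^ t) (start x)) t" for t
      by (induction t) (auto intro: rel0 step)
    then have R: "rel ((tm_step M ^^ n) (tm_init M x)) ((lstep G ^^ n) (start x)) n" by simp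
    obtain t where t: "t \<le> n" "fst ((tm_step M ^^ t) (tm_init M x)) = states M"
      "tm_outputs ((tm_step M ^^ t) (tm_init M x)) (f x)"
      using M[of x] by (auto simp: n_def lc)
    have "(tm_step M ^^ n) (tm_init M x) = (tm_step M ^^ (n - t)) ((tm_step M ^^ t) (tm_init M x))"
      using t(1) funpow_add[of "n - t" t "tm_step M"] by (simp add: o_def)
    with tm_step_halt[OF t(2)] t(3) have out: "tm_outputs ((tm_step M ^^ n) (tm_init M x)) (f x)" by simp
    define C c where "C = (tm_step M ^^ n) (tm_init M x)" and "c = (lstep G ^^ n) (start x)"
    have r: "inv c" "list_all2 tape_rel (snd C) (snd c)" "int (length (fst (hd (snd c)))) = int n + snd (hd (snd C))"
      using R by (auto simp: rel_def C_def c_def)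
    obtain u us l ls where h: "snd C = u # us" "snd c = l # ls"
      using r(1,2) K by (cases "snd C"; cases "snd c") (auto simp: inv_def)
    have cu: "cell (rev (fst l) @ snd l) (n + i) = fst u (int i)" for i
      using cell_tape[of u "fst l" "snd l" n i] r(2,3) h by simp
    have "take_nonzero (drop n (rev (fst l) @ snd l)) = f x"
    proof (rule take_nonzero)
      show "cell (drop n (rev (fst l) @ snd l)) i = bit_sym (f x ! i)" if "i < length (f x)" for i
        using out that h(1) by (simp add: cell_drop cu tm_outputs_def C_def[symmetric] del: drop_append)
      show "cell (drop n (rev (fst l) @ snd l)) (length (f x)) = 0"
        using out h(1) by (simp add: cell_drop cu tm_outputs_def C_def[symmetric] del: drop_append)
    qed
    then show ?thesis
      using h(2) by (simp add: lread_output_def foldl_const drop_along n_def c_def)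
  qed
  ultimately show ?thesis by simp
qed

section \<open>Moments of sampled sums, the Boolean cube, and multiplicative weights\<close>

section \<open>Tuples\<close>

primrec tuples :: "nat \<Rightarrow> 'a list \<Rightarrow> 'a list list" where
  "tuples 0 xs = [[]]"
| "tuples (Suc k) xs = concat (map (\<lambda>x. map ((#) x) (tuples k xs)) xs)"

lemma length_tuples [simp]: "length (tuples k xs) = length xs ^ k"
  by (induction k) (auto simp: length_concat o_def sum_list_triv)

lemma set_tuples: "set (tuples k xs) = {w. length w = k \<and> set w \<subseteq> set xs}"
proof (induction k)
  case (Suc k)
  show ?case
  proof (intro set_eqI iffI)
    fix w assume "w \<in> {w. length w = Suc k \<and> set w \<subseteq> set xs}"
    then show "w \<in> set (tuples (Suc k) xs)" using Suc by (cases w) auto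
  qed (use Suc in auto)
qed auto

lemma sum_list_tuples_Suc:
  "(\<Sum>w\<leftarrow>tuples (Suc k) xs. F w) = (\<Sum>x\<leftarrow>xs. \<Sum>w\<leftarrow>tuples k xs. F (x # w))"
  for F :: "_ \<Rightarrow> 'b::comm_monoid_add"
proof -
  have "(\<Sum>w\<leftarrow>concat (map (\<lambda>x. map ((#) x) T) ys). F w) = (\<Sum>x\<leftarrow>ys. \<Sum>w\<leftarrow>T. F (x # w))" for T ys
    by (induction ys) (auto simp: o_def)
  then show ?thesis by simp
qed

lemma sum_list_const_real: "(\<Sum>x\<leftarrow>xs. c) = real (length xs) * c"
  by (induction xs) (auto simp: algebra_simps)

text \<open>The expectation of a sum over \<open>k\<close> independent uniform entries of
  \<open>xs\<close>, multiplied by the denominators.\<close>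

lemma tuples_linear:
  fixes g :: "'a \<Rightarrow> real" and xs :: "'a list"
  defines "n \<equiv> real (length xs)"
  shows "n * (\<Sum>w\<leftarrow>tuples k xs. \<Sum>f\<leftarrow>w. g f) = real k * n ^ k * (\<Sum>f\<leftarrow>xs. g f)"
proof (induction k)
  case (Suc k)
  let ?S = "\<Sum>w\<leftarrow>tuples k xs. \<Sum>f\<leftarrow>w. g f"
  have "(\<Sum>w\<leftarrow>tuples (Suc k) xs. \<Sum>f\<leftarrow>w. g f) = (\<Sum>x\<leftarrow>xs. n ^ k * g x + ?S)"
    unfolding sum_list_tuples_Suc
    by (simp add: sum_list_addf sum_list_const_real n_def)
  also have "\<dots> = n ^ k * (\<Sum>f\<leftarrow>xs. g f) + n * ?S"
    by (simp add: sum_list_addf sum_list_const_real sum_list_const_mult n_def)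
  finally show ?case using Suc by (simp add: algebra_simps)
qed simp

text \<open>For \<open>k\<close> independent uniform draws, the expected square of the sum of
  \<open>g\<close> is at most k^2 times the squared mean of \<open>g\<close> plus k times the mean
  of g^2. The second part comes from the diagonal; clearing denominators includes the empty
  list.\<close>

lemma tuples_quadratic:
  fixes g :: "'a \<Rightarrow> real" and xs :: "'a list"
  defines "n \<equiv> real (length xs)"
  shows "n ^ 2 * (\<Sum>w\<leftarrow>tuples k xs. (\<Sum>f\<leftarrow>w. g f) ^ 2)
     \<le> n ^ k * (real k ^ 2 * (\<Sum>f\<leftarrow>xs. g f) ^ 2 + real k * n * (\<Sum>f\<leftarrow>xs. g f ^ 2))"
proof (induction k)
  case (Suc k)
  let ?S = "\<Sum>w\<leftarrow>tuples k xs. \<Sum>f\<leftarrow>w. g f" and ?Q = "\<Sum>w\<leftarrow>tuples k xs. (\<Sum>f\<leftarrow>w. g f) ^ 2"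
  let ?B = "\<Sum>f\<leftarrow>xs. g f" and ?C = "\<Sum>f\<leftarrow>xs. g f ^ 2"
  have n: "n \<ge> 0" by (simp add: n_def)
  have lin: "n * ?S = real k * n ^ k * ?B" unfolding n_def by (rule tuples_linear)
  have "(\<Sum>w\<leftarrow>tuples (Suc k) xs. (\<Sum>f\<leftarrow>w. g f) ^ 2) = (\<Sum>x\<leftarrow>xs. n ^ k * g x ^ 2 + 2 * ?S * g x + ?Q)"
    unfolding sum_list_tuples_Suc
    by (simp add: power2_sum sum_list_addf sum_list_const_real sum_list_const_mult n_def algebra_simps)
  also have "\<dots> = n ^ k * ?C + 2 * ?S * ?B + n * ?Q"
    by (simp add: sum_list_addf sum_list_const_real sum_list_const_mult n_def)
  finally have "n ^ 2 * (\<Sum>w\<leftarrow>tuples (Suc k) xs. (\<Sum>f\<leftarrow>w. g f) ^ 2)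
      = n ^ 2 * n ^ k * ?C + 2 * n * (n * ?S) * ?B + n * (n ^ 2 * ?Q)"
    by (simp add: algebra_simps power2_eq_square)
  also have "\<dots> \<le> n ^ 2 * n ^ k * ?C + 2 * n * (real k * n ^ k * ?B) * ?B
      + n * (n ^ k * (real k ^ 2 * ?B ^ 2 + real k * n * ?C))"
    unfolding lin by (intro add_left_mono mult_left_mono Suc n)
  also have "\<dots> = n ^ Suc k * ((real k ^ 2 + 2 * real k) * ?B ^ 2 + real (Suc k) * n * ?C)"
    by (simp add: algebra_simps power2_eq_square)
  also have "\<dots> \<le> n ^ Suc k * (real (Suc k) ^ 2 * ?B ^ 2 + real (Suc k) * n * ?C)"
    using n by (intro mult_left_mono add_right_mono mult_right_mono) (auto simp: power2_eq_square algebra_simps)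
  finally show ?case .
qed simp

section \<open>A second moment bound on the cube\<close>

definition cube :: "nat \<Rightarrow> bool list set" where
  "cube n = {y. length y = n}"

lemma finite_cube [simp]: "finite (cube n)"
  using finite_lists_length_eq[of "UNIV :: bool set" n] by (simp add: cube_def)

lemma cube_Suc: "cube (Suc n) = (#) False ` cube n \<union> (#) True ` cube n"
proof (intro set_eqI iffI)
  fix y assume "y \<in> cube (Suc n)"
  then show "y \<in> (#) False ` cube n \<union> (#) True ` cube n" by (cases y) (auto simp: cube_def)
qed (auto simp: cube_def)

lemma sum_cube_Suc: "(\<Sum>y\<in>cube (Suc n). F y) = (\<Sum>y\<in>cube n. F (False # y) + F (True # y))"
  for F :: "_ \<Rightarrow> 'b::comm_monoid_add"
proof -
  have "(\<Sum>y\<in>cube (Suc n). F y) = sum F ((#) False ` cube n) + sum F ((#) True ` cube n)"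
    unfolding cube_Suc by (rule sum.union_disjoint) auto
  then show ?thesis by (simp add: sum.reindex sum.distrib)
qed

lemma card_cube [simp]: "card (cube n) = 2 ^ n"
proof (induction n)
  case (Suc n)
  show ?case using sum_cube_Suc[of "\<lambda>_. 1::nat" n] Suc by simp
qed (simp add: cube_def)

lemma card_cube_coordinate:
  "a < n \<Longrightarrow> 2 * card {y \<in> cube n. \<not> y ! a} = 2 ^ n"
proof -
  assume a: "a < n"
  have "bij_betw (\<lambda>y. y[a := \<not> y ! a]) {y \<in> cube n. \<not> y ! a} {y \<in> cube n. y ! a}"
    by (rule bij_betw_byWitness[where f' = "\<lambda>y. y[a := \<not> y ! a]"]) (use a in \<open>auto simp: cube_def list_update_same_conv\<close>)
  then have "card {y \<in> cube n. \<not> y ! a} = card {y \<in> cube n. y ! a}" by (rule bij_betw_same_card)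
  moreover have "card {y \<in> cube n. \<not> y ! a} + card {y \<in> cube n. y ! a} = card (cube n)"
    by (subst card_Un_disjoint[symmetric]) (auto intro!: arg_cong[where f = card] simp del: card_cube)
  ultimately show ?thesis by simp
qed

text \<open>For a uniform string the centred bits are independent with mean 0 and variance
  1/4.\<close>

lemma cube_moments:
  fixes c :: "nat \<Rightarrow> real"
  shows "(\<Sum>y\<in>cube n. \<Sum>a<n. c a * (of_bool (y ! a) - 1/2)) = 0"
    and "(\<Sum>y\<in>cube n. (\<Sum>a<n. c a * (of_bool (y ! a) - 1/2)) ^ 2) = 2 ^ n / 4 * (\<Sum>a<n. c a ^ 2)"
proof (induction n arbitrary: c)
  case (Suc n)
  have e: "(\<Sum>a<Suc n. c a * (of_bool ((b # y) ! a) - 1/2))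
      = c 0 * (of_bool b - 1/2) + (\<Sum>a<n. c (Suc a) * (of_bool (y ! a) - 1/2))" for b y and c :: "nat \<Rightarrow> real"
    by (subst sum.lessThan_Suc_shift) simp
  {
    case (1 c)
    let ?s = "\<lambda>y. \<Sum>a<n. c (Suc a) * (of_bool (y ! a) - 1/2)"
    have "(\<Sum>y\<in>cube (Suc n). \<Sum>a<Suc n. c a * (of_bool (y ! a) - 1/2)) = (\<Sum>y\<in>cube n. 2 * ?s y)"
      unfolding sum_cube_Suc e by (rule sum.cong) auto
    then show ?case using Suc(1)[of "\<lambda>a. c (Suc a)"] by (simp only: sum_distrib_left[symmetric])
  next
    case (2 c)
    let ?s = "\<lambda>y. \<Sum>a<n. c (Suc a) * (of_bool (y ! a) - 1/2)"
    have "(\<Sum>y\<in>cube (Suc n). (\<Sum>a<Suc n. c a * (of_bool (y ! a) - 1/2)) ^ 2)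
        = (\<Sum>y\<in>cube n. c 0 ^ 2 / 2 + 2 * ?s y ^ 2)"
      unfolding sum_cube_Suc e by (rule sum.cong) (auto simp: power2_eq_square algebra_simps)
    also have "\<dots> = 2 ^ n * (c 0 ^ 2 / 2) + 2 * (\<Sum>y\<in>cube n. ?s y ^ 2)"
      by (simp add: sum.distrib sum_distrib_left)
    also have "\<dots> = 2 ^ Suc n / 4 * (c 0 ^ 2 + (\<Sum>a<n. c (Suc a) ^ 2))"
      using Suc(2)[of "\<lambda>a. c (Suc a)"] by (simp add: algebra_simps)
    finally show ?case by (simp only: sum.lessThan_Suc_shift)
  }
qed (auto simp: cube_def)

text \<open>Chebyshev's inequality for the centred linear form with coefficients
  \<open>c\<close>.\<close>

lemma halfspace_card:
  fixes c :: "nat \<Rightarrow> real"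
  assumes "F \<subseteq> cube n" "\<And>y. y \<in> F \<Longrightarrow> (\<Sum>a<n. c a * (of_bool (y ! a) - 1/2)) \<ge> t" "t \<ge> 0"
  shows "real (card F) * t ^ 2 \<le> 2 ^ n / 4 * (\<Sum>a<n. c a ^ 2)"
proof -
  have "real (card F) * t ^ 2 = (\<Sum>y\<in>F. t ^ 2)" by simp
  also have "\<dots> \<le> (\<Sum>y\<in>F. (\<Sum>a<n. c a * (of_bool (y ! a) - 1/2)) ^ 2)"
    using assms(2,3) by (intro sum_mono power_mono) auto
  also have "\<dots> \<le> (\<Sum>y\<in>cube n. (\<Sum>a<n. c a * (of_bool (y ! a) - 1/2)) ^ 2)"
    using assms(1) by (intro sum_mono2) auto
  finally show ?thesis unfolding cube_moments(2) .
qed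

section \<open>Multiplicative weights\<close>

text \<open>The weight of a coordinate grows by the factor \<open>1 + \<beta>\<close> whenever it is hit, so that the
  normalized weights are a probability vector for which a lightly hit new point exists.\<close>

lemma multiplicative_weights:
  fixes z :: "'x \<Rightarrow> nat \<Rightarrow> bool" and pt :: "'x \<Rightarrow> 'y" and \<theta> \<beta> :: real
  assumes X: "finite X" and q: "q \<ge> 1" and \<beta>: "\<beta> > 0" "\<theta> \<ge> 0"
    and many: "\<And>c. (\<And>b. c b \<ge> 0) \<Longrightarrow> (\<Sum>b<q. c b) = 1 \<Longrightarrow>
      h \<le> card (pt ` {x \<in> X. (\<Sum>b<q. c b * of_bool (z x b)) < \<theta>})"
    and param: "real q * (1 + \<beta> * \<theta>) ^ h < (1 + \<beta>) ^ Suc k"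
  obtains t where "length t = h" "set t \<subseteq> X" "distinct (map pt t)"
    "\<And>b. b < q \<Longrightarrow> length (filter (\<lambda>x. z x b) t) \<le> k"
proof -
  \<comment> \<open>The final potential stays below (1 + \<beta>)^(k+1) by \<open>param\<close>; a
    coordinate hit k+1 times would reach this value alone.\<close>
  define \<Phi> where "\<Phi> t = (\<Sum>b<q. (1 + \<beta>) ^ length (filter (\<lambda>x. z x b) t))" for t
  have "\<exists>t. length t = n \<and> set t \<subseteq> X \<and> distinct (map pt t) \<and> \<Phi> t \<le> real q * (1 + \<beta> * \<theta>) ^ n"
    if "n \<le> h" for n
    using that
  proof (induction n)
    case 0
    show ?case by (intro exI[of _ "[]"]) (simp add: \<Phi>_def)
  next
    case (Suc n)
    then obtain t where t: "length t = n" "set t \<subseteq> X" "distinct (map pt t)" "\<Phi> t \<le> real q * (1 + \<beta> * \<theta>) ^ n"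
      by auto
    let ?w = "\<lambda>b. (1 + \<beta>) ^ length (filter (\<lambda>x. z x b) t)"
    have w0: "?w b > 0" for b using \<beta> by simp
    have \<Phi>0: "\<Phi> t > 0" unfolding \<Phi>_def using q w0 by (intro sum_pos) (auto simp: lessThan_empty_iff)
    define c where "c b = ?w b / \<Phi> t" for b
    have c: "c b \<ge> 0" for b using w0[of b] \<Phi>0 by (simp add: c_def)
    have "(\<Sum>b<q. c b) = 1" using \<Phi>0 by (simp add: c_def sum_divide_distrib[symmetric] \<Phi>_def[symmetric])
    note m = many[OF c this]
    let ?Y = "pt ` {x \<in> X. (\<Sum>b<q. c b * of_bool (z x b)) < \<theta>}"
    \<comment> \<open>Fewer than \<open>h\<close> points are in use, while at least \<open>h\<close>
      are light for the current weights; so one of the light points is new.\<close>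
    have "card (set (map pt t)) < card ?Y"
      using t(1) card_length[of "map pt t"] m Suc.prems by simp
    then have "\<not> ?Y \<subseteq> set (map pt t)" using card_mono[of "set (map pt t)" ?Y] by auto
    then obtain x where x: "x \<in> X" "(\<Sum>b<q. c b * of_bool (z x b)) < \<theta>" "pt x \<notin> set (map pt t)" by auto
    have "\<Phi> (x # t) = (\<Sum>b<q. ?w b * (1 + \<beta> * of_bool (z x b)))"
      unfolding \<Phi>_def by (rule sum.cong) auto
    also have "\<dots> = \<Phi> t + \<beta> * (\<Phi> t * (\<Sum>b<q. c b * of_bool (z x b)))"
      using \<Phi>0 unfolding c_def \<Phi>_def[symmetric] sum_distrib_left
      by (simp add: algebra_simps sum.distrib \<Phi>_def[symmetric] sum_distrib_left)
    also have "\<dots> \<le> \<Phi> t + \<beta> * (\<Phi> t * \<theta>)"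
      using x(2) \<beta> \<Phi>0 by (intro add_left_mono mult_left_mono) auto
    also have "\<dots> = \<Phi> t * (1 + \<beta> * \<theta>)" by (simp add: algebra_simps)
    also have "\<dots> \<le> real q * (1 + \<beta> * \<theta>) ^ n * (1 + \<beta> * \<theta>)"
      using t(4) \<beta> by (intro mult_right_mono) auto
    finally show ?case using t x by (intro exI[of _ "x # t"]) (auto simp: algebra_simps)
  qed
  then obtain t where t: "length t = h" "set t \<subseteq> X" "distinct (map pt t)" "\<Phi> t \<le> real q * (1 + \<beta> * \<theta>) ^ h"
    by blast
  have "length (filter (\<lambda>x. z x b) t) \<le> k" if "b < q" for b
  proof (rule ccontr)
    assume "\<not> ?thesis"
    then have "(1 + \<beta>) ^ Suc k \<le> (1 + \<beta>) ^ length (filter (\<lambda>x. z x b) t)"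
      using \<beta> by (intro power_increasing) auto
    also have "\<dots> \<le> \<Phi> t" unfolding \<Phi>_def
      by (rule member_le_sum) (use that \<beta> in auto)
    finally show False using t(4) param by linarith
  qed
  with t that show thesis by blast
qed

section \<open>The covering problem of a unique game: completeness and soundness\<close>

section \<open>From unique games to covering problems\<close>

definition star :: "('e \<Rightarrow> 'u) \<Rightarrow> 'e list \<Rightarrow> 'u \<Rightarrow> 'e list" where
  "star l E u = filter (\<lambda>e. l e = u) E"

text \<open>The edges at \<open>u\<close> are repeated cyclically up to the length of \<open>E\<close>. This makes the number of
  stars sampled at \<open>u\<close> proportional to the degree of \<open>u\<close>, at the price of a factor \<open>2\<close> in the
  uniformity of the samples.\<close>

definition padded_star :: "('e \<Rightarrow> 'u) \<Rightarrow> 'e list \<Rightarrow> 'u \<Rightarrow> 'e list" where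
  "padded_star l E u = map snd (zip E (concat (map (\<lambda>_. star l E u) E)))"

definition samples :: "('e \<Rightarrow> 'u) \<Rightarrow> nat \<Rightarrow> 'e list \<Rightarrow> 'e list list" where
  "samples l L E = concat (map (\<lambda>e. tuples L (padded_star l E (l e))) E)"

lemma concat_replicate_add: "concat (replicate (m + n) xs) = concat (replicate m xs) @ concat (replicate n xs)"
  by (simp add: replicate_add)

lemma length_concat_replicate: "length (concat (replicate n xs)) = n * length xs"
  by (induction n) auto

lemma take_concat_replicate:
  assumes "N \<le> a * length xs" "N \<le> b * length xs"
  shows "take N (concat (replicate a xs)) = take N (concat (replicate b xs))"
proof -
  have "take N (concat (replicate a xs)) = take N (concat (replicate (a + b) xs))"
    unfolding concat_replicate_add using assms by (simp add: length_concat_replicate)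
  also have "\<dots> = take N (concat (replicate b xs))"
    unfolding add.commute[of a] concat_replicate_add using assms by (simp add: length_concat_replicate)
  finally show ?thesis .
qed

lemma sum_list_take_le:
  fixes g :: "'a \<Rightarrow> real"
  assumes "\<And>x. g x \<ge> 0"
  shows "(\<Sum>x\<leftarrow>take n xs. g x) \<le> (\<Sum>x\<leftarrow>xs. g x)"
proof -
  have "(\<Sum>x\<leftarrow>xs. g x) = (\<Sum>x\<leftarrow>take n xs. g x) + (\<Sum>x\<leftarrow>drop n xs. g x)"
    by (metis append_take_drop_id map_append sum_list_append)
  then show ?thesis using assms by (auto intro!: sum_list_nonneg)
qed

lemma sum_list_concat_replicate:
  "(\<Sum>x\<leftarrow>concat (replicate k xs). g x) = real k * (\<Sum>x\<leftarrow>xs. g x)" for g :: "'a \<Rightarrow> real"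
  by (induction k) (auto simp: algebra_simps)

lemma sum_list_filter: "(\<Sum>x\<leftarrow>filter P xs. g x) = (\<Sum>x\<leftarrow>xs. of_bool (P x) * g x)" for g :: "'a \<Rightarrow> real"
  by (induction xs) auto

lemma length_filter_real: "real (length (filter P xs)) = (\<Sum>x\<leftarrow>xs. of_bool (P x))"
  by (induction xs) auto

lemma sum_list_swap: "(\<Sum>x\<leftarrow>xs. \<Sum>y\<leftarrow>ys. f x y) = (\<Sum>y\<leftarrow>ys. \<Sum>x\<leftarrow>xs. f x y)" for f :: "'a \<Rightarrow> 'b \<Rightarrow> real"
  by (induction xs) (auto simp: sum_list_addf)

lemma sum_sum_list_swap: "(\<Sum>a\<in>A. \<Sum>x\<leftarrow>xs. f a x) = (\<Sum>x\<leftarrow>xs. \<Sum>a\<in>A. f a x)" for f :: "'a \<Rightarrow> 'b \<Rightarrow> real"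
  by (induction xs) (auto simp: sum.distrib)

lemma sum_list_nth: "(\<Sum>x\<leftarrow>xs. f x) = (\<Sum>i<length xs. f (xs ! i))"
  by (simp add: sum_list_sum_nth atLeast0LessThan)

lemma set_padded_star: "set (padded_star l E u) \<subseteq> set (star l E u)"
  unfolding padded_star_def by (auto dest!: set_zip_rightD split: if_splits)

context
  fixes l :: "'e \<Rightarrow> 'u" and E :: "'e list" and e :: 'e
  assumes e: "e \<in> set E"
begin

lemma length_star: "1 \<le> length (star l E (l e))" "length (star l E (l e)) \<le> length E"
proof -
  have "e \<in> set (star l E (l e))" using e by (simp add: star_def)
  then show "1 \<le> length (star l E (l e))" by (cases "star l E (l e)") auto
  show "length (star l E (l e)) \<le> length E" by (simp add: star_def)
qed

lemma padded_star_eq: "padded_star l E (l e) = take (length E) (concat (replicate (length E) (star l E (l e))))"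
proof -
  have "length (concat (replicate (length E) (star l E (l e)))) \<ge> length E"
    using length_star by (simp add: length_concat_replicate)
  then show ?thesis
    unfolding padded_star_def map_replicate_const by (simp add: map_snd_zip_take)
qed

lemma length_padded_star [simp]: "length (padded_star l E (l e)) = length E"
  unfolding padded_star_eq using length_star by (simp add: length_concat_replicate)

lemma sum_padded_star:
  fixes g :: "'e \<Rightarrow> real"
  assumes "\<And>x. g x \<ge> 0"
  shows "real (length (star l E (l e))) * (\<Sum>f\<leftarrow>padded_star l E (l e). g f)
     \<le> 2 * real (length E) * (\<Sum>f\<leftarrow>star l E (l e). g f)"
proof -
  let ?s = "star l E (l e)"
  \<comment> \<open>\<open>k\<close> copies of the star reach the length of \<open>E\<close>. Only
    the last one is cut, and \<open>d\<close> is at most that length, whence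
    \<open>k * d <= 2 * length E\<close>: the origin of the factor 2.\<close>
  define d k where "d = length ?s" and "k = length E div d + 1"
  have d: "1 \<le> d" "d \<le> length E" using length_star by (auto simp: d_def)
  have "length E \<le> k * d" unfolding k_def
    using dividend_less_div_times[of d "length E"] d(1) by simp
  moreover have "length E \<le> length E * d" using d by simp
  ultimately have "padded_star l E (l e) = take (length E) (concat (replicate k ?s))"
    unfolding padded_star_eq d_def by (rule take_concat_replicate[rotated])
  then have "(\<Sum>f\<leftarrow>padded_star l E (l e). g f) \<le> real k * (\<Sum>f\<leftarrow>?s. g f)"
    unfolding sum_list_concat_replicate[symmetric] using sum_list_take_le[OF assms] by simp
  then have "real d * (\<Sum>f\<leftarrow>padded_star l E (l e). g f) \<le> real d * (real k * (\<Sum>f\<leftarrow>?s. g f))"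
    by (rule mult_left_mono) simp
  also have "\<dots> = real (k * d) * (\<Sum>f\<leftarrow>?s. g f)" by simp
  also have "length E div d * d \<le> length E" by simp
  then have "k * d \<le> 2 * length E" unfolding k_def add_mult_distrib using d(2) by linarith
  then have "real (k * d) * (\<Sum>f\<leftarrow>?s. g f) \<le> real (2 * length E) * (\<Sum>f\<leftarrow>?s. g f)"
    by (intro mult_right_mono sum_list_nonneg) (auto simp: assms simp del: of_nat_mult)
  finally show ?thesis by (simp add: d_def)
qed

end

text \<open>Replacing a uniform edge by a uniform edge at the same left vertex yields a uniform edge
  again.\<close>

lemma double_count:
  fixes g :: "'e \<Rightarrow> real"
  shows "(\<Sum>e\<leftarrow>E. (\<Sum>f\<leftarrow>star l E (l e). g f) / real (length (star l E (l e)))) = (\<Sum>f\<leftarrow>E. g f)"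
proof -
  let ?d = "\<lambda>u. real (length (star l E u))"
  have "(\<Sum>e\<leftarrow>E. (\<Sum>f\<leftarrow>star l E (l e). g f) / ?d (l e)) = (\<Sum>e\<leftarrow>E. \<Sum>f\<leftarrow>E. of_bool (l f = l e) * g f / ?d (l e))"
    unfolding star_def[of l E "l _"] sum_list_filter by (simp add: divide_inverse sum_list_mult_const)
  also have "\<dots> = (\<Sum>f\<leftarrow>E. \<Sum>e\<leftarrow>E. of_bool (l f = l e) * g f / ?d (l e))" by (rule sum_list_swap)
  also have "\<dots> = (\<Sum>f\<leftarrow>E. g f)"
  proof (rule arg_cong[where f = sum_list], rule map_cong[OF refl])
    fix f assume f: "f \<in> set E"
    have "(\<Sum>e\<leftarrow>E. of_bool (l f = l e) * g f / ?d (l e)) = (\<Sum>e\<leftarrow>E. of_bool (l e = l f) * (g f / ?d (l f)))"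
      by (rule arg_cong[where f = sum_list], rule map_cong) auto
    also have "\<dots> = (\<Sum>e\<leftarrow>E. of_bool (l e = l f)) * (g f / ?d (l f))"
      by (rule sum_list_mult_const)
    also have "\<dots> = ?d (l f) * (g f / ?d (l f))" unfolding star_def length_filter_real ..
    also have "\<dots> = g f" using length_star(1)[OF f, of l] by (simp add: Suc_le_eq)
    finally show "(\<Sum>e\<leftarrow>E. of_bool (l f = l e) * g f / ?d (l e)) = g f" .
  qed
  finally show ?thesis .
qed

lemma length_samples: "length (samples l L E) = length E ^ Suc L"
proof -
  have "length (samples l L E) = sum_list (map (\<lambda>e. length E ^ L) E)"
    unfolding samples_def length_concat map_map by (rule arg_cong[where f = sum_list], rule map_cong) auto
  then show ?thesis by (simp add: sum_list_triv)
qed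

lemma in_samples:
  assumes "w \<in> set (samples l L E)"
  obtains e where "e \<in> set E" "length w = L" "\<And>f. f \<in> set w \<Longrightarrow> f \<in> set E \<and> l f = l e"
proof -
  obtain e where e: "e \<in> set E" "w \<in> set (tuples L (padded_star l E (l e)))"
    using assms by (auto simp: samples_def)
  show thesis
    by (rule that[of e]) (use e set_padded_star[of l E "l e"] in \<open>auto simp: set_tuples star_def\<close>)
qed

lemma sum_samples: "(\<Sum>w\<leftarrow>samples l L E. F w) = (\<Sum>e\<leftarrow>E. \<Sum>w\<leftarrow>tuples L (padded_star l E (l e)). F w)"
  for F :: "_ \<Rightarrow> real"
proof -
  have "(\<Sum>w\<leftarrow>concat (map (\<lambda>e. tuples L (padded_star l E (l e))) xs). F w)
      = (\<Sum>e\<leftarrow>xs. \<Sum>w\<leftarrow>tuples L (padded_star l E (l e)). F w)" for xs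
    by (induction xs) auto
  then show ?thesis by (simp add: samples_def)
qed

text \<open>Each of the \<open>L\<close> entries of a random sample is a uniform edge up to the
  factor 2 lost by padding.\<close>

lemma sum_samples_linear:
  fixes g :: "'e \<Rightarrow> real"
  assumes "\<And>f. g f \<ge> 0" "E \<noteq> []"
  shows "(\<Sum>w\<leftarrow>samples l L E. \<Sum>f\<leftarrow>w. g f) \<le> 2 * real L * real (length E) ^ L * (\<Sum>f\<leftarrow>E. g f)"
proof -
  let ?n = "real (length E)" and ?d = "\<lambda>e. real (length (star l E (l e)))"
  have n: "?n > 0" using assms(2) by simp
  have "(\<Sum>w\<leftarrow>samples l L E. \<Sum>f\<leftarrow>w. g f)
      \<le> (\<Sum>e\<leftarrow>E. 2 * real L * ?n ^ L * ((\<Sum>f\<leftarrow>star l E (l e). g f) / ?d e))"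
    unfolding sum_samples
  proof (rule sum_list_mono)
    fix e assume e: "e \<in> set E"
    have d: "?d e > 0" using length_star(1)[OF e, of l] by (simp add: Suc_le_eq)
    have "?n * (\<Sum>w\<leftarrow>tuples L (padded_star l E (l e)). \<Sum>f\<leftarrow>w. g f)
        = real L * ?n ^ L * (\<Sum>f\<leftarrow>padded_star l E (l e). g f)"
      using tuples_linear[of "padded_star l E (l e)" g L] e by simp
    also have "\<dots> \<le> real L * ?n ^ L * (2 * ?n * (\<Sum>f\<leftarrow>star l E (l e). g f) / ?d e)"
      using sum_padded_star[OF e assms(1), of l] d by (intro mult_left_mono) (auto simp: field_simps)
    finally have "?n * (\<Sum>w\<leftarrow>tuples L (padded_star l E (l e)). \<Sum>f\<leftarrow>w. g f)
        \<le> ?n * (2 * real L * ?n ^ L * ((\<Sum>f\<leftarrow>star l E (l e). g f) / ?d e))"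
      by (simp add: algebra_simps)
    then show "(\<Sum>w\<leftarrow>tuples L (padded_star l E (l e)). \<Sum>f\<leftarrow>w. g f)
        \<le> 2 * real L * ?n ^ L * ((\<Sum>f\<leftarrow>star l E (l e). g f) / ?d e)"
      using n by (rule mult_left_le_imp_le)
  qed
  also have "\<dots> = 2 * real L * ?n ^ L * (\<Sum>f\<leftarrow>E. g f)"
    by (simp only: sum_list_const_mult double_count)
  finally show ?thesis .
qed

locale label_game =
  fixes E :: "'e list" and l :: "'e \<Rightarrow> 'u" and r :: "'e \<Rightarrow> 'v" and p :: "'e \<Rightarrow> nat \<Rightarrow> nat" and q :: nat
  assumes ne: "E \<noteq> []" and q: "q \<ge> 1"
    and bij: "\<And>e. e \<in> set E \<Longrightarrow> bij_betw (p e) {..<q} {..<q}"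
begin

text \<open>Samples are addressed by index because the list may contain equal ones. The point
  \<open>(i, y)\<close> occurs with every edge \<open>f\<close> of its sample, and each occurrence
  belongs to the right vertex of that edge.\<close>

definition spots :: "nat \<Rightarrow> nat \<Rightarrow> (nat \<times> 'e \<times> bool list) set" where
  "spots L Q = {(i, f, y). i < length (samples l L E) \<and> f \<in> set (samples l L E ! i) \<and> y \<in> cube Q}"

text \<open>For \<open>x = (i, f, y)\<close> the labels hit are the images under \<open>p f\<close>
  of the labels \<open>a\<close> with bit 1 in \<open>y\<close>. Coordinates from \<open>q\<close>
  up to \<open>Q\<close> are ignored; they only enlarge the cube.\<close>

definition hits :: "nat \<Rightarrow> nat \<times> 'e \<times> bool list \<Rightarrow> bool" where
  "hits b x = (\<exists>a<q. p (fst (snd x)) a = b \<and> snd (snd x) ! a)"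

definition point :: "nat \<times> 'e \<times> bool list \<Rightarrow> nat \<times> bool list" where
  "point x = (fst x, snd (snd x))"

definition balanced :: "nat \<Rightarrow> (nat \<times> 'e \<times> bool list) list \<Rightarrow> bool" where
  "balanced k t \<longleftrightarrow> (\<exists>v. \<forall>x\<in>set t. r (fst (snd x)) = v) \<and> (\<forall>b<q. length (filter (hits b) t) \<le> k)"

lemma finite_spots: "finite (spots L Q)"
proof (rule finite_subset)
  show "spots L Q \<subseteq> {..<length (samples l L E)} \<times> (\<Union>(set ` set (samples l L E)) \<times> cube Q)"
    using nth_mem by (fastforce simp: spots_def)
qed auto

text \<open>A sample with a violated edge is covered entirely, any other one by half. Broken samples
  form a fraction of at most \<open>2 * L * z\<close>, which adds \<open>L * z\<close> to the 1/2.
  On an unbroken sample all edges \<open>f\<close> carry the common left label to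
  \<open>B (r f)\<close>, so every uncovered point of a balanced family hits the one label
  \<open>B v\<close>, and at most \<open>k\<close> of them do.\<close>

lemma small_cover:
  assumes A: "\<And>u. A u < q" and B: "\<And>v. B v < q"
    and bad: "real (length (filter (\<lambda>e. p e (A (l e)) \<noteq> B (r e)) E)) \<le> z * real (length E)"
    and L: "L \<ge> 1" and Q: "q \<le> Q" and z: "z \<ge> 0"
  obtains S where "S \<subseteq> {..<length (samples l L E)} \<times> cube Q"
    "real (card S) \<le> 2 ^ Q * (1/2 + real L * z) * real (length (samples l L E))"
    "\<And>t k. set t \<subseteq> spots L Q \<Longrightarrow> balanced k t \<Longrightarrow> card (point ` set t - S) \<le> k"
proof -
  let ?W = "samples l L E"
  define broken where "broken w \<longleftrightarrow> (\<exists>e\<in>set w. p e (A (l e)) \<noteq> B (r e))" for w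
  define lab where "lab w = A (l (hd w))" for w
  define S where "S = (SIGMA i : {..<length ?W}. {y \<in> cube Q. broken (?W ! i) \<or> \<not> y ! lab (?W ! i)})"
  show thesis
  proof (rule that)
    show "S \<subseteq> {..<length ?W} \<times> cube Q" by (auto simp: S_def)
    have c: "real (card {y \<in> cube Q. broken (?W ! i) \<or> \<not> y ! lab (?W ! i)})
        \<le> 2 ^ Q * (1/2 + 1/2 * of_bool (broken (?W ! i)))" for i
    proof (cases "broken (?W ! i)")
      case True
      then show ?thesis by simp
    next
      case False
      have "lab (?W ! i) < Q" using A[of "l (hd (?W ! i))"] Q by (simp add: lab_def)
      from arg_cong[OF card_cube_coordinate[OF this], of real]
      have "2 * real (card {y \<in> cube Q. \<not> y ! lab (?W ! i)}) = 2 ^ Q" by simp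
      with False show ?thesis by simp
    qed
    have "(\<Sum>i<length ?W. of_bool (broken (?W ! i))) = (\<Sum>w\<leftarrow>?W. of_bool (broken w) :: real)"
      by (rule sum_list_nth[symmetric])
    also have "\<dots> \<le> (\<Sum>w\<leftarrow>?W. \<Sum>f\<leftarrow>w. of_bool (p f (A (l f)) \<noteq> B (r f)))"
    proof (rule sum_list_mono)
      fix w
      show "of_bool (broken w) \<le> (\<Sum>f\<leftarrow>w. of_bool (p f (A (l f)) \<noteq> B (r f)) :: real)"
      proof (cases "broken w")
        case True
        then obtain e where "e \<in> set w" "p e (A (l e)) \<noteq> B (r e)" by (auto simp: broken_def)
        then have "length (filter (\<lambda>f. p f (A (l f)) \<noteq> B (r f)) w) \<noteq> 0" by (auto simp: filter_empty_conv)
        then show ?thesis unfolding length_filter_real[symmetric] using True by (simp add: Suc_le_eq)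
      qed (auto intro!: sum_list_nonneg)
    qed
    also have "\<dots> \<le> 2 * real L * real (length E) ^ L * (\<Sum>f\<leftarrow>E. of_bool (p f (A (l f)) \<noteq> B (r f)))"
      by (rule sum_samples_linear) (use ne in auto)
    also have "\<dots> \<le> 2 * real L * real (length E) ^ L * (z * real (length E))"
      unfolding length_filter_real[symmetric] by (intro mult_left_mono bad) auto
    also have "\<dots> = 2 * real L * z * real (length ?W)"
      by (simp add: length_samples)
    finally have brk: "(\<Sum>i<length ?W. of_bool (broken (?W ! i))) \<le> 2 * real L * z * real (length ?W)" .
    have "real (card S) = (\<Sum>i<length ?W. real (card {y \<in> cube Q. broken (?W ! i) \<or> \<not> y ! lab (?W ! i)}))"
      unfolding S_def by (subst card_SigmaI) auto
    also have "\<dots> \<le> (\<Sum>i<length ?W. 2 ^ Q * (1/2 + 1/2 * of_bool (broken (?W ! i))))"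
      by (rule sum_mono) (rule c)
    also have "\<dots> = 2 ^ Q * (1/2 * real (length ?W) + 1/2 * (\<Sum>i<length ?W. of_bool (broken (?W ! i))))"
      by (simp only: sum_distrib_left sum.distrib distrib_left) simp
    also have "\<dots> \<le> 2 ^ Q * (1/2 * real (length ?W) + 1/2 * (2 * real L * z * real (length ?W)))"
      using brk by (intro mult_left_mono add_left_mono) auto
    finally show "real (card S) \<le> 2 ^ Q * (1/2 + real L * z) * real (length ?W)"
      by (simp add: algebra_simps)
    fix t k assume t: "set t \<subseteq> spots L Q" "balanced k t"
    then obtain v where v: "\<forall>x\<in>set t. r (fst (snd x)) = v" "\<And>b. b < q \<Longrightarrow> length (filter (hits b) t) \<le> k"
      by (auto simp: balanced_def)
    have "point ` set t - S \<subseteq> point ` set (filter (hits (B v)) t)"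
    proof
      fix a assume "a \<in> point ` set t - S"
      then obtain i f y where x: "(i, f, y) \<in> set t" "a = (i, y)" "(i, y) \<notin> S" by (auto simp: point_def)
      have s: "i < length ?W" "f \<in> set (?W ! i)" "y \<in> cube Q" using t(1) x(1) by (auto simp: spots_def)
      have nb: "\<not> broken (?W ! i)" "y ! lab (?W ! i)" using x(3) s by (auto simp: S_def)
      have "?W ! i \<in> set ?W" using s(1) by simp
      then obtain e where e: "\<And>f. f \<in> set (?W ! i) \<Longrightarrow> f \<in> set E \<and> l f = l e" "length (?W ! i) = L"
        by (rule in_samples) blast
      have "hd (?W ! i) \<in> set (?W ! i)" using e(2) L by (cases "?W ! i") auto
      then have "lab (?W ! i) = A (l f)" using e(1)[OF s(2)] e(1) by (simp add: lab_def)
      moreover have "p f (A (l f)) = B (r f)" using nb(1) s(2) by (auto simp: broken_def)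
      moreover have "r f = v" using v(1) x(1) by force
      ultimately have "hits (B v) (i, f, y)" using nb(2) A by (auto simp: hits_def)
      then show "a \<in> point ` set (filter (hits (B v)) t)" using x by (force simp: point_def)
    qed
    then have "card (point ` set t - S) \<le> card (point ` set (filter (hits (B v)) t))"
      by (rule card_mono[rotated]) simp
    also have "\<dots> \<le> length (filter (hits (B v)) t)"
      by (rule order_trans[OF card_image_le card_length]) simp
    also have "\<dots> \<le> k" by (rule v(2)[OF B])
    finally show "card (point ` set t - S) \<le> k" .
  qed
qed

text \<open>A deterministic form of drawing random labels. \<open>A u\<close> maximizes the mass
  \<open>s u a\<close>; the squares then sum to at most \<open>s u (A u)\<close> times the degree,
  since the masses at \<open>u\<close> sum to the degree. \<open>B v\<close> maximizes the number of
  satisfied edges at \<open>v\<close>, which is at least the average under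
  \<open>\<mu> v\<close>.\<close>

lemma greedy_labeling:
  fixes \<mu> :: "'v \<Rightarrow> nat \<Rightarrow> real"
  assumes \<mu>: "\<And>v b. \<mu> v b \<ge> 0" "\<And>v. (\<Sum>b<q. \<mu> v b) = 1"
    and large: "(\<Sum>e\<leftarrow>E. (\<Sum>a<q. (\<Sum>f\<leftarrow>star l E (l e). \<mu> (r f) (p f a)) ^ 2)
        / real (length (star l E (l e))) ^ 2) \<ge> \<gamma> * real (length E)"
  obtains A B where "\<And>u. A u < q" "\<And>v. B v < q"
    "real (length (filter (\<lambda>e. p e (A (l e)) = B (r e)) E)) \<ge> \<gamma> * real (length E)"
proof -
  have ex: "\<exists>a<q. \<forall>b<q. g b \<le> g a" for g :: "nat \<Rightarrow> real"
  proof -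
    have "Max (g ` {..<q}) \<in> g ` {..<q}" using q by (intro Max_in) (auto simp: lessThan_empty_iff)
    then obtain a where "a < q" "g a = Max (g ` {..<q})" by auto
    then show ?thesis by (intro exI[of _ a]) auto
  qed
  define s where "s u a = (\<Sum>f\<leftarrow>star l E u. \<mu> (r f) (p f a))" for u a
  define A where "A u = (SOME a. a < q \<and> (\<forall>b<q. s u b \<le> s u a))" for u
  have A: "\<And>u. A u < q" "\<And>u a. a < q \<Longrightarrow> s u a \<le> s u (A u)"
    using someI_ex[OF ex[of "s _"]] unfolding A_def by blast+
  define N where "N v b = real (length (filter (\<lambda>f. r f = v \<and> p f (A (l f)) = b) E))" for v b
  define B where "B v = (SOME a. a < q \<and> (\<forall>b<q. N v b \<le> N v a))" for v
  have B: "\<And>v. B v < q" "\<And>v b. b < q \<Longrightarrow> N v b \<le> N v (B v)"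
    using someI_ex[OF ex[of "N _"]] unfolding B_def by blast+
  have s0: "s u a \<ge> 0" for u a unfolding s_def by (intro sum_list_nonneg) (auto simp: \<mu>)
  have s1: "(\<Sum>a<q. s u a) = real (length (star l E u))" for u
  proof -
    have "(\<Sum>a<q. s u a) = (\<Sum>f\<leftarrow>star l E u. \<Sum>a<q. \<mu> (r f) (p f a))"
      unfolding s_def by (rule sum_sum_list_swap)
    also have "\<dots> = (\<Sum>f\<leftarrow>star l E u. 1)"
    proof (rule arg_cong[where f = sum_list], rule map_cong[OF refl])
      fix f assume "f \<in> set (star l E u)"
      then have "f \<in> set E" by (simp add: star_def)
      from sum.reindex_bij_betw[OF bij[OF this], of "\<mu> (r f)"] \<mu>(2)
      show "(\<Sum>a<q. \<mu> (r f) (p f a)) = 1" by simp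
    qed
    finally show ?thesis by (simp add: sum_list_const_real)
  qed
  have "\<gamma> * real (length E) \<le> (\<Sum>e\<leftarrow>E. s (l e) (A (l e)) / real (length (star l E (l e))))"
    using large
  proof (rule order_trans)
    show "(\<Sum>e\<leftarrow>E. (\<Sum>a<q. (\<Sum>f\<leftarrow>star l E (l e). \<mu> (r f) (p f a)) ^ 2) / real (length (star l E (l e))) ^ 2)
        \<le> (\<Sum>e\<leftarrow>E. s (l e) (A (l e)) / real (length (star l E (l e))))"
    proof (rule sum_list_mono)
      fix e assume e: "e \<in> set E"
      let ?d = "real (length (star l E (l e)))"
      have d: "?d > 0" using length_star(1)[OF e, of l] by (simp add: Suc_le_eq)
      have "(\<Sum>a<q. s (l e) a ^ 2) \<le> (\<Sum>a<q. s (l e) (A (l e)) * s (l e) a)"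
        unfolding power2_eq_square by (intro sum_mono mult_right_mono A s0) auto
      also have "\<dots> = s (l e) (A (l e)) * ?d" by (simp add: sum_distrib_left[symmetric] s1)
      finally show "(\<Sum>a<q. (\<Sum>f\<leftarrow>star l E (l e). \<mu> (r f) (p f a)) ^ 2) / ?d ^ 2 \<le> s (l e) (A (l e)) / ?d"
        unfolding s_def[symmetric] using d by (simp add: divide_simps power2_eq_square)
    qed
  qed
  also have "\<dots> = (\<Sum>e\<leftarrow>E. (\<Sum>f\<leftarrow>star l E (l e). \<mu> (r f) (p f (A (l f)))) / real (length (star l E (l e))))"
  proof (rule arg_cong[where f = sum_list], rule map_cong[OF refl], rule arg_cong[where f = "\<lambda>x. x / _"])
    fix e show "s (l e) (A (l e)) = (\<Sum>f\<leftarrow>star l E (l e). \<mu> (r f) (p f (A (l f))))"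
      unfolding s_def by (rule arg_cong[where f = sum_list], rule map_cong) (auto simp: star_def)
  qed
  also have "\<dots> = (\<Sum>f\<leftarrow>E. \<mu> (r f) (p f (A (l f))))" by (rule double_count)
  also have "\<dots> = (\<Sum>f\<leftarrow>E. \<Sum>v\<in>r ` set E. \<Sum>b<q. \<mu> v b * of_bool (r f = v \<and> p f (A (l f)) = b))"
  proof (rule arg_cong[where f = sum_list], rule map_cong[OF refl])
    fix f assume f: "f \<in> set E"
    have pf: "p f (A (l f)) < q" using bij_betw_apply[OF bij[OF f]] A(1) by auto
    have "(\<Sum>b<q. \<mu> v b * of_bool (r f = v \<and> p f (A (l f)) = b)) = (if r f = v then \<mu> v (p f (A (l f))) else 0)" for v
    proof (cases "r f = v")
      case True
      then have "(\<Sum>b<q. \<mu> v b * of_bool (r f = v \<and> p f (A (l f)) = b)) = (\<Sum>b<q. if p f (A (l f)) = b then \<mu> v b else 0)"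
        by (intro sum.cong) auto
      with True pf show ?thesis by simp
    qed simp
    then have "(\<Sum>v\<in>r ` set E. \<Sum>b<q. \<mu> v b * of_bool (r f = v \<and> p f (A (l f)) = b)) = \<mu> (r f) (p f (A (l f)))"
      using f by simp
    then show "\<mu> (r f) (p f (A (l f))) = (\<Sum>v\<in>r ` set E. \<Sum>b<q. \<mu> v b * of_bool (r f = v \<and> p f (A (l f)) = b))" ..
  qed
  also have "\<dots> = (\<Sum>v\<in>r ` set E. \<Sum>b<q. \<mu> v b * N v b)"
    unfolding sum_sum_list_swap[symmetric] N_def length_filter_real by (simp add: sum_list_const_mult)
  also have "\<dots> \<le> (\<Sum>v\<in>r ` set E. \<Sum>b<q. \<mu> v b * N v (B v))"
    by (intro sum_mono mult_left_mono B \<mu>) auto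
  also have "\<dots> = (\<Sum>v\<in>r ` set E. N v (B v))" by (simp add: sum_distrib_right[symmetric] \<mu>)
  also have "\<dots> = (\<Sum>f\<leftarrow>E. of_bool (p f (A (l f)) = B (r f)))"
    unfolding N_def length_filter_real sum_sum_list_swap
  proof (rule arg_cong[where f = sum_list], rule map_cong[OF refl])
    fix f assume f: "f \<in> set E"
    have "(\<Sum>v\<in>r ` set E. of_bool (r f = v \<and> p f (A (l f)) = B v))
        = (\<Sum>v\<in>r ` set E. if r f = v then of_bool (p f (A (l f)) = B v) else 0 :: real)"
      by (intro sum.cong) auto
    also have "\<dots> = of_bool (p f (A (l f)) = B (r f))" using f by simp
    finally show "(\<Sum>v\<in>r ` set E. of_bool (r f = v \<and> p f (A (l f)) = B v)) = (of_bool (p f (A (l f)) = B (r f)) :: real)" .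
  qed
  finally show thesis using that[of A B] A(1) B(1) by (simp add: length_filter_real)
qed

lemma no_small_cover:
  fixes \<eta> \<beta> \<delta> :: real
  assumes S: "finite S" "real (card S) + real (length (samples l L E)) * real L * real h
      \<le> (1 - \<delta>) * 2 ^ Q * real (length (samples l L E))"
    and cover: "\<And>t. set t \<subseteq> spots L Q \<Longrightarrow> length t = h \<Longrightarrow> balanced k t \<Longrightarrow> card (point ` set t - S) < h"
    and \<eta>: "\<eta> > 0" and \<beta>: "\<beta> > 0" and \<delta>: "\<delta> > 0"
    and param: "real q * (1 + \<beta> * (1/2 + \<eta>)) ^ h < (1 + \<beta>) ^ Suc k"
    and L: "real L * (2 * \<eta>\<^sup>2 * \<delta>) \<ge> 1" and Q: "q \<le> Q"
  obtains A B where "\<And>u. A u < q" "\<And>v. B v < q"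
    "real (length (filter (\<lambda>e. p e (A (l e)) = B (r e)) E)) \<ge> \<eta>\<^sup>2 * \<delta> / 2 * real (length E)"
proof -
  let ?W = "samples l L E" and ?n = "real (length E)" and ?\<theta> = "1/2 + \<eta>"
  have n: "?n > 0" using ne by simp
  have L1: "L \<ge> 1" using L by (cases L) auto
  define near where "near v = {x \<in> spots L Q. r (fst (snd x)) = v \<and> point x \<notin> S}" for v
  have fin: "finite (near v)" for v using finite_spots[of L Q] by (simp add: near_def)
  have "\<forall>v. \<exists>c. (\<forall>b. c b \<ge> 0) \<and> (\<Sum>b<q. c b) = 1 \<and>
      card (point ` {x \<in> near v. (\<Sum>b<q. c b * of_bool (hits b x)) < ?\<theta>}) < h"
  proof (rule allI, rule ccontr)
    fix v
    assume "\<nexists>c. (\<forall>b. c b \<ge> 0) \<and> (\<Sum>b<q. c b) = 1 \<and>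
      card (point ` {x \<in> near v. (\<Sum>b<q. c b * of_bool (hits b x)) < ?\<theta>}) < h"
    then have many: "\<And>c. (\<And>b. c b \<ge> 0) \<Longrightarrow> (\<Sum>b<q. c b) = 1 \<Longrightarrow>
        h \<le> card (point ` {x \<in> near v. (\<Sum>b<q. c b * of_bool (hits b x)) < ?\<theta>})"
      using not_le by blast
    have \<theta>0: "?\<theta> \<ge> 0" using \<eta> by simp
    obtain t where t: "length t = h" "set t \<subseteq> near v" "distinct (map point t)"
        "\<And>b. b < q \<Longrightarrow> length (filter (\<lambda>x. hits b x) t) \<le> k"
      by (rule multiplicative_weights[OF fin q \<beta> \<theta>0 many param]) (assumption, assumption, rule that)
    have "card (point ` set t - S) < h"
    proof (rule cover)
      show "balanced k t" unfolding balanced_def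
        by (intro conjI exI[of _ v]) (use t in \<open>auto simp: near_def\<close>)
    qed (use t in \<open>auto simp: near_def\<close>)
    moreover have "point ` set t - S = point ` set t" using t(2) by (auto simp: near_def)
    moreover have "card (point ` set t) = h"
      using distinct_card[OF t(3)] t(1) by simp
    ultimately show False by simp
  qed
  from choice[OF this] obtain \<mu> where \<mu>: "\<And>v b. \<mu> v b \<ge> 0" "\<And>v. (\<Sum>b<q. \<mu> v b) = 1"
    "\<And>v. card (point ` {x \<in> near v. (\<Sum>b<q. \<mu> v b * of_bool (hits b x)) < ?\<theta>}) < h"
    by blast
  \<comment> \<open>The distribution of the right vertex of \<open>f\<close>, pulled back along the
    permutation of \<open>f\<close> to labels of the left vertex, where the edges of one sample can
    be compared.\<close>
  define \<Lambda> where "\<Lambda> f a = \<mu> (r f) (p f a)" for f a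
  have \<Lambda>0: "\<Lambda> f a \<ge> 0" for f a by (simp add: \<Lambda>_def \<mu>)
  have \<Lambda>1: "(\<Sum>a<q. \<Lambda> f a) = 1" if "f \<in> set E" for f
    using sum.reindex_bij_betw[OF bij[OF that], of "\<mu> (r f)"] \<mu>(2) by (simp add: \<Lambda>_def)
  have hit_sum: "(\<Sum>b<q. \<mu> (r f) b * of_bool (hits b (i, f, y))) = (\<Sum>a<q. \<Lambda> f a * of_bool (y ! a))"
    if "f \<in> set E" for i f y
  proof -
    have "(\<Sum>b<q. \<mu> (r f) b * of_bool (hits b (i, f, y)))
        = (\<Sum>a<q. \<mu> (r f) (p f a) * of_bool (hits (p f a) (i, f, y)))"
      by (rule sum.reindex_bij_betw[OF bij[OF that], symmetric])
    also have "\<dots> = (\<Sum>a<q. \<Lambda> f a * of_bool (y ! a))"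
    proof (rule sum.cong[OF refl])
      fix a assume a: "a \<in> {..<q}"
      have "hits (p f a) (i, f, y) \<longleftrightarrow> y ! a"
        using a bij[OF that] by (auto simp: hits_def bij_betw_def inj_on_def)
      then show "\<mu> (r f) (p f a) * of_bool (hits (p f a) (i, f, y)) = \<Lambda> f a * of_bool (y ! a)"
        by (simp add: \<Lambda>_def)
    qed
    finally show ?thesis .
  qed
  have wE: "f \<in> set E" if "i < length ?W" "f \<in> set (?W ! i)" for i f
    using in_samples[OF nth_mem[OF that(1)]] that(2) by blast
  define bad where "bad v = point ` {x \<in> near v. (\<Sum>b<q. \<mu> v b * of_bool (hits b x)) < ?\<theta>}" for v
  have finbad: "finite (bad v)" for v using fin by (simp add: bad_def)
  \<comment> \<open>Uncovered strings that are heavy for every edge of sample \<open>i\<close>. Each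
    edge spoils fewer than \<open>h\<close> uncovered strings, so at most \<open>L * h\<close> are
    lost; the size hypothesis on \<open>S\<close> contains this loss, summed over all
    samples.\<close>
  define F where "F i = {y \<in> cube Q. (i, y) \<notin> S \<and> (\<forall>f\<in>set (?W ! i). (\<Sum>a<q. \<Lambda> f a * of_bool (y ! a)) \<ge> ?\<theta>)}" for i
  have cardF: "2 ^ Q \<le> real (card (F i)) + real (card {y. (i, y) \<in> S}) + real L * real h" if i: "i < length ?W" for i
  proof -
    have "cube Q \<subseteq> F i \<union> {y. (i, y) \<in> S} \<union> (\<Union>f\<in>set (?W ! i). snd ` bad (r f))"
    proof
      fix y assume y: "y \<in> cube Q"
      show "y \<in> F i \<union> {y. (i, y) \<in> S} \<union> (\<Union>f\<in>set (?W ! i). snd ` bad (r f))"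
      proof (cases "y \<in> F i \<or> (i, y) \<in> S")
        case False
        then obtain f where f: "f \<in> set (?W ! i)" "(\<Sum>a<q. \<Lambda> f a * of_bool (y ! a)) < ?\<theta>"
          using y by (auto simp: F_def not_le)
        have "(i, f, y) \<in> near (r f)" using i f(1) y False by (auto simp: near_def spots_def point_def)
        moreover have "(\<Sum>b<q. \<mu> (r f) b * of_bool (hits b (i, f, y))) < ?\<theta>"
          using f(2) hit_sum wE[OF i f(1)] by simp
        ultimately have "point (i, f, y) \<in> bad (r f)" unfolding bad_def by blast
        then have "y \<in> snd ` bad (r f)" by (force simp: point_def)
        with f(1) show ?thesis by blast
      qed auto
    qed
    moreover have finS: "finite {y. (i, y) \<in> S}"
      using S(1) by (rule finite_surj[where f = snd]) force
    moreover have "finite (F i)" by (simp add: F_def)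
    ultimately have "card (cube Q) \<le> card (F i \<union> {y. (i, y) \<in> S} \<union> (\<Union>f\<in>set (?W ! i). snd ` bad (r f)))"
      using finbad by (intro card_mono) auto
    also have "\<dots> \<le> card (F i) + card {y. (i, y) \<in> S} + card (\<Union>f\<in>set (?W ! i). snd ` bad (r f))"
      by (intro order_trans[OF card_Un_le] add_right_mono card_Un_le)
    also have "card (\<Union>f\<in>set (?W ! i). snd ` bad (r f)) \<le> L * h"
    proof -
      have "card (\<Union>f\<in>set (?W ! i). snd ` bad (r f)) \<le> (\<Sum>f\<in>set (?W ! i). card (snd ` bad (r f)))"
        by (rule card_UN_le) simp
      also have "\<dots> \<le> (\<Sum>f\<in>set (?W ! i). h)"
      proof (rule sum_mono)
        fix f
        have "card (snd ` bad (r f)) \<le> card (bad (r f))" by (rule card_image_le[OF finbad])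
        also have "\<dots> \<le> h" using \<mu>(3)[of "r f"] by (simp add: bad_def)
        finally show "card (snd ` bad (r f)) \<le> h" .
      qed
      also have "\<dots> \<le> L * h"
      proof (cases "set (?W ! i) = {}")
        case False
        have "length (?W ! i) = L" by (rule in_samples[OF nth_mem[OF i]])
        then show ?thesis using card_length[of "?W ! i"] by simp
      qed simp
      finally show ?thesis .
    qed
    finally have "card (cube Q) \<le> card (F i) + card {y. (i, y) \<in> S} + L * h" by simp
    then have "real (card (cube Q)) \<le> real (card (F i) + card {y. (i, y) \<in> S} + L * h)"
      by (rule of_nat_mono)
    then show ?thesis by simp
  qed
  \<comment> \<open>On \<open>F i\<close> each of the \<open>L\<close> edges adds at least \<eta> to
    the centred form whose coefficients are the sums of \<Lambda> over the sample. Chebyshev's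
    inequality limits how many strings achieve this; the 4 is the inverse of the variance
    1/4.\<close>
  have F2: "real (card (F i)) * (4 * (real L * \<eta>)\<^sup>2) \<le> 2 ^ Q * (\<Sum>a<q. (\<Sum>f\<leftarrow>?W ! i. \<Lambda> f a)\<^sup>2)" if i: "i < length ?W" for i
  proof -
    \<comment> \<open>Extended by 0 to the coordinates that belong to no label, so that the bound
      for the full cube applies.\<close>
    define c where "c a = (if a < q then \<Sum>f\<leftarrow>?W ! i. \<Lambda> f a else 0)" for a
    have cq: "(\<Sum>a<Q. g (c a) a) = (\<Sum>a<q. g (\<Sum>f\<leftarrow>?W ! i. \<Lambda> f a) a)" if "\<And>a. g 0 a = 0" for g :: "real \<Rightarrow> nat \<Rightarrow> real"
      by (rule sum.mono_neutral_cong_right) (use Q that in \<open>auto simp: c_def\<close>)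
    have "real (card (F i)) * (real L * \<eta>)\<^sup>2 \<le> 2 ^ Q / 4 * (\<Sum>a<Q. (c a)\<^sup>2)"
    proof (rule halfspace_card)
      show "F i \<subseteq> cube Q" by (auto simp: F_def)
      show "0 \<le> real L * \<eta>" using \<eta> by simp
      fix y assume y: "y \<in> F i"
      have "(\<Sum>a<Q. c a * (of_bool (y ! a) - 1/2)) = (\<Sum>a<q. (\<Sum>f\<leftarrow>?W ! i. \<Lambda> f a) * (of_bool (y ! a) - 1/2))"
        by (rule cq) simp
      also have "\<dots> = (\<Sum>f\<leftarrow>?W ! i. \<Sum>a<q. \<Lambda> f a * (of_bool (y ! a) - 1/2))"
        unfolding sum_sum_list_swap[symmetric] by (simp add: sum_list_mult_const)
      also have "\<dots> \<ge> (\<Sum>f\<leftarrow>?W ! i. \<eta>)"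
      proof (rule sum_list_mono)
        fix f assume f: "f \<in> set (?W ! i)"
        have "(\<Sum>a<q. \<Lambda> f a * (of_bool (y ! a) - 1/2)) = (\<Sum>a<q. \<Lambda> f a * of_bool (y ! a)) - 1/2 * (\<Sum>a<q. \<Lambda> f a)"
          by (simp add: algebra_simps sum_subtractf sum_distrib_left)
        moreover have "(\<Sum>a<q. \<Lambda> f a * of_bool (y ! a)) \<ge> 1/2 + \<eta>" using y f unfolding F_def by blast
        ultimately have "(\<Sum>a<q. \<Lambda> f a * (of_bool (y ! a) - 1/2)) \<ge> \<eta>"
          unfolding \<Lambda>1[OF wE[OF i f]] by linarith
        then show "\<eta> \<le> (\<Sum>a<q. \<Lambda> f a * (of_bool (y ! a) - 1/2))" .
      qed
      moreover have "(\<Sum>f\<leftarrow>?W ! i. \<eta>) = real L * \<eta>"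
      proof -
        have "length (?W ! i) = L" by (rule in_samples[OF nth_mem[OF i]])
        then show ?thesis by (simp add: sum_list_const_real)
      qed
      ultimately show "real L * \<eta> \<le> (\<Sum>a<Q. c a * (of_bool (y ! a) - 1/2))" by linarith
    qed
    also have "(\<Sum>a<Q. (c a)\<^sup>2) = (\<Sum>a<q. (\<Sum>f\<leftarrow>?W ! i. \<Lambda> f a)\<^sup>2)" by (rule cq) simp
    finally show ?thesis by simp
  qed
  have cardS: "(\<Sum>i<length ?W. real (card {y. (i, y) \<in> S})) \<le> real (card S)"
  proof -
    have "(\<Sum>i<length ?W. card {y. (i, y) \<in> S}) = card (SIGMA i : {..<length ?W}. {y. (i, y) \<in> S})"
      using finite_surj[OF S(1), of _ snd] by (subst card_SigmaI) (auto intro!: finite_surj[OF S(1), of _ snd] simp: image_iff, force)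
    also have "\<dots> \<le> card S" by (rule card_mono[OF S(1)]) auto
    finally show ?thesis unfolding of_nat_sum[symmetric] of_nat_le_iff .
  qed
  have "\<delta> * real (length ?W) * 2 ^ Q \<le> (\<Sum>i<length ?W. real (card (F i)))"
  proof -
    have "real (length ?W) * 2 ^ Q = (\<Sum>i<length ?W. 2 ^ Q)" by simp
    also have "\<dots> \<le> (\<Sum>i<length ?W. real (card (F i)) + real (card {y. (i, y) \<in> S}) + real L * real h)"
      by (rule sum_mono) (use cardF in auto)
    also have "\<dots> \<le> (\<Sum>i<length ?W. real (card (F i))) + real (card S) + real (length ?W) * real L * real h"
      using cardS by (simp add: sum.distrib)
    finally show ?thesis using S(2) by (simp add: algebra_simps)
  qed
  then have "(\<delta> * real (length ?W) * 2 ^ Q) * (4 * (real L * \<eta>)\<^sup>2) \<le> (\<Sum>i<length ?W. real (card (F i))) * (4 * (real L * \<eta>)\<^sup>2)"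
    by (rule mult_right_mono) simp
  also have "\<dots> \<le> (\<Sum>i<length ?W. 2 ^ Q * (\<Sum>a<q. (\<Sum>f\<leftarrow>?W ! i. \<Lambda> f a)\<^sup>2))"
    unfolding sum_distrib_right by (rule sum_mono) (use F2 in auto)
  also have "\<dots> = 2 ^ Q * (\<Sum>w\<leftarrow>?W. \<Sum>a<q. (\<Sum>f\<leftarrow>w. \<Lambda> f a)\<^sup>2)"
    by (simp only: sum_list_nth[where xs = ?W] sum_distrib_left[symmetric])
  finally have low: "\<delta> * real (length ?W) * (4 * (real L * \<eta>)\<^sup>2) \<le> (\<Sum>w\<leftarrow>?W. \<Sum>a<q. (\<Sum>f\<leftarrow>w. \<Lambda> f a)\<^sup>2)"
    by (simp add: mult.commute mult.left_commute)
  let ?s = "\<lambda>e a. \<Sum>f\<leftarrow>star l E (l e). \<Lambda> f a" and ?d = "\<lambda>e. real (length (star l E (l e)))"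
  \<comment> \<open>Second moment over random samples: the 4 is the square of the padding factor 2,
    and the summand \<open>L\<close> is the diagonal, where the squares of a probability vector sum
    to at most 1.\<close>
  have "(\<Sum>w\<leftarrow>?W. \<Sum>a<q. (\<Sum>f\<leftarrow>w. \<Lambda> f a)\<^sup>2)
      \<le> (\<Sum>e\<leftarrow>E. ?n ^ L * (4 * (real L)\<^sup>2 * ((\<Sum>a<q. (?s e a)\<^sup>2) / (?d e)\<^sup>2) + real L))"
    unfolding sum_samples
  proof (rule sum_list_mono)
    fix e assume e: "e \<in> set E"
    let ?P = "padded_star l E (l e)"
    have d: "?d e > 0" using length_star(1)[OF e, of l] by (simp add: Suc_le_eq)
    have PE: "f \<in> set E" if "f \<in> set ?P" for f using that set_padded_star[of l E "l e"] by (auto simp: star_def)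
    have "?n\<^sup>2 * (\<Sum>w\<leftarrow>tuples L ?P. \<Sum>a<q. (\<Sum>f\<leftarrow>w. \<Lambda> f a)\<^sup>2) = (\<Sum>a<q. ?n\<^sup>2 * (\<Sum>w\<leftarrow>tuples L ?P. (\<Sum>f\<leftarrow>w. \<Lambda> f a)\<^sup>2))"
      by (simp only: sum_sum_list_swap[symmetric] sum_distrib_left)
    also have "\<dots> \<le> (\<Sum>a<q. ?n ^ L * ((real L)\<^sup>2 * (\<Sum>f\<leftarrow>?P. \<Lambda> f a)\<^sup>2 + real L * ?n * (\<Sum>f\<leftarrow>?P. (\<Lambda> f a)\<^sup>2)))"
    proof (rule sum_mono)
      fix a
      show "?n\<^sup>2 * (\<Sum>w\<leftarrow>tuples L ?P. (\<Sum>f\<leftarrow>w. \<Lambda> f a)\<^sup>2)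
        \<le> ?n ^ L * ((real L)\<^sup>2 * (\<Sum>f\<leftarrow>?P. \<Lambda> f a)\<^sup>2 + real L * ?n * (\<Sum>f\<leftarrow>?P. (\<Lambda> f a)\<^sup>2))"
        using tuples_quadratic[of ?P "\<lambda>f. \<Lambda> f a" L] e by simp
    qed
    also have "\<dots> = ?n ^ L * ((real L)\<^sup>2 * (\<Sum>a<q. (\<Sum>f\<leftarrow>?P. \<Lambda> f a)\<^sup>2) + real L * ?n * (\<Sum>f\<leftarrow>?P. \<Sum>a<q. (\<Lambda> f a)\<^sup>2))"
      by (simp only: sum_distrib_left[symmetric] sum.distrib sum_sum_list_swap[symmetric])
    also have "\<dots> \<le> ?n ^ L * ((real L)\<^sup>2 * (\<Sum>a<q. (2 * ?n * ?s e a / ?d e)\<^sup>2) + real L * ?n * ?n)"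
    proof (intro mult_left_mono add_mono sum_mono power_mono)
      fix a
      show "(\<Sum>f\<leftarrow>?P. \<Lambda> f a) \<le> 2 * ?n * ?s e a / ?d e"
        using sum_padded_star[OF e, of "\<lambda>f. \<Lambda> f a" l] d \<Lambda>0 by (simp add: field_simps)
      show "0 \<le> (\<Sum>f\<leftarrow>?P. \<Lambda> f a)" by (intro sum_list_nonneg) (auto simp: \<Lambda>0)
      have "(\<Sum>f\<leftarrow>?P. \<Sum>a<q. (\<Lambda> f a)\<^sup>2) \<le> (\<Sum>f\<leftarrow>?P. 1)"
      proof (rule sum_list_mono)
        fix f assume "f \<in> set ?P"
        note \<Lambda>1 = \<Lambda>1[OF PE[OF this]]
        have "(\<Sum>a<q. (\<Lambda> f a)\<^sup>2) \<le> (\<Sum>a<q. \<Lambda> f a)"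
        proof (rule sum_mono)
          fix a assume "a \<in> {..<q}"
          then have "\<Lambda> f a \<le> (\<Sum>a<q. \<Lambda> f a)" by (intro member_le_sum) (auto simp: \<Lambda>0)
          then show "(\<Lambda> f a)\<^sup>2 \<le> \<Lambda> f a" using \<Lambda>0[of f a] \<Lambda>1 mult_left_le[of "\<Lambda> f a" "\<Lambda> f a"]
            by (simp add: power2_eq_square)
        qed
        then show "(\<Sum>a<q. (\<Lambda> f a)\<^sup>2) \<le> 1" using \<Lambda>1 by simp
      qed
      then show "(\<Sum>f\<leftarrow>?P. \<Sum>a<q. (\<Lambda> f a)\<^sup>2) \<le> ?n" using e by (simp add: sum_list_const_real)
    qed auto
    also have "\<dots> = ?n\<^sup>2 * (?n ^ L * (4 * (real L)\<^sup>2 * ((\<Sum>a<q. (?s e a)\<^sup>2) / (?d e)\<^sup>2) + real L))"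
      by (simp add: power_mult_distrib power_divide sum_distrib_left[symmetric] sum_divide_distrib[symmetric]
          algebra_simps power2_eq_square)
    finally show "(\<Sum>w\<leftarrow>tuples L ?P. \<Sum>a<q. (\<Sum>f\<leftarrow>w. \<Lambda> f a)\<^sup>2)
        \<le> ?n ^ L * (4 * (real L)\<^sup>2 * ((\<Sum>a<q. (?s e a)\<^sup>2) / (?d e)\<^sup>2) + real L)"
      using n by (simp add: mult_le_cancel_left)
  qed
  also have "\<dots> = ?n ^ L * (4 * (real L)\<^sup>2 * (\<Sum>e\<leftarrow>E. (\<Sum>a<q. (?s e a)\<^sup>2) / (?d e)\<^sup>2) + real L * ?n)"
    by (simp only: sum_list_const_mult sum_list_addf sum_list_const_real mult.commute[of ?n "real L"])
  finally have up: "\<delta> * real (length ?W) * (4 * (real L * \<eta>)\<^sup>2)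
      \<le> ?n ^ L * (4 * (real L)\<^sup>2 * (\<Sum>e\<leftarrow>E. (\<Sum>a<q. (?s e a)\<^sup>2) / (?d e)\<^sup>2) + real L * ?n)"
    using low by linarith
  let ?Z = "\<Sum>e\<leftarrow>E. (\<Sum>a<q. (?s e a)\<^sup>2) / (?d e)\<^sup>2"
  have "?n ^ L * (\<delta> * ?n * (4 * (real L * \<eta>)\<^sup>2)) \<le> ?n ^ L * (4 * (real L)\<^sup>2 * ?Z + real L * ?n)"
    using up by (simp add: length_samples algebra_simps)
  then have "\<delta> * ?n * (4 * (real L * \<eta>)\<^sup>2) \<le> 4 * (real L)\<^sup>2 * ?Z + real L * ?n"
    using n by (simp add: mult_le_cancel_left)
  \<comment> \<open>By the choice of \<open>L\<close> the diagonal uses up at most half of the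
    left-hand side; the other half is the correlation between different edges at a left
    vertex.\<close>
  moreover have "real L * ?n \<le> real L * ?n * (real L * (2 * \<eta>\<^sup>2 * \<delta>))"
    using mult_left_mono[OF L, of "real L * ?n"] n by simp
  ultimately have "(4 * (real L)\<^sup>2) * (\<eta>\<^sup>2 * \<delta> / 2 * ?n) \<le> (4 * (real L)\<^sup>2) * ?Z"
    by (simp add: algebra_simps power2_eq_square)
  then have "\<eta>\<^sup>2 * \<delta> / 2 * ?n \<le> ?Z"
    by (rule mult_left_le_imp_le) (use L1 in simp)
  from greedy_labeling[OF \<mu>(1,2) this[unfolded \<Lambda>_def]] that show thesis by blast
qed

end

section \<open>Repetition turns a gap in covering into a gap in server cost\<close>

section \<open>A gap instance of weighted k-server\<close>

text \<open>Weights: \<open>R\<close> for the \<open>n\<close> heavy servers and \<open>1\<close> for the \<open>k\<close> cheap ones. There are \<open>R\<close> phases;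
  in each of them every set in \<open>H\<close> is requested \<open>R\<close> times in full.\<close>

definition gap_requests :: "nat \<Rightarrow> 'a list list \<Rightarrow> 'a list" where
  "gap_requests R H = concat (map (\<lambda>e. concat (replicate R e)) (concat (replicate R H)))"

definition gap_instance :: "nat \<Rightarrow> nat \<Rightarrow> nat \<Rightarrow> nat \<Rightarrow> nat list list \<Rightarrow> wks" where
  "gap_instance P n k R H = \<lparr>points = P,
     servers = replicate n (of_nat R, 1) @ replicate k (1, 1), requests = gap_requests R H\<rparr>"

lemma set_gap_requests: "set (gap_requests R H) \<subseteq> \<Union>(set ` set H)"
  by (auto simp: gap_requests_def split: if_splits)

fun moves :: "'a \<Rightarrow> 'a list \<Rightarrow> nat" where
  "moves p [] = 0"
| "moves p (x # xs) = of_bool (x \<noteq> p) + moves x xs"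

lemma moves_append: "moves p (xs @ ys) = moves p xs + moves (last (p # xs)) ys"
  by (induction xs arbitrary: p) auto

lemma moves_same: "\<forall>y\<in>set xs. y = x \<Longrightarrow> moves p xs \<le> 1"
proof (induction xs arbitrary: p)
  case (Cons y xs)
  have "\<forall>y\<in>set xs. y = x \<Longrightarrow> moves x xs = 0" by (induction xs) auto
  with Cons.prems show ?case by auto
qed simp

lemma moves_blocks:
  "(\<And>b. b \<in> set bs \<Longrightarrow> \<forall>y\<in>set (F b). y = G b) \<Longrightarrow> moves p (concat (map F bs)) \<le> length bs"
proof (induction bs arbitrary: p)
  case (Cons b bs)
  have "moves p (F b) \<le> 1" by (rule moves_same[of _ "G b"]) (use Cons.prems in auto)
  moreover have "moves (last (p # F b)) (concat (map F bs)) \<le> length bs"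
    by (rule Cons.IH) (use Cons.prems in auto)
  ultimately show ?case by (simp add: moves_append del: last.simps)
qed simp

lemma sum_moves: "(\<Sum>t = 1..T. of_bool (f t \<noteq> f (t - 1))) = moves (f 0) (map f [1..<Suc T])"
proof (induction T)
  case (Suc T)
  have "last (f 0 # map f [1..<Suc T]) = f T" by (cases T) auto
  then show ?case using Suc by (simp add: moves_append del: last.simps upt_Suc add: upt_Suc_append)
qed simp

lemma wks_cost_moves:
  "2 * wks_cost I f = (\<Sum>i<length (servers I). of_rat (fst (servers I ! i)) *
     real (moves (f i 0) (map (f i) [1..<Suc (length (requests I))])))"
  unfolding wks_cost_def sum_moves[symmetric] by (simp add: of_nat_sum)

text \<open>Each heavy server moves once, to a point of \<open>S\<close>, and stays. A block repeats
  one set \<open>e\<close>; during it the j-th cheap server stands on the j-th point of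
  \<open>e\<close> outside \<open>S\<close>, so it moves at most once in each of the
  \<open>R * length H\<close> blocks. The factor 2 on the left removes the 1/2 in the cost.\<close>

lemma cheap_solution:
  fixes P n k R :: nat and H :: "nat list list"
  defines "I \<equiv> gap_instance P n k R H"
  assumes P: "P \<ge> 1" and H: "\<And>e. e \<in> set H \<Longrightarrow> set e \<subseteq> {1..P}"
    and S: "S \<subseteq> {1..P}" "card S \<le> n" "\<And>e. e \<in> set H \<Longrightarrow> card (set e - S) \<le> k"
  obtains f where "wks_solution I f" "2 * wks_cost I f \<le> real R * real n + real k * (real R * real (length H))"
proof -
  \<comment> \<open>Each request is paired with the set it comes from, because a cheap server
    chooses its position by the set and not by the requested point.\<close>
  define pairs where "pairs = concat (map (\<lambda>e. concat (replicate R (map (\<lambda>r. (r, e)) e))) (concat (replicate R H)))"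
  have req: "requests I = map fst pairs"
    by (simp add: I_def gap_instance_def gap_requests_def pairs_def map_concat o_def)
  have pairs: "snd x \<in> set H \<and> fst x \<in> set (snd x)" if "x \<in> set pairs" for x
    using that by (auto simp: pairs_def split: if_splits)
  define T where "T = length pairs"
  have finS: "finite S" using S(1) finite_subset by blast
  define hs where "hs = sorted_list_of_set S @ replicate (n - card S) 1"
  have hs: "length hs = n" "S \<subseteq> set hs" "set hs \<subseteq> {1..P}" using S finS P by (auto simp: hs_def)
  define us where "us e = sorted_list_of_set (set e - S)" for e
  define pick where "pick j e = (if j < length (us e) then us e ! j else 1)" for j e
  have us: "set (us e) = set e - S" "length (us e) \<le> k" if "e \<in> set H" for e
    using S(3)[OF that] by (auto simp: us_def)
  have pick: "pick j e \<in> {1..P}" if "e \<in> set H" for j e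
  proof (cases "j < length (us e)")
    case True
    then have "us e ! j \<in> set (us e)" by simp
    with True us(1)[OF that] H[OF that] show ?thesis by (auto simp: pick_def)
  qed (use P in \<open>simp add: pick_def\<close>)
  define pos where "pos i = (if i < n then replicate T (hs ! i) else map (\<lambda>x. pick (i - n) (snd x)) pairs)" for i
  have lpos: "length (pos i) = T" for i by (simp add: pos_def T_def)
  define f where "f i t = ((1::nat) # pos i) ! t" for i t
  have sv: "length (servers I) = n + k" "i < n + k \<Longrightarrow> snd (servers I ! i) = 1"
    "fst (servers I ! i) = (if i < n then of_nat R else 1)" if "i < n + k" for i
    using that by (auto simp: I_def gap_instance_def nth_append)
  have lsv: "length (servers I) = n + k" by (simp add: I_def gap_instance_def)
  have lreq: "length (requests I) = T" by (simp add: req T_def)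
  have "wks_solution I f"
    unfolding wks_solution_def lsv lreq
  proof (intro conjI allI impI ballI)
    fix i t assume "i < n + k" "t \<le> T"
    show "f i t \<in> {1..points I}"
    proof (cases t)
      case 0 with P show ?thesis by (simp add: f_def I_def gap_instance_def)
    next
      case (Suc t')
      then have t': "t' < T" using \<open>t \<le> T\<close> by simp
      then have "snd (pairs ! t') \<in> set H" using pairs[OF nth_mem] by (simp add: T_def)
      moreover have "i < n \<Longrightarrow> hs ! i \<in> {1..P}" using hs nth_mem by blast
      ultimately show ?thesis using Suc t' pick by (auto simp: f_def pos_def I_def gap_instance_def T_def)
    qed
  next
    fix i assume "i < n + k"
    then show "f i 0 = snd (servers I ! i)" using sv(2) by (simp add: f_def)
  next
    fix t assume t: "t \<in> {1..T}"
    define t' where "t' = t - 1"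
    have t': "t = Suc t'" "t' < T" using t by (auto simp: t'_def)
    obtain a e where ae: "pairs ! t' = (a, e)" by force
    have e: "e \<in> set H" "a \<in> set e" using pairs[OF nth_mem[of t' pairs]] t' ae by (auto simp: T_def)
    have r: "requests I ! (t - 1) = a" using t' ae by (simp add: req T_def)
    show "\<exists>i<n + k. f i t = requests I ! (t - 1)"
    proof (cases "a \<in> S")
      case True
      then obtain i where "i < n" "hs ! i = a" using hs by (metis in_set_conv_nth subsetD)
      with t' r show ?thesis by (intro exI[of _ i]) (simp add: f_def pos_def)
    next
      case False
      then obtain j where j: "j < length (us e)" "us e ! j = a" using us(1)[OF e(1)] e(2) by (metis DiffI in_set_conv_nth)
      with us(2)[OF e(1)] t' r ae show ?thesis
        by (intro exI[of _ "n + j"]) (simp add: f_def pos_def pick_def T_def)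
    qed
  qed
  moreover have "2 * wks_cost I f \<le> real R * real n + real k * (real R * real (length H))"
  proof -
    have mv: "map (f i) [1..<Suc (length (requests I))] = pos i" for i
      by (rule nth_equalityI) (auto simp: lpos lreq f_def simp del: upt_Suc)
    have cheap: "moves 1 (pos i) \<le> R * length H" if "\<not> i < n" for i
    proof -
      have "pos i = concat (map (\<lambda>e. concat (replicate R (map (\<lambda>_. pick (i - n) e) e))) (concat (replicate R H)))"
        using that by (simp add: pos_def pairs_def map_concat o_def)
      also have "moves 1 \<dots> \<le> length (concat (replicate R H))"
        by (rule moves_blocks[where G = "pick (i - n)"]) (auto split: if_splits)
      also have "\<dots> = R * length H" by (induction R) auto
      finally show ?thesis .
    qed
    have heavy: "moves 1 (pos i) \<le> 1" if "i < n" for i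
      using that by (intro moves_same[where x = "hs ! i"]) (simp add: pos_def)
    have "2 * wks_cost I f = (\<Sum>i<n + k. (if i < n then real R else 1) * real (moves 1 (pos i)))"
      unfolding wks_cost_moves mv lsv by (rule sum.cong) (use sv in \<open>auto simp: f_def\<close>)
    also have "\<dots> = (\<Sum>i<n. real R * real (moves 1 (pos i))) + (\<Sum>i=n..<n + k. real (moves 1 (pos i)))"
    proof -
      let ?F = "\<lambda>i. (if i < n then real R else 1) * real (moves 1 (pos i))"
      have "(\<Sum>i<n. ?F i) = (\<Sum>i<n. real R * real (moves 1 (pos i)))" by (rule sum.cong) auto
      moreover have "(\<Sum>i=n..<n + k. ?F i) = (\<Sum>i=n..<n + k. real (moves 1 (pos i)))" by (rule sum.cong) auto
      moreover have "(\<Sum>i<n + k. ?F i) = (\<Sum>i<n. ?F i) + (\<Sum>i=n..<n + k. ?F i)"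
        using sum.atLeastLessThan_concat[of 0 n "n + k" ?F] by (simp add: atLeast0LessThan)
      ultimately show ?thesis by simp
    qed
    also have "\<dots> \<le> (\<Sum>i<n. real R * 1) + (\<Sum>i=n..<n + k. real (R * length H))"
    proof (intro add_mono sum_mono mult_left_mono)
      show "real (moves 1 (pos i)) \<le> 1" if "i \<in> {..<n}" for i using heavy that by simp
      show "real (moves 1 (pos i)) \<le> real (R * length H)" if "i \<in> {n..<n + k}" for i
        using cheap[of i] that unfolding of_nat_le_iff by simp
    qed auto
    finally show ?thesis by (simp add: mult.commute)
  qed
  ultimately show thesis using that by blast
qed

fun config_dist :: "nat list \<Rightarrow> 'a list \<Rightarrow> 'a list \<Rightarrow> nat" where
  "config_dist (w # ws) (x # xs) (y # ys) = w * of_bool (x \<noteq> y) + config_dist ws xs ys"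
| "config_dist _ _ _ = 0"

text \<open>Sequences of whole configurations can be cut into consecutive blocks at any time, which
  the pigeonhole argument over repetitions needs; \<open>moves\<close> follows a single
  server.\<close>

fun path_cost :: "nat list \<Rightarrow> 'a list \<Rightarrow> 'a list list \<Rightarrow> nat" where
  "path_cost ws c [] = 0"
| "path_cost ws c (d # cs) = config_dist ws c d + path_cost ws d cs"

lemma path_cost_append: "path_cost ws c (cs @ ds) = path_cost ws c cs + path_cost ws (last (c # cs)) ds"
  by (induction cs arbitrary: c) auto

lemma config_dist_ge:
  "length xs = length ws \<Longrightarrow> length ys = length ws \<Longrightarrow> i < length ws \<Longrightarrow> xs ! i \<noteq> ys ! i \<Longrightarrow>
     ws ! i \<le> config_dist ws xs ys"
proof (induction ws xs ys arbitrary: i rule: config_dist.induct)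
  case (1 w ws x xs y ys)
  then show ?case by (cases i) (auto intro: trans_le_add2)
qed auto

lemma path_cost_static:
  assumes "length c = length ws" "\<forall>d\<in>set cs. length d = length ws" "i < length ws" "path_cost ws c cs < ws ! i"
  shows "\<forall>d\<in>set cs. d ! i = c ! i"
  using assms
proof (induction cs arbitrary: c)
  case (Cons d cs)
  have "c ! i = d ! i"
    using config_dist_ge[of c ws d i] Cons.prems by force
  moreover have "\<forall>x\<in>set cs. x ! i = d ! i" by (rule Cons.IH) (use Cons.prems in auto)
  ultimately show ?case by simp
qed simp

text \<open>Pigeonhole over the \<open>m\<close> repetitions of \<open>X\<close>. With
  \<open>B = R\<close> it yields a phase without heavy moves, and with \<open>B = 1\<close> a
  repetition without any move.\<close>

lemma cheap_block:
  "list_all2 Q cs (concat (replicate m X)) \<Longrightarrow> path_cost ws c cs < m * B \<Longrightarrow>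
     \<exists>pre bl post. cs = pre @ bl @ post \<and> list_all2 Q bl X \<and> path_cost ws (last (c # pre)) bl < B"
proof (induction m arbitrary: c cs)
  case (Suc m)
  then obtain us vs where uv: "cs = us @ vs" "list_all2 Q us X" "list_all2 Q vs (concat (replicate m X))"
    by (auto simp: list_all2_append2)
  show ?case
  proof (cases "path_cost ws c us < B")
    case True
    with uv show ?thesis by (intro exI[of _ "[]"] exI[of _ us] exI[of _ vs]) simp
  next
    case False
    then have "path_cost ws (last (c # us)) vs < m * B"
      using Suc.prems(2) uv(1) by (simp add: path_cost_append del: last.simps)
    from Suc.IH[OF uv(3) this] obtain pre bl post where
      b: "vs = pre @ bl @ post" "list_all2 Q bl X" "path_cost ws (last (last (c # us) # pre)) bl < B" by blast
    have "last (last (c # us) # pre) = last (c # us @ pre)" by (cases pre) auto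
    with b uv(1) show ?thesis by (intro exI[of _ "us @ pre"] exI[of _ bl] exI[of _ post]) simp
  qed
qed simp

lemma static_cover:
  fixes ws :: "nat list" and c :: "'a list"
  assumes ws: "set ws \<subseteq> {R, 1}" "R \<ge> 1"
    and len: "length c = length ws" "\<forall>d\<in>set cs. length d = length ws"
    and serve: "list_all2 (\<lambda>d a. a \<in> set d) cs (gap_requests R H)"
    and cost: "path_cost ws c cs < R * R"
  obtains S where "S \<subseteq> \<Union>(set ` insert c (set cs))" "card S \<le> count_list ws R"
    "\<And>e. e \<in> set H \<Longrightarrow> card (set e - S) \<le> length (filter (\<lambda>w. w \<noteq> R) ws)"
proof -
  let ?F = "\<lambda>e. concat (replicate R e)"
  have "concat (map ?F (concat (replicate m H))) = concat (replicate m (concat (map ?F H)))" for m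
    by (induction m) auto
  then have gr: "gap_requests R H = concat (replicate R (concat (map ?F H)))" by (simp add: gap_requests_def)
  from cheap_block[OF serve[unfolded gr] cost] obtain pre ph post where ph: "cs = pre @ ph @ post"
    "list_all2 (\<lambda>d a. a \<in> set d) ph (concat (map ?F H))" "path_cost ws (last (c # pre)) ph < R"
    by blast
  \<comment> \<open>Where the servers stand when the cheap phase begins. The phase costs less than
    \<open>R\<close>, so the heavy ones remain there; their positions form \<open>S\<close> for all
    sets at once.\<close>
  define c1 where "c1 = last (c # pre)"
  have c1: "c1 \<in> insert c (set cs)" using ph(1) by (auto simp: c1_def)
  have lc1: "length c1 = length ws" using c1 len by auto
  define S where "S = {c1 ! i | i. i < length ws \<and> ws ! i = R}"
  show thesis
  proof (rule that)
    show "S \<subseteq> \<Union>(set ` insert c (set cs))" using c1 lc1 by (force simp: S_def)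
    have "S = (\<lambda>i. c1 ! i) ` {i. i < length ws \<and> ws ! i = R}" by (auto simp: S_def)
    then have "card S \<le> card {i. i < length ws \<and> ws ! i = R}" by (simp add: card_image_le)
    also have "\<dots> = count_list ws R" by (simp add: count_list_eq_length_filter length_filter_conv_card eq_commute)
    finally show "card S \<le> count_list ws R" .
    fix e assume "e \<in> set H"
    then obtain H1 H2 where H: "H = H1 @ e # H2" by (auto dest: split_list)
    with ph(2) obtain a b d where abd: "ph = a @ b @ d" "list_all2 (\<lambda>d a. a \<in> set d) b (?F e)"
      by (auto simp: list_all2_append2)
    have "path_cost ws c1 a + path_cost ws (last (c1 # a)) b < R"
      using ph(3) unfolding c1_def[symmetric] abd(1) by (simp add: path_cost_append del: last.simps)
    then have cb: "path_cost ws c1 a + path_cost ws (last (c1 # a)) b < R" "path_cost ws (last (c1 # a)) b < R * 1" by auto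
    from cheap_block[OF abd(2) cb(2)] obtain b0 b1 b2 where b: "b = b0 @ b1 @ b2"
      "list_all2 (\<lambda>d a. a \<in> set d) b1 e" "path_cost ws (last (last (c1 # a) # b0)) b1 < 1" by blast
    define c2 where "c2 = last (last (c1 # a) # b0)"
    have c2': "c2 = last (c1 # a @ b0)" by (cases b0) (auto simp: c2_def)
    have sub: "set (a @ b0) \<subseteq> set cs" "set b1 \<subseteq> set cs" using ph(1) abd(1) b(1) by auto
    have lc2: "length c2 = length ws" using c2' sub lc1 len(2) by (cases "a @ b0" rule: rev_cases) auto
    have "path_cost ws c1 (a @ b0) < R"
      using cb(1) unfolding b(1) by (simp add: path_cost_append del: last.simps)
    then have heavy: "c2 ! i = c1 ! i" if "i < length ws" "ws ! i = R" for i
      using path_cost_static[of c1 ws "a @ b0" i] lc1 len(2) sub(1) that unfolding c2'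
      by (cases "a @ b0" rule: rev_cases) auto
    have static: "d = c2" if "d \<in> set b1" for d
    proof (rule nth_equalityI)
      show "length d = length c2" using that sub(2) len(2) lc2 by auto
      fix i assume "i < length d"
      then have i: "i < length ws" using that sub(2) len(2) by auto
      have "ws ! i \<ge> 1" using subsetD[OF ws(1) nth_mem[OF i]] ws(2) by auto
      then have "path_cost ws c2 b1 < ws ! i" using b(3) unfolding c2_def by linarith
      from path_cost_static[OF lc2 _ i this] that sub(2) len(2) show "d ! i = c2 ! i" by blast
    qed
    \<comment> \<open>During \<open>b1\<close> every point of \<open>e\<close> is requested and
      nobody moves, so the single configuration \<open>c2\<close> contains all of
      \<open>e\<close>.\<close>
    have "set e \<subseteq> set c2"
    proof
      fix x assume "x \<in> set e"
      then obtain j where j: "j < length e" "e ! j = x" by (auto simp: in_set_conv_nth)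
      then have "x \<in> set (b1 ! j)" "b1 ! j \<in> set b1" using b(2) by (auto simp: list_all2_conv_all_nth)
      with static show "x \<in> set c2" by auto
    qed
    have "set e - S \<subseteq> (\<lambda>i. c2 ! i) ` {i. i < length ws \<and> ws ! i \<noteq> R}"
    proof
      fix x assume x: "x \<in> set e - S"
      with \<open>set e \<subseteq> set c2\<close> have "x \<in> set c2" by blast
      then obtain i where i: "i < length ws" "c2 ! i = x"
        unfolding in_set_conv_nth lc2 by blast
      have "ws ! i \<noteq> R" using heavy[OF i(1)] i x by (auto simp: S_def)
      with i show "x \<in> (\<lambda>i. c2 ! i) ` {i. i < length ws \<and> ws ! i \<noteq> R}" by blast
    qed
    then have "card (set e - S) \<le> card {i. i < length ws \<and> ws ! i \<noteq> R}"
      by (intro order_trans[OF card_mono card_image_le]) auto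
    then show "card (set e - S) \<le> length (filter (\<lambda>w. w \<noteq> R) ws)"
      by (simp add: length_filter_conv_card)
  qed
qed

section \<open>Computing the reduction: codes of games, numbers and instances\<close>

section \<open>Parsing and printing in polynomial time\<close>

type_synonym 'a parser = "bool list \<Rightarrow> 'a \<times> bool list"

definition parses :: "'a parser \<Rightarrow> ('a \<Rightarrow> bool list) \<Rightarrow> bool" where
  "parses p e \<longleftrightarrow> (\<forall>a r. p (e a @ r) = (a, r))"

text \<open>The length condition keeps the state of the list parser small on malformed input, too.\<close>

definition parser :: "'a::rep parser \<Rightarrow> bool" where
  "parser p \<longleftrightarrow> PT p \<and> (\<forall>s. length (snd (p s)) \<le> length s)"

definition parse_bit :: "bool parser" where
  "parse_bit s = (case s of [] \<Rightarrow> (False, []) | b # r \<Rightarrow> (b, r))"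

definition parse_pair :: "'a parser \<Rightarrow> 'b parser \<Rightarrow> ('a \<times> 'b) parser" where
  "parse_pair p q s = ((fst (p s), fst (q (snd (p s)))), snd (q (snd (p s))))"

definition list_step :: "'a parser \<Rightarrow> 'a list \<times> bool list \<times> bool \<Rightarrow> 'a list \<times> bool list \<times> bool" where
  "list_step p t = (if snd (snd t) then t else
     case fst (snd t) of [] \<Rightarrow> (fst t, [], True)
     | b # r \<Rightarrow> if b then (fst (p r) # fst t, snd (p r), False) else (fst t, r, True))"

text \<open>The input is its own clock: every list entry and the end marker use up at least one bit,
  so one step per bit suffices. The flag records that the end marker has been read.\<close>

definition parse_list :: "'a parser \<Rightarrow> 'a list parser" where
  "parse_list p s = (let t = foldl (\<lambda>t _. list_step p t) ([], s, False) s in (rev (fst t), fst (snd t)))"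

lemma parses_bit: "parses parse_bit (\<lambda>b. [b])"
  by (simp add: parses_def parse_bit_def)

lemma parses_pair: "parses p e \<Longrightarrow> parses q d \<Longrightarrow> parses (parse_pair p q) (\<lambda>x. e (fst x) @ d (snd x))"
  by (auto simp: parses_def parse_pair_def)

lemma parses_list:
  assumes "parses p e"
  shows "parses (parse_list p) (enc_list e)"
proof -
  have stop: "foldl (\<lambda>t _. list_step p t) (as, s, True) xs = (as, s, True)" for as s and xs :: "bool list"
    by (induction xs) (auto simp: list_step_def)
  have F: "length cs > length as \<Longrightarrow> foldl (\<lambda>t _. list_step p t) (bs, enc_list e as @ r, False) cs = (rev as @ bs, r, True)"
    for as bs r and cs :: "bool list"
  proof (induction as arbitrary: bs cs)
    case Nil
    have "list_step p (bs, False # r, False) = (bs, r, True)" by (simp add: list_step_def)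
    with Nil show ?case by (cases cs) (auto simp: enc_list_def stop)
  next
    case (Cons a as)
    then obtain c cs' where cs: "cs = c # cs'" by (cases cs) auto
    have "list_step p (bs, enc_list e (a # as) @ r, False) = (a # bs, enc_list e as @ r, False)"
      using assms by (simp add: list_step_def enc_list_def parses_def)
    with Cons cs show ?case by simp
  qed
  have "length as < length (enc_list e as @ r)" for as r
    by (induction as) (auto simp: enc_list_def)
  from F[OF this] show ?thesis by (simp add: parses_def parse_list_def Let_def del: foldl_append)
qed

lemma parser_bit: "parser parse_bit"
  unfolding parser_def
proof
  show "PT parse_bit" unfolding parse_bit_def by (intro PT_intros)
  show "\<forall>s. length (snd (parse_bit s)) \<le> length s" by (simp add: parse_bit_def split: list.split)
qed

lemma parser_pair:
  assumes "parser p" "parser q"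
  shows "parser (parse_pair p q)"
proof -
  have p: "PT p" and q: "PT q" using assms by (auto simp: parser_def)
  have "PT (\<lambda>s. q (snd (p s)))" by (rule PT_comp[OF PT_snd[OF p] q])
  then have "PT (parse_pair p q)" unfolding parse_pair_def by (intro PT_pair PT_fst PT_snd p)
  with assms show ?thesis by (fastforce simp: parser_def parse_pair_def intro: order_trans)
qed

lemma sz_bits: "sz (bs :: bool list) \<le> 4 * length bs + 1"
proof (induction bs)
  case (Cons b bs) then show ?case by (cases b) auto
qed simp

lemma PT_list_step:
  assumes "PT p"
  shows "PT (list_step p)"
proof -
  have "PT (\<lambda>x. p (snd (fst x)))" by (rule PT_comp[OF _ assms]) (intro PT_intros)
  then show ?thesis unfolding list_step_def by (intro PT_intros)
qed

lemma parser_list: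
  assumes "parser p"
  shows "parser (parse_list p)"
  unfolding parser_def
proof
  have p: "PT p" and len: "\<And>s. length (snd (p s)) \<le> length s" using assms by (auto simp: parser_def)
  obtain P :: "nat poly" where P: "\<And>s. sz (p s) \<le> poly P (sz s)"
    using polybound_PT[OF p] unfolding polybound_def by blast
  let ?D = "\<lambda>s :: bool list. 10 + 4 * sz s + poly P (4 * sz s + 1)"
  have PD: "polybound ?D"
  proof -
    have "polybound (\<lambda>s :: bool list. poly P (4 * sz s + 1))"
      unfolding polybound_def
      by (rule exI[of _ "pcompose P [:1, 4:]"]) (simp add: poly_pcompose mult.commute add.commute)
    then show ?thesis by (intro polybound_add polybound_mult polybound_const polybound_sz)
  qed
  have "PT (\<lambda>s. foldl (\<lambda>t _. list_step p t) ([], s, False) s)"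
  proof (rule PT_fold_incr[where D = ?D and I = "\<lambda>s t. length (fst (snd t)) \<le> length s"])
    show "PT (\<lambda>x. list_step p (fst (snd x)))" by (rule PT_comp[OF _ PT_list_step[OF p]]) (intro PT_intros)
    show "length (fst (snd (list_step p t))) \<le> length s" if "length (fst (snd t)) \<le> length s" for s t
      using that len[of "tl (fst (snd t))"] by (auto simp: list_step_def split: list.splits)
    show "sz (list_step p t) \<le> sz t + ?D s" if l: "length (fst (snd t)) \<le> length s" for s t
    proof -
      obtain as r d where t: "t = (as, r, d)" by (cases t) auto
      have b: "sz d \<ge> 1" by (cases d) auto
      show ?thesis
      proof (cases "d \<or> r = [] \<or> \<not> hd r")
        case True
        then show ?thesis using t b by (cases r) (auto simp: list_step_def split: if_splits)
      next
        case False
        then obtain r' where r: "r = True # r'" "\<not> d" by (cases r) auto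
        have "sz r' \<le> 4 * sz s + 1"
          using l t r sz_bits[of r'] length_le_sz[of s] by simp
        then have "sz (p r') \<le> poly P (4 * sz s + 1)"
          using P[of r'] poly_nat_mono[of "sz r'" "4 * sz s + 1" P] by linarith
        then have "sz (fst (p r')) + sz (snd (p r')) \<le> poly P (4 * sz s + 1)"
          by (cases "p r'") simp
        then show ?thesis using t r b by (simp add: list_step_def)
      qed
    qed
    show "PT (\<lambda>s. ([], s, False))" "PT (\<lambda>s :: bool list. s)" by (intro PT_intros)+
    show "polybound ?D" by (rule PD)
  qed auto
  then show "PT (parse_list p)" unfolding parse_list_def Let_def by (intro PT_intros)
  have inv: "length (fst (snd t)) \<le> length s \<Longrightarrow> length (fst (snd (foldl (\<lambda>t _. list_step p t) t cs))) \<le> length s"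
    for s t and cs :: "bool list"
  proof (induction cs arbitrary: t)
    case (Cons c cs)
    have "length (fst (snd (list_step p t))) \<le> length s"
      using Cons.prems len[of "tl (fst (snd t))"] by (auto simp: list_step_def split: list.splits)
    from Cons.IH[OF this] show ?case by simp
  qed simp
  show "\<forall>s. length (snd (parse_list p s)) \<le> length s"
    using inv[of "([], s, False)" s s for s] by (auto simp: parse_list_def Let_def)
qed

lemma PT_enc_list:
  assumes "PT (\<lambda>x. e (fst x) (snd x))" "PT l"
  shows "PT (\<lambda>x. enc_list (e x) (l x))"
proof -
  have "PT (\<lambda>x. concat (map (\<lambda>a. True # e x a) (l x)) @ [False])"
    by (intro PT_append PT_concat PT_map PT_Cons assms PT_const)
  then show ?thesis by (simp add: enc_list_def)
qed

definition enc_bits :: "bool list \<Rightarrow> bool list" where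
  "enc_bits = enc_list (\<lambda>b. [b])"

lemma PT_enc_bits [PT_intros]: "PT l \<Longrightarrow> PT (\<lambda>x. enc_bits (l x))"
  unfolding enc_bits_def by (intro PT_enc_list PT_intros)

lemma enc_nat_bits: "enc_nat n = enc_bits (bits n)"
  by (simp add: enc_nat_def enc_bits_def enc_list_def)

lemma str_pair_enc: "str_pair x y = enc_bits x @ y"
  by (simp add: str_pair_def enc_bits_def enc_list_def)

definition parse_bits :: "bool list parser" where
  "parse_bits = parse_list parse_bit"

lemma parses_bits: "parses parse_bits enc_bits"
  unfolding parse_bits_def enc_bits_def by (intro parses_list parses_bit)

lemma parser_bits: "parser parse_bits"
  unfolding parse_bits_def by (intro parser_list parser_bit)

lemma parse_bits_pair [simp]: "parse_bits (str_pair x y) = (x, y)"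
  using parses_bits by (simp add: parses_def str_pair_enc)

section \<open>Binary numbers\<close>

primrec num :: "bool list \<Rightarrow> nat" where
  "num [] = 0"
| "num (b # s) = of_bool b + 2 * num s"

lemma num_bits [simp]: "num (bits n) = n"
proof (induction n rule: bits.induct)
  case (1 n)
  show ?case
  proof (cases "n = 0")
    case False
    then have "num (bits n) = of_bool (odd n) + 2 * (n div 2)" using 1 by (subst bits.simps) simp
    then show ?thesis by (simp add: of_bool_odd_eq_mod_2)
  qed (simp add: bits.simps)
qed

lemma bits_inject [simp]: "bits m = bits n \<longleftrightarrow> m = n"
  using num_bits by metis

lemma num_pos: "s \<noteq> [] \<Longrightarrow> last s \<Longrightarrow> num s > 0"
  by (induction s) (auto split: if_splits)

lemma bits_num: "s = [] \<or> last s \<Longrightarrow> bits (num s) = s"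
proof (induction s)
  case (Cons b s)
  have "num (b # s) > 0" by (rule num_pos) (use Cons.prems in auto)
  moreover have "bits (num s) = s" using Cons by (cases s) auto
  ultimately show ?case by (subst bits.simps) (auto simp: bits.simps)
qed (simp add: bits.simps)

lemma num_less: "num s < 2 ^ length s"
  by (induction s) auto

lemma num_ones: "num (replicate n True) + 1 = 2 ^ n"
  by (induction n) auto

lemma length_bits_le: "length (bits n) \<le> n"
proof (induction n rule: bits.induct)
  case (1 n)
  show ?case
  proof (cases "n = 0")
    case False
    then have "length (bits n) = Suc (length (bits (n div 2)))" by (subst bits.simps) simp
    also have "\<dots> \<le> Suc (n div 2)" using 1 False by simp
    also have "\<dots> \<le> n" using False by presburger
    finally show ?thesis .
  qed (simp add: bits.simps)
qed

text \<open>Binary increment; the first component of the state is the carry.\<close>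

definition bits_Suc :: "bool list \<Rightarrow> bool list" where
  "bits_Suc b = (let t = foldl (\<lambda>t x. (fst t \<and> x, (fst t \<noteq> x) # snd t)) (True, []) b
     in rev (if fst t then True # snd t else snd t))"

lemma bits_Suc: "bits_Suc (bits n) = bits (Suc n)"
proof -
  define h where "h = (\<lambda>(t :: bool \<times> bool list) x. (fst t \<and> x, (fst t \<noteq> x) # snd t))"
  have h: "h (True, s) True = (True, False # s)" "h (True, s) False = (False, True # s)"
    "h (False, s) x = (False, x # s)" for s x by (auto simp: h_def)
  have nc: "foldl h (False, s) b = (False, rev b @ s)" for s b by (induction b arbitrary: s) (auto simp: h)
  have *: "rev (if fst (foldl h (True, s) b) then True # snd (foldl h (True, s) b) else snd (foldl h (True, s) b))
      = rev s @ bits (Suc (num b))" if "b = [] \<or> last b" for b s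
    using that
  proof (induction b arbitrary: s)
    case Nil
    show ?case by (simp add: bits.simps)
  next
    case (Cons x b)
    have b: "b = [] \<or> last b" using Cons.prems by (auto split: if_splits)
    show ?case
    proof (cases x)
      case True
      have "bits (Suc (num (x # b))) = False # bits (Suc (num b))" using True by (subst bits.simps) simp
      with Cons.IH[OF b, of "False # s"] True show ?thesis by (auto simp: h split: if_splits)
    next
      case False
      have "bits (Suc (num (x # b))) = True # bits (num b)" using False by (subst bits.simps) simp
      with False show ?thesis by (simp add: h nc bits_num[OF b])
    qed
  qed
  have "bits n = [] \<or> last (bits n)"
  proof (induction n rule: bits.induct)
    case (1 n)
    then show ?case
      by (cases "n = 0"; cases "n div 2 = 0") (subst (1 2) bits.simps; auto simp: bits.simps)+
  qed
  from *[OF this, of "[]"] show ?thesis unfolding bits_Suc_def Let_def h_def[symmetric] by simp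
qed

definition bits_length :: "'a list \<Rightarrow> bool list" where
  "bits_length xs = foldl (\<lambda>b _. bits_Suc b) [] xs"

lemma bits_length: "bits_length xs = bits (length xs)"
proof -
  have "foldl (\<lambda>b _. bits_Suc b) (bits n) xs = bits (n + length xs)" for n
    by (induction xs arbitrary: n) (auto simp: bits_Suc)
  from this[of 0] show ?thesis by (simp add: bits_length_def bits.simps)
qed

lemma PT_bits_Suc: "PT bits_Suc"
proof -
  let ?h = "\<lambda>t x. (fst t \<and> x, (fst t \<noteq> x) # snd t)"
  have "PT (\<lambda>b. foldl ?h (True, []) b)"
  proof (rule PT_fold_incr[where D = "\<lambda>_. 10" and I = "\<lambda>_ _. True"])
    show "PT (\<lambda>p. ?h (fst (snd p)) (snd (snd p)))" by (intro PT_intros)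
    show "sz (?h t x) \<le> sz t + 10" for t x
    proof (cases t)
      case (Pair c s)
      then show ?thesis using sz_bool(1)[of "c \<and> x"] sz_bool(1)[of "c \<noteq> x"] by auto
    qed
  qed (auto intro: PT_intros)
  then show ?thesis unfolding bits_Suc_def Let_def by (intro PT_intros)
qed

lemma PT_bits_length [PT_intros]:
  assumes "PT l"
  shows "PT (\<lambda>x. bits_length (l x))"
proof -
  have "PT (\<lambda>x. foldl (\<lambda>b _. bits_Suc b) [] (l x))"
  proof (rule PT_fold[where A = "\<lambda>x. 4 * sz (l x) + 1"])
    show "PT (\<lambda>p. bits_Suc (fst (snd p)))" by (rule PT_comp[OF _ PT_bits_Suc]) (intro PT_intros)
    show "polybound (\<lambda>x. 4 * sz (l x) + 1)"
      by (intro polybound_add polybound_mult polybound_const polybound_PT assms)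
    show "sz (foldl (\<lambda>b _. bits_Suc b) [] (take n (l x))) \<le> 4 * sz (l x) + 1" if "n \<le> length (l x)" for x n
    proof -
      have "foldl (\<lambda>b _. bits_Suc b) [] (take n (l x)) = bits n"
        using bits_length[of "take n (l x)"] that by (simp add: bits_length_def)
      then show ?thesis using sz_bits[of "bits n"] length_bits_le[of n] length_le_sz[of "l x"] that by simp
    qed
  qed (intro PT_intros assms)+
  then show ?thesis by (simp add: bits_length_def)
qed

section \<open>The reduction\<close>

lemma PT_tuples [PT_intros]:
  assumes "PT l"
  shows "PT (\<lambda>x. tuples k (l x))"
proof (induction k)
  case (Suc k)
  have "PT (\<lambda>p. tuples k (l (fst p)))" by (rule PT_comp[OF _ Suc]) (intro PT_intros)
  then show ?case unfolding tuples.simps by (intro PT_intros assms)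
qed (simp add: PT_const)

lemma PT_samples: "PT (samples (fst :: 'a::rep \<times> 'b::rep \<Rightarrow> 'a) L)"
  unfolding samples_def padded_star_def star_def by (intro PT_intros)

text \<open>Indices in unary, so that counting up is a single cons; their total length is only
  quadratic.\<close>

definition unary_index :: "'a list \<Rightarrow> bool list list" where
  "unary_index xs = rev (fst (foldl (\<lambda>t _. (snd t # fst t, False # snd t)) ([], []) xs))"

lemma unary_index_foldl:
  "foldl (\<lambda>t _. (snd t # fst t, False # snd t)) (s, replicate n False) xs =
     (rev (map (\<lambda>i. replicate i False) [n..<n + length xs]) @ s, replicate (n + length xs) False)"
proof (induction xs arbitrary: s n)
  case (Cons x xs)
  have "False # replicate n False = replicate (Suc n) False" by simp
  then show ?case using Cons.IH[of "replicate n False # s" "Suc n"]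
    by (simp add: upt_conv_Cons del: replicate_Suc upt_Suc)
qed simp

lemma unary_index: "unary_index xs = map (\<lambda>i. replicate i False) [0..<length xs]"
  using unary_index_foldl[of "[]" 0 xs] by (simp add: unary_index_def)

lemma PT_unary_index [PT_intros]:
  assumes "PT l"
  shows "PT (\<lambda>x. unary_index (l x))"
proof -
  let ?h = "\<lambda>t _. (snd t # fst t, False # snd t)"
  have "PT (\<lambda>x. foldl ?h ([], []) (l x))"
  proof (rule PT_fold[where A = "\<lambda>x. 5 + (sz (l x) * (2 + 2 * sz (l x)) + 2 * sz (l x))"])
    show "PT (\<lambda>p. ?h (fst (snd p)) (snd (snd p)))" by (intro PT_intros)
    show "polybound (\<lambda>x. 5 + (sz (l x) * (2 + 2 * sz (l x)) + 2 * sz (l x)))"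
      by (intro polybound_add polybound_mult polybound_const polybound_PT assms)
    show "sz (foldl ?h ([], []) (take n (l x))) \<le> 5 + (sz (l x) * (2 + 2 * sz (l x)) + 2 * sz (l x))"
      if n: "n \<le> length (l x)" for x n
    proof -
      have F: "sz (replicate i False) = 2 * i + 1" for i by (induction i) auto
      have "sz (map (\<lambda>i. replicate i False) [0..<m]) \<le> 1 + m * (2 + 2 * m)" for m
      proof (induction m)
        case (Suc m)
        have "sz (map (\<lambda>i. replicate i False) [0..<Suc m]) + 1
            = sz (map (\<lambda>i. replicate i False) [0..<m]) + sz [replicate m False]"
          using sz_append[of "map (\<lambda>i. replicate i False) [0..<m]" "[replicate m False]"] by simp
        then show ?case using Suc by (simp add: F)
      qed simp
      then have "sz (map (\<lambda>i. replicate i False) [0..<n]) \<le> 1 + n * (2 + 2 * n)" .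
      moreover have "n \<le> sz (l x)" using n length_le_sz[of "l x"] by simp
      then have "n * (2 + 2 * n) \<le> sz (l x) * (2 + 2 * sz (l x))" by (intro mult_le_mono) auto
      ultimately show ?thesis
        using unary_index_foldl[of "[]" 0 "take n (l x)"] n \<open>n \<le> sz (l x)\<close> by (simp add: F)
    qed
  qed (intro PT_intros assms)+
  then show ?thesis unfolding unary_index_def by (intro PT_intros)
qed

type_synonym edge = "bool list \<times> bool list \<times> bool list list"
type_synonym spot = "bool list \<times> bool list \<times> bool list list \<times> bool list"

definition perm_codes :: "nat \<Rightarrow> bool list list set" where
  "perm_codes q = {\<pi>. set \<pi> \<subseteq> bits ` {..<q} \<and> length \<pi> = q}"

text \<open>The hit condition of \<open>balanced\<close>, read off data of constant size:
  \<open>h\<close> permutations and strings. Its relevant domain is finite, so it can be replaced by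
  the table \<open>check\<close>.\<close>

definition tight :: "nat \<Rightarrow> nat \<Rightarrow> (bool list list \<times> bool list) list \<Rightarrow> bool" where
  "tight q k t \<longleftrightarrow> (\<forall>b<q. length (filter (\<lambda>x. \<exists>a<q. fst x ! a = bits b \<and> snd x ! a) t) \<le> k)"

lemma finite_tight_domain: "finite {t. set t \<subseteq> perm_codes q \<times> cube Q \<and> length t = h}"
  unfolding perm_codes_def by (intro finite_lists_length_eq finite_cartesian_product) auto

text \<open>Point \<open>(i, y)\<close> is numbered in binary by \<open>y\<close>, then \<open>i\<close> in unary and a leading one.\<close>

definition pos_bits :: "spot \<Rightarrow> bool list" where
  "pos_bits s = snd (snd (snd s)) @ fst (snd s) @ [True]"

text \<open>All parameters are constants of the reduction: \<open>L\<close> edges per sample,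
  \<open>Q\<close> bits per string, \<open>h\<close> points per set, \<open>k\<close> cheap servers,
  \<open>K\<close> heavy servers per sample, and \<open>D\<close> and \<open>c0\<close> for the size
  of the weight \<open>R\<close>.\<close>

locale reduction =
  fixes q L Q h k K D c0 :: nat and check :: "(bool list list \<times> bool list) list \<Rightarrow> bool"
  assumes PT_check: "PT check"
    and check: "\<And>t. set t \<subseteq> perm_codes q \<times> cube Q \<Longrightarrow> length t = h \<Longrightarrow> check t = tight q k t"
begin

abbreviation Ws :: "edge list \<Rightarrow> edge list list" where
  "Ws E \<equiv> samples fst L E"

definition spot_list :: "edge list \<Rightarrow> spot list" where
  "spot_list E = concat (map (\<lambda>x. concat (map (\<lambda>e. map (\<lambda>y. (fst (snd e), snd x, snd (snd e), y))
     (tuples Q [False, True])) (fst x))) (zip (Ws E) (unary_index (Ws E))))"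

text \<open>Since \<open>h\<close> is a constant, all \<open>h\<close>-tuples of spots at one right
  vertex can be listed in polynomial time. The list may repeat a set, which is harmless.\<close>

definition hyperedges :: "edge list \<Rightarrow> spot list list" where
  "hyperedges E = concat (map (\<lambda>s. filter (\<lambda>t. check (map (\<lambda>s. snd (snd s)) t))
     (tuples h (filter (\<lambda>s'. fst s' = fst s) (spot_list E)))) (spot_list E))"

text \<open>The weight \<open>R\<close> in unary. It is the power \<open>D\<close> of a number that
  exceeds the number of samples, the number of sets and, through \<open>c0\<close>, all
  constants.\<close>

definition ticks :: "edge list \<Rightarrow> bool list" where
  "ticks E = power_list D (map (\<lambda>_. True) (Ws E) @ map (\<lambda>_. True) (hyperedges E) @ replicate c0 True)"

definition request_bits :: "edge list \<Rightarrow> bool list list" where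
  "request_bits E = concat (map (\<lambda>e. concat (map (\<lambda>_. e) (ticks E)))
     (concat (map (\<lambda>_. map (map pos_bits) (hyperedges E)) (ticks E))))"

definition server_bits :: "edge list \<Rightarrow> ((bool list \<times> bool list) \<times> bool list) list" where
  "server_bits E = concat (map (\<lambda>_. map (\<lambda>_. ((bits_length (ticks E), [True]), [True])) (replicate K True)) (Ws E))
     @ replicate k (([True], [True]), [True])"

text \<open>The number of points is exponential but enters the input in binary. It only has to leave
  room for every point code; most of these points are never requested.\<close>

definition point_bits :: "edge list \<Rightarrow> bool list" where
  "point_bits E = map (\<lambda>_. True) (Ws E) @ replicate (Q + 1) True"

definition print :: "edge list \<Rightarrow> bool list" where
  "print E = enc_bits (point_bits E)
     @ enc_list (\<lambda>s. (enc_bits (fst (fst s)) @ enc_bits (snd (fst s))) @ enc_bits (snd s)) (server_bits E)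
     @ enc_list enc_bits (request_bits E)"

definition instance_of :: "edge list \<Rightarrow> wks" where
  "instance_of E = gap_instance (num (point_bits E)) (K * length (Ws E)) k (length (ticks E))
     (map (map (num \<circ> pos_bits)) (hyperedges E))"

lemma PT_spot_list: "PT spot_list"
  unfolding spot_list_def samples_def padded_star_def star_def by (intro PT_intros)

lemma PT_hyperedges: "PT hyperedges"
  unfolding hyperedges_def
  by (intro PT_intros PT_comp[OF _ PT_check] PT_comp[OF _ PT_spot_list] PT_spot_list)

lemma PT_Ws: "PT f \<Longrightarrow> PT (\<lambda>x. Ws (f x))"
  by (rule PT_comp[OF _ PT_samples])

lemma PT_ticks: "PT ticks"
  unfolding ticks_def by (intro PT_intros PT_hyperedges PT_Ws)

lemma PT_request_bits: "PT request_bits"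
  unfolding request_bits_def pos_bits_def
  by (intro PT_intros PT_hyperedges PT_comp[OF _ PT_ticks] PT_comp[OF _ PT_hyperedges])

lemma PT_server_bits: "PT server_bits"
  unfolding server_bits_def by (intro PT_intros PT_Ws PT_comp[OF _ PT_ticks])

lemma PT_print: "PT print"
  unfolding print_def point_bits_def
  by (intro PT_intros PT_enc_list PT_Ws PT_server_bits PT_request_bits)

end

section \<open>Weight classes of the gap instance and its augmented solutions\<close>

lemma wks_wf_gap_instance:
  assumes "P \<ge> 1" "\<And>e. e \<in> set H \<Longrightarrow> set e \<subseteq> {1..P}"
  shows "wks_wf (gap_instance P n k R H)"
  using assms set_gap_requests[of R H] by (fastforce simp: wks_wf_def gap_instance_def)

lemma card_weights_gap_instance:
  assumes "n \<ge> 1" "k \<ge> 1" "R \<ge> 2"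
  shows "card (weights (gap_instance P n k R H)) = 2"
proof -
  have "weights (gap_instance P n k R H) = {of_nat R, 1}"
    using assms by (auto simp: weights_def gap_instance_def)
  moreover have "(of_nat R :: rat) \<noteq> 1" using assms(3) of_nat_eq_1_iff[of R, where 'a = rat] by simp
  ultimately show ?thesis by simp
qed

lemma class_size_gap_instance:
  assumes "R \<ge> 2"
  shows "class_size (gap_instance P n k R H) (of_nat R) = n" "class_size (gap_instance P n k R H) 1 = k"
    "w \<noteq> of_nat R \<Longrightarrow> w \<noteq> 1 \<Longrightarrow> class_size (gap_instance P n k R H) w = 0"
proof -
  have r: "count_list (replicate m x) y = (if x = y then m else 0)" for m and x y :: rat
    by (induction m) auto
  have "(of_nat R :: rat) \<noteq> 1" using assms of_nat_eq_1_iff[of R, where 'a = rat] by simp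
  then show "class_size (gap_instance P n k R H) (of_nat R) = n" "class_size (gap_instance P n k R H) 1 = k"
    "w \<noteq> of_nat R \<Longrightarrow> w \<noteq> 1 \<Longrightarrow> class_size (gap_instance P n k R H) w = 0"
    by (auto simp: class_size_def gap_instance_def r)
qed

lemma sum_config_dist:
  "length xs = length ws \<Longrightarrow> length ys = length ws \<Longrightarrow>
     config_dist ws xs ys = (\<Sum>i<length ws. ws ! i * of_bool (xs ! i \<noteq> ys ! i))"
proof (induction ws xs ys rule: config_dist.induct)
  case (1 w ws x xs y ys)
  then show ?case by (simp add: sum.lessThan_Suc_shift del: sum.lessThan_Suc sum_mult_of_bool_eq)
qed auto

lemma path_cost_moves:
  fixes f :: "nat \<Rightarrow> nat \<Rightarrow> 'a" and ws :: "nat list"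
  defines "cfg \<equiv> \<lambda>t. map (\<lambda>i. f i t) [0..<length ws]"
  shows "path_cost ws (cfg 0) (map cfg [1..<Suc T]) = (\<Sum>i<length ws. ws ! i * moves (f i 0) (map (f i) [1..<Suc T]))"
proof -
  have "path_cost ws (cfg 0) (map cfg [1..<Suc T]) = (\<Sum>t = 1..T. config_dist ws (cfg (t - 1)) (cfg t))"
  proof (induction T)
    case (Suc T)
    have "last (cfg 0 # map cfg [1..<Suc T]) = cfg T" by (cases T) auto
    then show ?case using Suc
      by (simp add: path_cost_append del: last.simps upt_Suc add: upt_Suc_append)
  qed simp
  also have "\<dots> = (\<Sum>t = 1..T. \<Sum>i<length ws. ws ! i * of_bool (f i t \<noteq> f i (t - 1)))"
  proof (rule sum.cong[OF refl])
    fix t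
    show "config_dist ws (cfg (t - 1)) (cfg t) = (\<Sum>i<length ws. ws ! i * of_bool (f i t \<noteq> f i (t - 1)))"
      by (subst sum_config_dist) (auto simp: cfg_def intro!: sum.cong)
  qed
  also have "\<dots> = (\<Sum>i<length ws. \<Sum>t = 1..T. ws ! i * of_bool (f i t \<noteq> f i (t - 1)))" by (rule sum.swap)
  also have "\<dots> = (\<Sum>i<length ws. ws ! i * moves (f i 0) (map (f i) [1..<Suc T]))"
    by (simp only: sum_distrib_left[symmetric] sum_moves)
  finally show ?thesis .
qed

text \<open>Reading all weights as natural numbers makes costs integral, so that a cost below 1
  means that no server moves.\<close>

definition weight_of :: "nat \<Rightarrow> server \<Rightarrow> nat" where
  "weight_of R s = (if fst s = of_nat R then R else 1)"

context
  fixes P n k R :: nat and H :: "nat list list" and c :: real and xs :: "server list" and I J :: wks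
  assumes R: "R \<ge> 2" and c: "c \<ge> 1"
  defines "I \<equiv> gap_instance P n k R H" and "J \<equiv> add_servers I xs"
  assumes aug: "augmentation c I xs"
begin

text \<open>A weight that is absent from \<open>I\<close> would have class size \<lfloor>c *
  0\<rfloor> = 0 after augmentation.\<close>

lemma augmented_weights: "s \<in> set (servers J) \<Longrightarrow> fst s = of_nat (weight_of R s)"
proof (rule ccontr)
  assume s: "s \<in> set (servers J)" and "fst s \<noteq> of_nat (weight_of R s)"
  then have "class_size I (fst s) = 0"
    unfolding I_def using class_size_gap_instance(3)[OF R] by (auto simp: weight_of_def split: if_splits)
  then have "int (class_size J (fst s)) = 0" using aug unfolding augmentation_def J_def by auto
  then show False using s by (auto simp: class_size_def count_list_0_iff)
qed

lemma augmented_counts: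
  "int (count_list (map (weight_of R) (servers J)) R) = \<lfloor>c * real n\<rfloor>"
  "int (length (filter (\<lambda>w. w \<noteq> R) (map (weight_of R) (servers J)))) = \<lfloor>c * real k\<rfloor>"
proof -
  have w: "(weight_of R s = R) = (fst s = of_nat R)" "(weight_of R s \<noteq> R) = (fst s = 1)"
    if "s \<in> set (servers J)" for s
    using augmented_weights[OF that] R by (auto simp: weight_of_def split: if_splits)
  have a: "int (class_size J w) = \<lfloor>c * real (class_size I w)\<rfloor>" for w
    using aug unfolding augmentation_def J_def by blast
  have "count_list (map (weight_of R) (servers J)) R = length (filter (\<lambda>s. weight_of R s = R) (servers J))"
    by (simp add: count_list_eq_length_filter filter_map o_def eq_commute)
  also have "filter (\<lambda>s. weight_of R s = R) (servers J) = filter (\<lambda>s. fst s = of_nat R) (servers J)"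
    by (rule filter_cong) (use w in auto)
  also have "length \<dots> = class_size J (of_nat R)"
    by (simp add: class_size_def count_list_eq_length_filter filter_map o_def eq_commute[of _ "fst _"])
  finally show "int (count_list (map (weight_of R) (servers J)) R) = \<lfloor>c * real n\<rfloor>"
    using a[of "of_nat R"] class_size_gap_instance(1)[OF R] by (simp add: I_def)
  have "length (filter (\<lambda>w. w \<noteq> R) (map (weight_of R) (servers J))) = length (filter (\<lambda>s. weight_of R s \<noteq> R) (servers J))"
    by (simp add: filter_map o_def)
  also have "filter (\<lambda>s. weight_of R s \<noteq> R) (servers J) = filter (\<lambda>s. fst s = 1) (servers J)"
    by (rule filter_cong) (use w in auto)
  also have "length \<dots> = class_size J 1"
    by (simp add: class_size_def count_list_eq_length_filter filter_map o_def eq_commute[of _ "fst _"])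
  finally show "int (length (filter (\<lambda>w. w \<noteq> R) (map (weight_of R) (servers J)))) = \<lfloor>c * real k\<rfloor>"
    using a[of 1] class_size_gap_instance(2)[OF R] by (simp add: I_def)
qed

lemma augmented_cost:
  "2 * wks_cost J f = real (\<Sum>i<length (servers J). weight_of R (servers J ! i) *
     moves (f i 0) (map (f i) [1..<Suc (length (requests I))]))"
proof -
  have q: "requests J = requests I" by (simp add: J_def add_servers_def)
  have "of_rat (fst (servers J ! i)) = real (weight_of R (servers J ! i))" if "i < length (servers J)" for i
    using augmented_weights[OF nth_mem[OF that]] by simp
  then show ?thesis unfolding wks_cost_moves q of_nat_sum of_nat_mult by (intro sum.cong) auto
qed

lemma cheap_augmented_solution:
  assumes "wks_solution J f" "2 * wks_cost J f < real R * real R"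
  obtains S where "S \<subseteq> {1..P}" "int (card S) \<le> \<lfloor>c * real n\<rfloor>" "\<And>e. e \<in> set H \<Longrightarrow> int (card (set e - S)) \<le> \<lfloor>c * real k\<rfloor>"
proof -
  let ?T = "length (requests I)" and ?ws = "map (weight_of R) (servers J)"
  define cfg where "cfg t = map (\<lambda>i. f i t) [0..<length ?ws]" for t
  have q: "requests J = requests I" "points J = P" by (simp_all add: J_def add_servers_def I_def gap_instance_def)
  have pos: "f i t \<in> {1..P}" if "i < length (servers J)" "t \<le> ?T" for i t
    using assms(1) that unfolding wks_solution_def q by blast
  have cost: "path_cost ?ws (cfg 0) (map cfg [1..<Suc ?T]) < R * R"
  proof -
    have "2 * wks_cost J f = real (path_cost ?ws (cfg 0) (map cfg [1..<Suc ?T]))"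
      unfolding augmented_cost cfg_def path_cost_moves by simp
    then show ?thesis using assms(2) by (simp only: of_nat_mult[symmetric] of_nat_less_iff)
  qed
  have serve: "list_all2 (\<lambda>d a. a \<in> set d) (map cfg [1..<Suc ?T]) (gap_requests R H)"
  proof -
    have "\<exists>i<length (servers J). f i (Suc t) = requests I ! t" if "t < ?T" for t
      using assms(1) that unfolding wks_solution_def q by (auto dest!: bspec[of _ _ "Suc t"])
    then have "requests I ! t \<in> set (cfg (Suc t))" if "t < ?T" for t
      using that by (force simp: cfg_def)
    moreover have "requests I = gap_requests R H" by (simp add: I_def gap_instance_def)
    ultimately show ?thesis by (auto simp: list_all2_conv_all_nth simp del: upt_Suc)
  qed
  have ws: "set ?ws \<subseteq> {R, 1}" "1 \<le> R" using R by (auto simp: weight_of_def)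
  have len: "length (cfg 0) = length ?ws" "\<forall>d\<in>set (map cfg [1..<Suc ?T]). length d = length ?ws"
    by (auto simp: cfg_def)
  obtain S where S: "S \<subseteq> \<Union>(set ` insert (cfg 0) (set (map cfg [1..<Suc ?T])))"
    "card S \<le> count_list ?ws R" "\<And>e. e \<in> set H \<Longrightarrow> card (set e - S) \<le> length (filter (\<lambda>w. w \<noteq> R) ?ws)"
    by (rule static_cover[OF ws len serve cost]) (rule that)
  show thesis
  proof (rule that)
    show "S \<subseteq> {1..P}"
    proof
      fix a assume "a \<in> S"
      then have "a \<in> \<Union>(set ` insert (cfg 0) (set (map cfg [1..<Suc ?T])))" using S(1) by blast
      then have "a \<in> set (cfg 0) \<or> (\<exists>t\<in>{1..<Suc ?T}. a \<in> set (cfg t))"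
        unfolding set_map set_upt by blast
      then obtain t where "t \<le> ?T" "a \<in> set (cfg t)"
      proof
        assume "a \<in> set (cfg 0)"
        then show thesis using that[of 0] by simp
      next
        assume "\<exists>t\<in>{1..<Suc ?T}. a \<in> set (cfg t)"
        then obtain t where "t \<in> {1..<Suc ?T}" "a \<in> set (cfg t)" by blast
        then show thesis using that[of t] by simp
      qed
      then show "a \<in> {1..P}" using pos by (auto simp: cfg_def)
    qed
    show "int (card S) \<le> \<lfloor>c * real n\<rfloor>" using S(2) augmented_counts(1) by linarith
    show "int (card (set e - S)) \<le> \<lfloor>c * real k\<rfloor>" if "e \<in> set H" for e
      using S(3)[OF that] augmented_counts(2) by linarith
  qed
qed

end

lemma wks_opt_le: "wks_wf I \<Longrightarrow> wks_solution I f \<Longrightarrow> wks_opt I \<le> wks_cost I f"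
  unfolding wks_opt_def
proof (rule cInf_lower)
  assume wf: "wks_wf I"
  show "bdd_below {wks_cost I f |f. wks_solution I f}"
  proof (rule bdd_belowI[of _ 0])
    fix x assume "x \<in> {wks_cost I f |f. wks_solution I f}"
    then obtain f where x: "x = wks_cost I f" by blast
    have "0 \<le> (real_of_rat (fst (servers I ! i)))" if "i < length (servers I)" for i
      using wf nth_mem[OF that] by (auto simp: wks_wf_def)
    then show "0 \<le> x" unfolding x wks_cost_def by (intro mult_nonneg_nonneg sum_nonneg) auto
  qed
qed auto

lemma enc_list_map: "enc_list e (map f xs) = enc_list (\<lambda>x. e (f x)) xs"
  by (simp add: enc_list_def o_def)

lemma enc_list_cong: "(\<And>x. x \<in> set xs \<Longrightarrow> e x = d x) \<Longrightarrow> enc_list e xs = enc_list d xs"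
  unfolding enc_list_def by (rule arg_cong[where f = "\<lambda>ys. concat ys @ [False]"], rule map_cong) auto

lemma length_enc_list: "length (enc_list e xs) = sum_list (map (\<lambda>x. Suc (length (e x))) xs) + 1"
  by (simp add: enc_list_def length_concat o_def)

lemma length_enc_bits: "length (enc_bits s) = 2 * length s + 1"
  by (simp add: enc_bits_def length_enc_list sum_list_triv)

lemma bits_1: "bits 1 = [True]"
  by (simp add: bits.simps)

lemma sum_list_bound: "(\<And>x. x \<in> set xs \<Longrightarrow> f x \<le> (c::nat)) \<Longrightarrow> sum_list (map f xs) \<le> length xs * c"
  by (induction xs) (auto simp: add_mono)

definition point_code :: "nat \<times> bool list \<Rightarrow> nat" where
  "point_code x = num (snd x @ replicate (fst x) False @ [True])"

lemma point_code_inject: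
  assumes "length (snd x) = length (snd y)" "point_code x = point_code y"
  shows "x = y"
proof -
  have "bits (point_code z) = snd z @ replicate (fst z) False @ [True]" for z
    unfolding point_code_def by (rule bits_num) simp
  with assms(2) have "snd x @ replicate (fst x) False @ [True] = snd y @ replicate (fst y) False @ [True]" by metis
  then have "snd x = snd y" "replicate (fst x) False @ [True] = replicate (fst y) False @ [True]"
    using assms(1) by auto
  then show ?thesis by (metis length_append length_replicate add_right_cancel prod_eqI)
qed

context reduction
begin

lemma server_bits_eq:
  "server_bits E = replicate (K * length (Ws E)) ((bits (length (ticks E)), [True]), [True])
      @ replicate k (([True], [True]), [True])"
  proof -
    have "concat (map (\<lambda>_. map (\<lambda>_. c) (replicate K True)) ws) = replicate (K * length ws) c" for c :: 'c and ws :: "'w list"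
      by (induction ws) (auto simp: replicate_add map_replicate_const)
    then show ?thesis by (simp add: server_bits_def bits_length)
  qed

lemma request_bitsD:
  assumes "s \<in> set (request_bits E)"
  obtains t s' where "t \<in> set (hyperedges E)" "s' \<in> set t" "s = pos_bits s'"
  using assms unfolding request_bits_def by (auto split: if_splits)

text \<open>The strings printed as point numbers end in \<open>True\<close>, hence are the canonical
  binary expansions that \<open>enc_nat\<close> produces.\<close>

lemma print_eq: "print E = enc_wks (instance_of E)"
proof -
  have p: "enc_nat (num s) = enc_bits s" if "s \<noteq> []" "last s" for s
    using bits_num[of s] that by (simp add: enc_nat_bits)
  have 1: "enc_nat (points (instance_of E)) = enc_bits (point_bits E)"
    by (simp add: instance_of_def gap_instance_def p point_bits_def)
  have 2: "enc_list (\<lambda>s. (enc_bits (fst (fst s)) @ enc_bits (snd (fst s))) @ enc_bits (snd s)) (server_bits E)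
      = enc_list enc_server (servers (instance_of E))"
    unfolding server_bits_eq by (simp add: enc_list_def instance_of_def gap_instance_def enc_server_def enc_rat_def
        enc_nat_bits bits_1[simplified])
  have "requests (instance_of E) = map num (request_bits E)"
    by (simp add: instance_of_def gap_instance_def gap_requests_def request_bits_def map_concat o_def map_replicate_const)
  moreover have "enc_nat (num s) = enc_bits s" if s: "s \<in> set (request_bits E)" for s
  proof -
    obtain s' where "s = pos_bits s'" by (rule request_bitsD[OF s])
    then show ?thesis by (intro p) (simp_all add: pos_bits_def)
  qed
  ultimately have 3: "enc_list enc_nat (requests (instance_of E)) = enc_list enc_bits (request_bits E)"
    by (simp only: enc_list_map) (rule enc_list_cong)
  show ?thesis by (simp only: enc_wks_def print_def 1 2 3)
qed

lemma length_ticks: "length (ticks E) = (length (Ws E) + (length (hyperedges E) + c0)) ^ D"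
  by (simp add: ticks_def)

lemma spot_listD:
  assumes "s \<in> set (spot_list E)"
  obtains i f y where "i < length (Ws E)" "f \<in> set (Ws E ! i)" "y \<in> cube Q"
    "s = (fst (snd f), replicate i False, snd (snd f), y)"
proof -
  obtain w z e y where "(w, z) \<in> set (zip (Ws E) (unary_index (Ws E)))" "e \<in> set w" "y \<in> set (tuples Q [False, True])"
    "s = (fst (snd e), z, snd (snd e), y)"
    using assms by (auto simp: spot_list_def)
  moreover from this(1) obtain i where "i < length (Ws E)" "w = Ws E ! i" "z = replicate i False"
    by (auto simp: set_zip unary_index)
  ultimately show thesis using that[of i e y] by (auto simp: set_tuples cube_def)
qed

lemma spot_listI:
  assumes "i < length (Ws E)" "f \<in> set (Ws E ! i)" "y \<in> cube Q"
  shows "(fst (snd f), replicate i False, snd (snd f), y) \<in> set (spot_list E)"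
proof -
  have "(Ws E ! i, replicate i False) \<in> set (zip (Ws E) (unary_index (Ws E)))"
    using assms(1) by (auto simp: set_zip unary_index)
  moreover have "y \<in> set (tuples Q [False, True])" using assms(3) by (auto simp: set_tuples cube_def)
  ultimately show ?thesis using assms(2) unfolding spot_list_def set_concat set_map by force
qed

text \<open>The requests dominate: R * |H| blocks, each with R * h requests whose codes have O(|W| +
  Q) bits, which amounts to R^2 times a cubic term in X, the sum on the right. The fourth power
  absorbs the numerical constants because X is at least 20.\<close>

lemma length_print:
  assumes c0: "2 * Q + 10 * k + K + h \<le> c0" "20 \<le> c0"
  shows "length (print E) \<le> length (ticks E) ^ 2 * (length (Ws E) + (length (hyperedges E) + c0)) ^ 4"
proof -
  define M Hn X R where "M = length (Ws E)" and "Hn = length (hyperedges E)"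
    and "X = length (Ws E) + (length (hyperedges E) + c0)" and "R = length (ticks E)"
  have X: "M \<le> X" "Hn \<le> X" "2 * Q + 10 * k + K + h \<le> X" "20 \<le> X" "M + 20 \<le> X" using c0 by (auto simp: M_def Hn_def X_def)
  have R: "R \<ge> 1" using X(4) unfolding R_def length_ticks X_def by simp
  have X0: "X > 0" "R > 0" using X(4) R by linarith+
  have 1: "length (enc_bits (point_bits E)) \<le> 2 * M + 2 * Q + 3"
    by (simp add: length_enc_bits point_bits_def M_def)
  have 2: "length (enc_list (\<lambda>s. (enc_bits (fst (fst s)) @ enc_bits (snd (fst s))) @ enc_bits (snd s)) (server_bits E))
      \<le> (M * K + k) * (10 * R) + 1"
  proof -
    have "sum_list (map (\<lambda>s. Suc (length ((enc_bits (fst (fst s)) @ enc_bits (snd (fst s))) @ enc_bits (snd s)))) (server_bits E))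
        \<le> length (server_bits E) * (10 * R)"
    proof (rule sum_list_bound)
      fix s assume "s \<in> set (server_bits E)"
      then have "s = ((bits R, [True]), [True]) \<or> s = (([True], [True]), [True])"
        by (auto simp: server_bits_def R_def bits_length split: if_splits)
      then show "Suc (length ((enc_bits (fst (fst s)) @ enc_bits (snd (fst s))) @ enc_bits (snd s))) \<le> 10 * R"
        using R length_bits_le[of R] by (auto simp: length_enc_bits)
    qed
    also have "length (server_bits E) = M * K + k"
      by (simp add: server_bits_def length_concat o_def sum_list_triv M_def)
    finally show ?thesis unfolding length_enc_list by simp
  qed
  have hl: "length t = h" "\<And>s. s \<in> set t \<Longrightarrow> length (pos_bits s) \<le> Q + M" if t: "t \<in> set (hyperedges E)" for t
  proof -
    show "length t = h" using t by (auto simp: hyperedges_def set_tuples)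
    fix s assume "s \<in> set t"
    with t have "s \<in> set (spot_list E)" by (auto simp: hyperedges_def set_tuples)
    then show "length (pos_bits s) \<le> Q + M" by (rule spot_listD) (auto simp: pos_bits_def cube_def M_def)
  qed
  have 3: "length (enc_list enc_bits (request_bits E)) \<le> R * Hn * (R * h) * (2 * Q + 2 * M + 2) + 1"
  proof -
    have "sum_list (map (\<lambda>s. Suc (length (enc_bits s))) (request_bits E)) \<le> length (request_bits E) * (2 * Q + 2 * M + 2)"
    proof (rule sum_list_bound)
      fix s assume "s \<in> set (request_bits E)"
      then obtain t s' where "t \<in> set (hyperedges E)" "s' \<in> set t" "s = pos_bits s'" by (rule request_bitsD)
      then show "Suc (length (enc_bits s)) \<le> 2 * Q + 2 * M + 2" using hl(2)[of t s'] by (simp add: length_enc_bits)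
    qed
    also have "\<dots> \<le> R * Hn * (R * h) * (2 * Q + 2 * M + 2)"
    proof (rule mult_le_mono1)
      have "length (request_bits E) = sum_list (map (\<lambda>e. length (ticks E) * length e) (concat (map (\<lambda>_. map (map pos_bits) (hyperedges E)) (ticks E))))"
        by (simp add: request_bits_def length_concat o_def sum_list_triv)
      also have "\<dots> \<le> length (concat (map (\<lambda>_. map (map pos_bits) (hyperedges E)) (ticks E))) * (R * h)"
        by (rule sum_list_bound) (use hl(1) in \<open>auto simp: R_def\<close>)
      also have "length (concat (map (\<lambda>_. map (map pos_bits) (hyperedges E)) (ticks E))) = R * Hn"
        by (simp add: length_concat o_def sum_list_triv R_def Hn_def)
      finally show "length (request_bits E) \<le> R * Hn * (R * h)" .
    qed
    finally show ?thesis unfolding length_enc_list by simp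
  qed
  have "length (print E) \<le> (2 * M + 2 * Q + 3) + ((M * K + k) * (10 * R) + 1) + (R * Hn * (R * h) * (2 * Q + 2 * M + 2) + 1)"
    unfolding print_def length_append using 1 2 3 by linarith
  also have "\<dots> \<le> 3 * X + (2 * X ^ 2 * (X * R)) + R ^ 2 * (X ^ 2 * (4 * X))"
  proof (intro add_mono)
    have "(M * K + k) * (10 * R) \<le> (X * X + X) * (10 * R)" using X by (intro mult_le_mono add_mono) auto
    also have "\<dots> + 1 \<le> 2 * X ^ 2 * (X * R)"
    proof -
      have a: "X \<le> X ^ 2" "20 * X ^ 2 \<le> X * X ^ 2" using X by (auto simp: power2_eq_square)
      have "(X * X + X) * (10 * R) + 1 \<le> (2 * X ^ 2) * (10 * R) + X ^ 2 * R"
      proof (rule add_mono)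
        show "(X * X + X) * (10 * R) \<le> 2 * X ^ 2 * (10 * R)" using a by (intro mult_le_mono) (auto simp: power2_eq_square)
        show "1 \<le> X ^ 2 * R" using X0 by (simp add: Suc_le_eq)
      qed
      also have "\<dots> \<le> 2 * (20 * X ^ 2) * R" by simp
      also have "\<dots> \<le> 2 * (X * X ^ 2) * R" by (intro mult_le_mono a order_refl)
      finally show ?thesis by (simp add: mult.commute mult.left_commute)
    qed
    finally show "(M * K + k) * (10 * R) + 1 \<le> 2 * X ^ 2 * (X * R)" by simp
    have "R * Hn * (R * h) * (2 * Q + 2 * M + 2) \<le> R * X * (R * X) * (3 * X + 2)"
      using X by (intro mult_le_mono) auto
    moreover have "R * X * (R * X) * (3 * X + 2) + 1 \<le> R * X * (R * X) * (3 * X + 3)"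
    proof -
      have "1 \<le> R * X * (R * X)" using X0 by (simp add: Suc_le_eq)
      then show ?thesis by (simp add: algebra_simps)
    qed
    moreover have "R * X * (R * X) * (3 * X + 3) \<le> R ^ 2 * (X ^ 2 * (4 * X))"
    proof -
      have "R * X * (R * X) * (3 * X + 3) \<le> R * X * (R * X) * (4 * X)" using X by (intro mult_le_mono) auto
      then show ?thesis by (simp add: power2_eq_square mult.commute mult.left_commute)
    qed
    ultimately show "R * Hn * (R * h) * (2 * Q + 2 * M + 2) + 1 \<le> R ^ 2 * (X ^ 2 * (4 * X))" by linarith
  qed (use X in auto)
  also have "\<dots> \<le> R ^ 2 * X ^ 4"
  proof -
    have r: "R \<le> R ^ 2" "1 \<le> R ^ 2" using R by (auto simp: power2_eq_square)
    have c: "X \<le> X ^ 3" using X by (simp add: power3_eq_cube)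
    have "3 * X + 2 * X ^ 2 * (X * R) + R ^ 2 * (X ^ 2 * (4 * X)) = 3 * X * 1 + 2 * X ^ 3 * R + 4 * X ^ 3 * R ^ 2"
      by (simp add: power2_eq_square power3_eq_cube)
    also have "\<dots> \<le> 3 * X ^ 3 * R ^ 2 + 2 * X ^ 3 * R ^ 2 + 4 * X ^ 3 * R ^ 2"
      using r c by (intro add_mono mult_le_mono) simp_all
    also have "\<dots> = 9 * (X ^ 3 * R ^ 2)" by simp
    also have "\<dots> \<le> X * (X ^ 3 * R ^ 2)" using X by (intro mult_le_mono) auto
    also have "\<dots> = R ^ 2 * X ^ 4" by (simp add: power_def eval_nat_numeral)
    finally show ?thesis .
  qed
  finally show ?thesis by (simp add: R_def X_def)
qed

end

section \<open>The printed instance has the gap\<close>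

section \<open>The gap\<close>

definition edge_map :: "edge \<Rightarrow> nat \<Rightarrow> nat" where
  "edge_map e a = num (snd (snd e) ! a)"

locale gap_game = reduction q L Q h k K D c0 check + label_game E fst "\<lambda>e. fst (snd e)" edge_map q
  for q L Q h k K D c0 check and E :: "edge list" +
  assumes codes: "\<And>e. e \<in> set E \<Longrightarrow> snd (snd e) \<in> perm_codes q"
    and h: "h \<ge> 1" and k: "k \<ge> 1" and K: "K \<ge> 1" and D: "D \<ge> 1" and c0: "c0 \<ge> 2"
begin

definition spot_of :: "nat \<times> edge \<times> bool list \<Rightarrow> spot" where
  "spot_of x = (fst (snd (fst (snd x))), replicate (fst x) False, snd (snd (fst (snd x))), snd (snd x))"

lemma set_spot_list: "set (spot_list E) = spot_of ` spots L Q"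
proof (intro set_eqI iffI)
  fix s assume "s \<in> set (spot_list E)"
  then show "s \<in> spot_of ` spots L Q"
    by (rule spot_listD) (force simp: spot_of_def spots_def)
next
  fix s assume "s \<in> spot_of ` spots L Q"
  then show "s \<in> set (spot_list E)" by (auto simp: spot_of_def spots_def intro: spot_listI)
qed

lemma num_pos_bits: "num (pos_bits (spot_of x)) = point_code (point x)"
  by (simp add: pos_bits_def spot_of_def point_code_def point_def)

lemma spots_codes:
  assumes "x \<in> spots L Q"
  shows "snd (snd (spot_of x)) = (snd (snd (fst (snd x))), snd (snd x))"
    "snd (snd (spot_of x)) \<in> perm_codes q \<times> cube Q"
proof -
  have "fst (snd x) \<in> set E"
  proof -
    have "samples fst L E ! fst x \<in> set (samples fst L E)" using assms by (auto simp: spots_def)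
    then show ?thesis by (rule in_samples) (use assms in \<open>auto simp: spots_def\<close>)
  qed
  then show "snd (snd (spot_of x)) = (snd (snd (fst (snd x))), snd (snd x))"
    "snd (snd (spot_of x)) \<in> perm_codes q \<times> cube Q"
    using codes[of "fst (snd x)"] assms by (auto simp: spot_of_def spots_def)
qed

lemma hits_code:
  assumes "x \<in> spots L Q"
  shows "(\<exists>a<q. fst (snd (snd (spot_of x))) ! a = bits b \<and> snd (snd (snd (spot_of x))) ! a) = hits b x"
proof -
  have "(snd (snd (fst (snd x))) ! a = bits b) = (edge_map (fst (snd x)) a = b)" if "a < q" for a
  proof -
    have "snd (snd (fst (snd x))) \<in> perm_codes q" using spots_codes[OF assms] by simp
    then have "snd (snd (fst (snd x))) ! a \<in> bits ` {..<q}"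
      using that by (auto simp: perm_codes_def subset_iff)
    then show ?thesis by (auto simp: edge_map_def)
  qed
  then show ?thesis unfolding hits_def spots_codes(1)[OF assms] fst_conv snd_conv by metis
qed

lemma tight_spots:
  assumes "set t \<subseteq> spots L Q"
  shows "tight q k (map (\<lambda>s. snd (snd s)) (map spot_of t)) \<longleftrightarrow> (\<forall>b<q. length (filter (hits b) t) \<le> k)"
proof -
  have "filter ((\<lambda>x. \<exists>a<q. fst x ! a = bits b \<and> snd x ! a) \<circ> (\<lambda>s. snd (snd s)) \<circ> spot_of) t = filter (hits b) t" for b
    by (rule filter_cong[OF refl]) (use hits_code[OF subsetD[OF assms]] in simp)
  then show ?thesis by (simp add: tight_def filter_map o_assoc)
qed

lemma check_spots:
  assumes "set t \<subseteq> spots L Q" "length t = h"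
  shows "check (map (\<lambda>s. snd (snd s)) (map spot_of t)) \<longleftrightarrow> (\<forall>b<q. length (filter (hits b) t) \<le> k)"
proof -
  have "set (map (\<lambda>s. snd (snd s)) (map spot_of t)) \<subseteq> perm_codes q \<times> cube Q"
    unfolding set_map image_image by (rule image_subsetI) (rule spots_codes(2)[OF subsetD[OF assms(1)]])
  then show ?thesis using check[of "map (\<lambda>s. snd (snd s)) (map spot_of t)"] assms(2) tight_spots[OF assms(1)] by simp
qed

lemma hyperedgesD:
  assumes "t' \<in> set (hyperedges E)"
  obtains t where "set t \<subseteq> spots L Q" "length t = h" "balanced k t" "t' = map spot_of t"
proof -
  obtain s where s: "s \<in> set (spot_list E)" "check (map (\<lambda>s. snd (snd s)) t')"
    "t' \<in> set (tuples h (filter (\<lambda>s'. fst s' = fst s) (spot_list E)))"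
    using assms by (auto simp: hyperedges_def)
  then have t': "length t' = h" "set t' \<subseteq> spot_of ` spots L Q" "\<And>s'. s' \<in> set t' \<Longrightarrow> fst s' = fst s"
    by (auto simp: set_tuples set_spot_list)
  define t where "t = map (inv_into (spots L Q) spot_of) t'"
  have t: "set t \<subseteq> spots L Q" "length t = h" "t' = map spot_of t"
  proof -
    show "set t \<subseteq> spots L Q" unfolding t_def set_map
      by (rule image_subsetI) (rule inv_into_into[OF subsetD[OF t'(2)]])
    have "map (\<lambda>x. spot_of (inv_into (spots L Q) spot_of x)) t' = map (\<lambda>x. x) t'"
      by (rule map_cong[OF refl]) (rule f_inv_into_f[OF subsetD[OF t'(2)]])
    then show "t' = map spot_of t" by (simp add: t_def o_def)
  qed (simp add: t_def t'(1))
  have "fst (snd (fst (snd x))) = fst s" if "x \<in> set t" for x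
    using t'(3)[of "spot_of x"] that t(3) by (simp add: spot_of_def)
  then have "balanced k t"
    using check_spots[OF t(1,2)] s(2) t(3) by (auto simp: balanced_def)
  with t show thesis using that by blast
qed

lemma hyperedgesI:
  assumes t: "set t \<subseteq> spots L Q" "length t = h" and b: "balanced k t"
  shows "map spot_of t \<in> set (hyperedges E)"
proof -
  have ne: "t \<noteq> []" using t(2) h by auto
  let ?s = "spot_of (hd t)"
  have s: "?s \<in> set (spot_list E)" unfolding set_spot_list by (rule imageI) (use ne t(1) in auto)
  have "fst (spot_of x) = fst ?s" if "x \<in> set t" for x
    using b that ne by (auto simp: balanced_def spot_of_def)
  then have "map spot_of t \<in> set (tuples h (filter (\<lambda>s'. fst s' = fst ?s) (spot_list E)))"
    using t by (auto simp: set_tuples set_spot_list)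
  moreover have "check (map (\<lambda>s. snd (snd s)) (map spot_of t))"
    using check_spots[OF t] b by (simp add: balanced_def)
  ultimately have "map spot_of t \<in> set (filter (\<lambda>t. check (map (\<lambda>s. snd (snd s)) t))
     (tuples h (filter (\<lambda>s'. fst s' = fst ?s) (spot_list E))))" by (simp only: set_filter mem_Collect_eq simp_thms)
  then show ?thesis using s unfolding hyperedges_def set_concat set_map by (intro UN_I[of _ "image _ _"] imageI) auto
qed

abbreviation sets :: "nat list list" where
  "sets \<equiv> map (map (num \<circ> pos_bits)) (hyperedges E)"

lemma sets_iff: "e \<in> set sets \<longleftrightarrow> (\<exists>t. set t \<subseteq> spots L Q \<and> length t = h \<and> balanced k t \<and> e = map (\<lambda>x. point_code (point x)) t)"
proof
  assume "e \<in> set sets"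
  then obtain t' where e: "t' \<in> set (hyperedges E)" "e = map (num \<circ> pos_bits) t'" by auto
  from e(1) show "\<exists>t. set t \<subseteq> spots L Q \<and> length t = h \<and> balanced k t \<and> e = map (\<lambda>x. point_code (point x)) t"
  proof (rule hyperedgesD)
    fix t assume "set t \<subseteq> spots L Q" "length t = h" "balanced k t" "t' = map spot_of t"
    then show ?thesis using e(2) by (intro exI[of _ t]) (simp add: num_pos_bits)
  qed
next
  assume "\<exists>t. set t \<subseteq> spots L Q \<and> length t = h \<and> balanced k t \<and> e = map (\<lambda>x. point_code (point x)) t"
  then obtain t where t: "set t \<subseteq> spots L Q" "length t = h" "balanced k t" "e = map (\<lambda>x. point_code (point x)) t" by blast
  have "e = map (num \<circ> pos_bits) (map spot_of t)" using t(4) by (simp add: num_pos_bits)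
  then show "e \<in> set sets" unfolding set_map by (rule image_eqI) (rule hyperedgesI[OF t(1-3)])
qed

lemma Ws_ge: "length (Ws E) \<ge> 1"
  using ne by (simp add: length_samples Suc_le_eq)

lemma point_code_range:
  assumes "x \<in> {..<length (Ws E)} \<times> cube Q"
  shows "point_code x \<in> {1..num (point_bits E)}"
proof -
  let ?s = "snd x @ replicate (fst x) False @ [True]"
  have "num ?s < 2 ^ length ?s" by (rule num_less)
  also have "\<dots> \<le> 2 ^ (length (Ws E) + (Q + 1))"
    by (rule power_increasing) (use assms in \<open>auto simp: cube_def\<close>)
  also have "\<dots> = num (point_bits E) + 1"
    using num_ones[of "length (Ws E) + (Q + 1)"] by (simp only: point_bits_def map_replicate_const replicate_add)
  finally have "num ?s \<le> num (point_bits E)" by simp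
  moreover have "num ?s > 0" by (rule num_pos) auto
  ultimately show ?thesis by (simp add: point_code_def)
qed

lemma point_spots: "x \<in> spots L Q \<Longrightarrow> point x \<in> {..<length (Ws E)} \<times> cube Q"
  by (auto simp: spots_def point_def)

lemma point_code_inj: "inj_on point_code ({..<length (Ws E)} \<times> cube Q)"
proof (rule inj_onI)
  fix x y assume "x \<in> {..<length (Ws E)} \<times> cube Q" "y \<in> {..<length (Ws E)} \<times> cube Q" "point_code x = point_code y"
  then show "x = y" by (intro point_code_inject) (auto simp: cube_def)
qed

lemma sets_range:
  assumes "e \<in> set sets"
  shows "set e \<subseteq> {1..num (point_bits E)}"
proof -
  obtain t where t: "set t \<subseteq> spots L Q" "e = map (\<lambda>x. point_code (point x)) t"
    using assms unfolding sets_iff by blast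
  show ?thesis unfolding t(2) set_map
    by (rule image_subsetI) (rule point_code_range[OF point_spots[OF subsetD[OF t(1)]]])
qed

lemma points_ge: "num (point_bits E) \<ge> 1"
proof -
  have "num (point_bits E) > 0" by (rule num_pos) (auto simp: point_bits_def)
  then show ?thesis by simp
qed

lemma ticks_ge: "length (ticks E) \<ge> 2"
proof -
  have "2 ^ 1 \<le> (length (Ws E) + (length (hyperedges E) + c0)) ^ D"
    using c0 D by (intro order_trans[OF power_increasing[of 1 D "2 :: nat"] power_mono]) auto
  then show ?thesis by (simp add: length_ticks)
qed

lemma wks_wf_instance: "wks_wf (instance_of E)"
  unfolding instance_of_def by (rule wks_wf_gap_instance[OF points_ge sets_range])

lemma card_weights_instance: "card (weights (instance_of E)) = 2"
  unfolding instance_of_def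
  by (rule card_weights_gap_instance) (use k K Ws_ge ticks_ge in \<open>auto simp: Suc_le_eq\<close>)

text \<open>By \<open>size\<close>, \<open>K\<close> heavy servers per sample can occupy the cover
  from \<open>small_cover\<close>. The resulting cost is linear in \<open>R\<close>, against the
  quadratic threshold in \<open>soundness\<close>.\<close>

lemma completeness:
  assumes lab: "\<And>u. A u < q" "\<And>v. B v < q"
      "real (length (filter (\<lambda>e. edge_map e (A (fst e)) \<noteq> B (fst (snd e))) E)) \<le> z * real (length E)"
    and z: "z \<ge> 0" and L: "L \<ge> 1" and Q: "q \<le> Q" and size: "2 ^ Q * (1/2 + real L * z) \<le> real K"
  shows "2 * wks_opt (instance_of E) \<le> real (length (ticks E)) *
    (real K * real (length (Ws E)) + real k * real (length (hyperedges E)))"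
proof -
  obtain S where S: "S \<subseteq> {..<length (Ws E)} \<times> cube Q"
    "real (card S) \<le> 2 ^ Q * (1/2 + real L * z) * real (length (Ws E))"
    "\<And>t k. set t \<subseteq> spots L Q \<Longrightarrow> balanced k t \<Longrightarrow> card (point ` set t - S) \<le> k"
    by (rule small_cover[OF lab L Q z]) (rule that)
  have fin: "finite S" using S(1) by (rule finite_subset) auto
  let ?S = "point_code ` S"
  have 1: "?S \<subseteq> {1..num (point_bits E)}" using S(1) point_code_range by blast
  have "real (card ?S) \<le> real (card S)" using card_image_le[OF fin] by simp
  also have "\<dots> \<le> real K * real (length (Ws E))"
    by (rule order_trans[OF S(2)]) (intro mult_right_mono size, simp)
  finally have 2: "card ?S \<le> K * length (Ws E)" by (simp only: of_nat_mult[symmetric] of_nat_le_iff)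
  have 3: "card (set e - ?S) \<le> k" if "e \<in> set sets" for e
  proof -
    obtain t where t: "set t \<subseteq> spots L Q" "balanced k t" "e = map (\<lambda>x. point_code (point x)) t"
      using \<open>e \<in> set sets\<close> unfolding sets_iff by blast
    have "set e - ?S \<subseteq> point_code ` (point ` set t - S)" using t(3) by auto
    then have "card (set e - ?S) \<le> card (point_code ` (point ` set t - S))" by (intro card_mono) auto
    also have "\<dots> \<le> card (point ` set t - S)" by (intro card_image_le) auto
    also have "\<dots> \<le> k" by (rule S(3)[OF t(1,2)])
    finally show ?thesis .
  qed
  obtain f where f: "wks_solution (instance_of E) f"
    "2 * wks_cost (instance_of E) f \<le> real (length (ticks E)) * real (K * length (Ws E))
       + real k * (real (length (ticks E)) * real (length sets))"
    by (rule cheap_solution[where R = "length (ticks E)" and H = sets, OF points_ge sets_range 1 2 3,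
          folded instance_of_def]) (assumption | rule that)+
  have "wks_opt (instance_of E) \<le> wks_cost (instance_of E) f"
    by (rule wks_opt_le[OF wks_wf_instance f(1)])
  with f(2) show ?thesis by (simp add: algebra_simps)
qed

text \<open>By \<open>hk\<close>, \<open>h\<close> is one more than the augmented number of cheap
  servers, so the static cover extracted from a cheap solution leaves fewer than \<open>h\<close>
  points of every set. The augmented heavy servers number at most \<open>c * K\<close> per sample,
  and \<open>size\<close> says that they miss a fraction \<delta> of the points even after the
  allowance for light points.\<close>

lemma soundness:
  fixes c \<eta> \<beta> \<delta> :: real
  assumes c: "c \<ge> 1" and aug: "augmentation c (instance_of E) xs"
    and sol: "wks_solution (add_servers (instance_of E) xs) f"
    and cheap: "2 * wks_cost (add_servers (instance_of E) xs) f < real (length (ticks E)) * real (length (ticks E))"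
    and hk: "int h = \<lfloor>c * real k\<rfloor> + 1"
    and size: "c * real K + real L * real h \<le> (1 - \<delta>) * 2 ^ Q"
    and par: "\<eta> > 0" "\<beta> > 0" "\<delta> > 0" "real q * (1 + \<beta> * (1/2 + \<eta>)) ^ h < (1 + \<beta>) ^ Suc k"
      "real L * (2 * \<eta>\<^sup>2 * \<delta>) \<ge> 1" "q \<le> Q"
  obtains A B where "\<And>u. A u < q" "\<And>v. B v < q"
    "real (length (filter (\<lambda>e. edge_map e (A (fst e)) = B (fst (snd e))) E)) \<ge> \<eta>\<^sup>2 * \<delta> / 2 * real (length E)"
proof -
  obtain S where S: "S \<subseteq> {1..num (point_bits E)}" "int (card S) \<le> \<lfloor>c * real (K * length (Ws E))\<rfloor>"
    "\<And>e. e \<in> set sets \<Longrightarrow> int (card (set e - S)) \<le> \<lfloor>c * real k\<rfloor>"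
    by (rule cheap_augmented_solution[OF ticks_ge c aug[unfolded instance_of_def] sol[unfolded instance_of_def]
          cheap[unfolded instance_of_def]]) (rule that)
  let ?D = "{..<length (Ws E)} \<times> cube Q"
  define S' where "S' = {x \<in> ?D. point_code x \<in> S}"
  have fin: "finite S'" unfolding S'_def by auto
  have finS: "finite S" using S(1) by (rule finite_subset) auto
  have inj: "inj_on point_code S'" using point_code_inj by (rule inj_on_subset) (auto simp: S'_def)
  have "card S' \<le> card S" by (rule card_inj_on_le[OF inj _ finS]) (auto simp: S'_def)
  then have "real (card S') \<le> c * real (K * length (Ws E))" using S(2) by linarith
  then have "real (card S') + real (length (Ws E)) * real L * real h
      \<le> (c * real K + real L * real h) * real (length (Ws E))" by (simp add: algebra_simps)
  also have "\<dots> \<le> (1 - \<delta>) * 2 ^ Q * real (length (Ws E))" by (intro mult_right_mono size) simp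
  finally have small: "real (card S') + real (length (Ws E)) * real L * real h
      \<le> (1 - \<delta>) * 2 ^ Q * real (length (Ws E))" .
  have cover: "card (point ` set t - S') < h" if t: "set t \<subseteq> spots L Q" "length t = h" "balanced k t" for t
  proof -
    let ?e = "map (\<lambda>x. point_code (point x)) t"
    have "?e \<in> set sets" unfolding sets_iff using t by blast
    then have le: "int (card (set ?e - S)) \<le> \<lfloor>c * real k\<rfloor>" by (rule S(3))
    have sub: "point ` set t - S' \<subseteq> ?D" using t(1) point_spots by blast
    then have "point_code ` (point ` set t - S') \<subseteq> set ?e - S" by (auto simp: S'_def)
    moreover have "inj_on point_code (point ` set t - S')" using point_code_inj sub by (rule inj_on_subset)
    ultimately have "card (point ` set t - S') \<le> card (set ?e - S)" by (intro card_inj_on_le) auto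
    with le hk show ?thesis by linarith
  qed
  show thesis
    by (rule no_small_cover[OF fin small cover par]) (assumption | rule that)+
qed

end

section \<open>Deciding the language from an approximate solution\<close>

section \<open>Checking answers\<close>

lemma parses_unique: "parses p e \<Longrightarrow> e a @ r = e b @ s \<Longrightarrow> a = b"
  unfolding parses_def by (metis fst_conv)

type_synonym server_code = "(bool list \<times> bool list) \<times> bool list"

definition code_server :: "server \<Rightarrow> server_code" where
  "code_server s = ((bits (nat (fst (quotient_of (fst s)))), bits (nat (snd (quotient_of (fst s))))), bits (snd s))"

definition print_server :: "server_code \<Rightarrow> bool list" where
  "print_server s = (enc_bits (fst (fst s)) @ enc_bits (snd (fst s))) @ enc_bits (snd s)"

definition parse_server :: "server_code parser" where
  "parse_server = parse_pair (parse_pair parse_bits parse_bits) parse_bits"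

lemma parses_server: "parses parse_server print_server"
  using parses_pair[OF parses_pair[OF parses_bits parses_bits] parses_bits]
  unfolding parse_server_def print_server_def[abs_def] .

lemma parser_server: "parser parse_server"
  unfolding parse_server_def by (intro parser_pair parser_bits)

lemma enc_server: "enc_server s = print_server (code_server s)"
  by (simp add: enc_server_def code_server_def print_server_def enc_rat_def enc_nat_bits split: prod.split)

lemma enc_servers: "enc_list enc_server ss = enc_list print_server (map code_server ss)"
  by (simp only: enc_list_map enc_server[abs_def])

lemma enc_nats: "enc_list enc_nat ns = enc_list enc_bits (map bits ns)"
  by (simp only: enc_list_map enc_nat_bits[abs_def])

text \<open>Codes apply \<open>nat\<close> to numerator and denominator, which is injective on
  nonnegative weights.\<close>

lemma code_server_inject:
  assumes "fst s \<ge> 0" "fst t \<ge> 0" "code_server s = code_server t"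
  shows "s = t"
proof -
  have q: "fst (quotient_of r) \<ge> 0" "snd (quotient_of r) > 0" if r: "r \<ge> 0" for r
  proof -
    show "snd (quotient_of r) > 0" by (rule quotient_of_denom_pos') 
    moreover have "0 \<le> rat_of_int (fst (quotient_of r)) / rat_of_int (snd (quotient_of r))"
      using r quotient_of_div[of r "fst (quotient_of r)" "snd (quotient_of r)"] by simp
    ultimately show "fst (quotient_of r) \<ge> 0" by (auto simp: zero_le_divide_iff)
  qed
  have "quotient_of (fst s) = quotient_of (fst t)" "snd s = snd t"
    using assms(3) q[OF assms(1)] q[OF assms(2)] by (auto simp: code_server_def prod_eq_iff)
  then show ?thesis by (intro prod_eqI) (auto dest: quotient_of_inject)
qed

text \<open>\<open>wks_approx\<close> speaks of some instance with the given code; injectivity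
  identifies it with the printed one.\<close>

lemma enc_wks_inject:
  assumes "wks_wf I" "wks_wf J" "enc_wks I = enc_wks J"
  shows "I = J"
proof -
  let ?e = "\<lambda>x. enc_bits (fst x) @ enc_list print_server (fst (snd x)) @ enc_list enc_bits (snd (snd x))"
  let ?c = "\<lambda>I. (bits (points I), map code_server (servers I), map bits (requests I))"
  have "parses (parse_pair parse_bits (parse_pair (parse_list parse_server) (parse_list parse_bits))) ?e"
    by (intro parses_pair parses_list parses_bits parses_server)
  moreover have "enc_wks I = ?e (?c I)" for I
    by (simp add: enc_wks_def enc_servers enc_nats enc_nat_bits)
  ultimately have eq: "?c I = ?c J" using parses_unique[of _ ?e "?c I" "[]" "?c J" "[]"] assms(3) by simp
  have "servers I = servers J"
  proof (rule map_inj_on)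
    show "map code_server (servers I) = map code_server (servers J)" using eq by simp
    show "inj_on code_server (set (servers I) \<union> set (servers J))"
      using assms(1,2) by (intro inj_onI code_server_inject) (auto simp: wks_wf_def)
  qed
  moreover have "requests I = requests J"
    using eq by (auto simp: inj_map_eq_map inj_def)
  ultimately show ?thesis using eq by simp
qed

lemma moves_filter: "moves p xs = length (filter (\<lambda>c. fst c \<noteq> snd c) (zip (p # xs) xs))"
  by (induction xs arbitrary: p) auto

lemma filter_zip_map:
  assumes "inj g"
  shows "length (filter (\<lambda>c. fst c \<noteq> snd c) (zip (map g xs) (map g ys))) = length (filter (\<lambda>c. fst c \<noteq> snd c) (zip xs ys))"
  by (simp add: zip_map_map filter_map o_def inj_eq[OF assms] split_def)

type_synonym answer = "server_code list \<times> bool list list list"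

definition parse_answer :: "answer parser" where
  "parse_answer = parse_pair (parse_list parse_server) (parse_list (parse_list parse_bits))"

lemma parser_answer: "parser parse_answer"
  unfolding parse_answer_def by (intro parser_pair parser_list parser_server parser_bits)

lemma parse_enc_answer:
  "fst (parse_answer (enc_answer I xs f)) = (map code_server xs,
     map (\<lambda>i. map (\<lambda>t. bits (f i t)) [0..<length (requests I) + 1]) [0..<length (servers (add_servers I xs))])"
  (is "_ = ?a")
proof -
  let ?e = "\<lambda>x. enc_list print_server (fst x) @ enc_list (enc_list enc_bits) (snd x)"
  have "parses parse_answer ?e"
    unfolding parse_answer_def by (intro parses_pair parses_list parses_bits parses_server)
  then have "parse_answer (?e ?a @ []) = (?a, [])" unfolding parses_def by blast
  moreover have "enc_answer I xs f = ?e ?a"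
    by (simp only: enc_answer_def enc_servers enc_list_map enc_nat_bits fst_conv snd_conv)
  ultimately show ?thesis by simp
qed

context reduction
begin

text \<open>Twice the cost of the answer in unary: a move contributes one tick if the numerator of
  the weight has the code \<open>[True]\<close> of 1, and \<open>R\<close> ticks otherwise. A row
  starts with the position at time 0, so consecutive entries show all moves.\<close>

definition units :: "edge list \<Rightarrow> answer \<Rightarrow> bool list" where
  "units E a = concat (map (\<lambda>p. concat (map (\<lambda>_. if fst p = [True] then [True] else ticks E)
     (filter (\<lambda>c. fst c \<noteq> snd c) (zip (snd p) (tl (snd p))))))
     (zip (map (\<lambda>s. fst (fst s)) (server_bits E @ fst a)) (snd a)))"

text \<open>Compares \<open>2 * cost\<close> with \<open>R\<^sup>2\<close> by dropping one unary
  number from another, which avoids binary arithmetic.\<close>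

definition accepts :: "edge list \<Rightarrow> bool list \<Rightarrow> bool" where
  "accepts E y \<longleftrightarrow> drop_along (units E (fst (parse_answer y))) (power_list 2 (ticks E)) \<noteq> []"

lemma accepts: "accepts E y \<longleftrightarrow> length (units E (fst (parse_answer y))) < length (ticks E) ^ 2"
  by (simp add: accepts_def drop_along length_power_list not_le)

lemma PT_accepts:
  assumes "PT f" "PT g"
  shows "PT (\<lambda>x. accepts (f x) (g x))"
proof (rule PT_comp2[OF _ assms])
  have a: "PT (\<lambda>p :: edge list \<times> bool list. fst (parse_answer (snd p)))"
    using PT_fst[OF PT_comp[OF PT_snd[OF PT_id]]] parser_answer unfolding parser_def by blast
  have e: "PT (\<lambda>p. ticks (f p))" "PT (\<lambda>p. server_bits (f p))" if "PT f" for f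
    by (rule PT_comp[OF that PT_ticks], rule PT_comp[OF that PT_server_bits])
  show "PT (\<lambda>p. accepts (fst p) (snd p))"
    unfolding accepts_def units_def by (intro PT_intros e a PT_comp[OF _ a])
qed

end

context gap_game
begin

lemma servers_codes: "map code_server (servers (instance_of E)) = server_bits E"
proof -
  have q: "quotient_of (of_nat m :: rat) = (int m, 1)" "quotient_of 1 = (1, 1)" for m
    by simp_all
  show ?thesis
    by (simp add: server_bits_eq instance_of_def gap_instance_def code_server_def q bits_1[simplified])
qed

lemma length_units:
  assumes c: "c \<ge> 1" and aug: "augmentation c (instance_of E) xs"
  shows "2 * wks_cost (add_servers (instance_of E) xs) f
    = real (length (units E (fst (parse_answer (enc_answer (instance_of E) xs f)))))"
proof -
  let ?R = "length (ticks E)" and ?J = "add_servers (instance_of E) xs" and ?T = "length (requests (instance_of E))"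
  let ?n = "length (servers ?J)"
  let ?u = "\<lambda>w row. concat (map (\<lambda>_. if w = [True] then [True] else ticks E) (filter (\<lambda>c. fst c \<noteq> snd c) (zip row (tl row))))"
  have w: "map (\<lambda>s. fst (fst s)) (server_bits E @ map code_server xs) = map (\<lambda>s. bits (weight_of ?R s)) (servers ?J)"
  proof -
    have "server_bits E @ map code_server xs = map code_server (servers ?J)"
      by (simp add: servers_codes[symmetric] add_servers_def)
    moreover have "fst (fst (code_server s)) = bits (weight_of ?R s)" if "s \<in> set (servers ?J)" for s
      using augmented_weights[OF ticks_ge c aug[unfolded instance_of_def], folded instance_of_def, OF that]
      by (simp add: code_server_def)
    ultimately show ?thesis by simp
  qed
  have u: "length (?u (bits (weight_of ?R s)) (map (\<lambda>t. bits (f i t)) [0..<?T + 1]))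
      = weight_of ?R s * moves (f i 0) (map (f i) [1..<Suc ?T])" for s i
  proof -
    have row: "[0..<?T + 1] = 0 # [1..<Suc ?T]" by (simp add: upt_conv_Cons del: upt_Suc)
    have m: "length (filter (\<lambda>c. fst c \<noteq> snd c) (zip (map (\<lambda>t. bits (f i t)) [0..<?T + 1]) (tl (map (\<lambda>t. bits (f i t)) [0..<?T + 1]))))
        = moves (f i 0) (map (f i) [1..<Suc ?T])"
      unfolding moves_filter row
      using filter_zip_map[of bits "f i 0 # map (f i) [1..<Suc ?T]" "map (f i) [1..<Suc ?T]"]
      by (simp add: o_def inj_def del: upt_Suc)
    have "bits (weight_of ?R s) = [True] \<longleftrightarrow> weight_of ?R s = 1"
      using bits_inject[of "weight_of ?R s" 1] by (simp only: bits_1)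
    then have l: "length (if bits (weight_of ?R s) = [True] then [True] else ticks E) = weight_of ?R s"
      using ticks_ge by (auto simp: weight_of_def)
    show ?thesis
      unfolding length_concat map_map o_def l m[symmetric] by (simp add: sum_list_triv del: upt_Suc)
  qed
  have "length (units E (fst (parse_answer (enc_answer (instance_of E) xs f))))
      = sum_list (map (\<lambda>p. length (?u (fst p) (snd p))) (zip (map (\<lambda>s. bits (weight_of ?R s)) (servers ?J))
          (map (\<lambda>i. map (\<lambda>t. bits (f i t)) [0..<?T + 1]) [0..<?n])))"
    unfolding parse_enc_answer units_def fst_conv snd_conv w length_concat map_map o_def ..
  also have "\<dots> = (\<Sum>i<?n. length (?u (bits (weight_of ?R (servers ?J ! i))) (map (\<lambda>t. bits (f i t)) [0..<?T + 1])))"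
    by (simp add: sum_list_sum_nth atLeast0LessThan del: upt_Suc)
  also have "\<dots> = (\<Sum>i<?n. weight_of ?R (servers ?J ! i) * moves (f i 0) (map (f i) [1..<Suc ?T]))"
    by (simp only: u)
  finally show ?thesis
    using augmented_cost[OF ticks_ge c aug[unfolded instance_of_def], folded instance_of_def] by simp
qed

lemma approx_answer:
  assumes "c \<ge> 1" "wks_approx c \<rho> (print E) y"
  obtains xs f where "augmentation c (instance_of E) xs" "wks_solution (add_servers (instance_of E) xs) f"
    "wks_cost (add_servers (instance_of E) xs) f \<le> \<rho> (length (print E)) * wks_opt (instance_of E)"
    "accepts E y \<longleftrightarrow> 2 * wks_cost (add_servers (instance_of E) xs) f < real (length (ticks E)) * real (length (ticks E))"
proof -
  obtain I xs f where a: "wks_wf I" "print E = enc_wks I" "y = enc_answer I xs f"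
    "augmentation c I xs" "wks_solution (add_servers I xs) f"
    "wks_cost (add_servers I xs) f \<le> \<rho> (length (print E)) * wks_opt I"
    using assms(2) unfolding wks_approx_def by blast
  have I: "I = instance_of E" by (rule enc_wks_inject[OF a(1) wks_wf_instance]) (use a(2) print_eq in simp)
  have "accepts E y \<longleftrightarrow> real (length (units E (fst (parse_answer y)))) < real (length (ticks E) ^ 2)"
    unfolding accepts of_nat_less_iff ..
  also have "\<dots> \<longleftrightarrow> 2 * wks_cost (add_servers (instance_of E) xs) f < real (length (ticks E)) * real (length (ticks E))"
    unfolding a(3) I length_units[OF assms(1) a(4)[unfolded I]] by (simp add: power2_eq_square)
  finally show thesis using a that unfolding I by blast
qed

text \<open>Let X be the sum of the numbers of samples and sets and \<open>c0\<close>, so that R =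
  X^D. Twice the optimum is at most X^(D+2) and the input size at most X^(2D+4), so twice the cost
  of the answer is at most X to the power 2D + 4 - 2 \<epsilon> D - 4 \<epsilon>. This is less than
  R^2 because \<epsilon> D is at least 2. The bound 1/4 on \<epsilon> keeps
  \<open>1/2 - \<epsilon>\<close> nonnegative, as monotonicity in the size requires.\<close>

lemma accepts_complete:
  fixes \<epsilon> :: real
  assumes lab: "\<And>u. A u < q" "\<And>v. B v < q"
      "real (length (filter (\<lambda>e. edge_map e (A (fst e)) \<noteq> B (fst (snd e))) E)) \<le> z * real (length E)"
    and z: "z \<ge> 0" and L: "L \<ge> 1" and Q: "q \<le> Q" and size: "2 ^ Q * (1/2 + real L * z) \<le> real K"
    and c: "c \<ge> 1" and c0: "2 * Q + 10 * k + K + h \<le> c0" "20 \<le> c0"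
    and \<epsilon>: "0 < \<epsilon>" "\<epsilon> \<le> 1/4" "2 \<le> \<epsilon> * real D" "\<epsilon> \<le> \<epsilon>'"
    and y: "wks_approx c (\<lambda>N. real N powr (1/2 - \<epsilon>')) (print E) y"
  shows "accepts E y"
proof -
  obtain xs f where xf:
    "wks_cost (add_servers (instance_of E) xs) f \<le> real (length (print E)) powr (1/2 - \<epsilon>') * wks_opt (instance_of E)"
    "accepts E y \<longleftrightarrow> 2 * wks_cost (add_servers (instance_of E) xs) f < real (length (ticks E)) * real (length (ticks E))"
    by (rule approx_answer[OF c y]) (rule that)
  define X where "X = length (Ws E) + (length (hyperedges E) + c0)"
  have R: "length (ticks E) = X ^ D" by (simp add: length_ticks X_def)
  have X: "X \<ge> 20" "length (Ws E) + length (hyperedges E) \<le> X" "K \<le> X" "k \<le> X" using c0 by (auto simp: X_def)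
  let ?N = "real (length (print E))"
  have N1: "?N \<ge> 1" by (simp add: print_def enc_list_def enc_bits_def Suc_le_eq)
  have opt: "2 * wks_opt (instance_of E) \<le> real X ^ (D + 2)"
  proof -
    have "2 * wks_opt (instance_of E) \<le> real (length (ticks E)) *
        (real K * real (length (Ws E)) + real k * real (length (hyperedges E)))"
      by (rule completeness[OF lab z L Q size])
    also have "\<dots> \<le> real (length (ticks E)) * (real X * real (length (Ws E)) + real X * real (length (hyperedges E)))"
      using X by (intro mult_left_mono add_mono mult_right_mono) auto
    also have "\<dots> = real (length (ticks E)) * (real X * real (length (Ws E) + length (hyperedges E)))"
      by (simp add: distrib_left)
    also have "\<dots> \<le> real (length (ticks E)) * (real X * real X)"
      using X(2) by (intro mult_left_mono) (simp_all del: of_nat_add)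
    finally show ?thesis by (simp add: R power_add power2_eq_square mult_ac)
  qed
  have N: "?N powr (1/2 - \<epsilon>') \<le> real X powr (real (2 * D + 4) * (1/2 - \<epsilon>))"
  proof -
    have "length (print E) \<le> X ^ (2 * D + 4)"
      using length_print[OF c0, of E] unfolding R X_def[symmetric] by (simp add: power_add power_mult mult.commute[of 2 D])
    then have "?N \<le> real X ^ (2 * D + 4)" by (simp only: of_nat_power[symmetric] of_nat_le_iff)
    moreover have "real X ^ (2 * D + 4) = real X powr real (2 * D + 4)"
      using X(1) by (intro powr_realpow[symmetric]) simp
    ultimately have le: "?N \<le> real X powr real (2 * D + 4)" by (simp only:)
    have "?N powr (1/2 - \<epsilon>') \<le> ?N powr (1/2 - \<epsilon>)" using N1 \<epsilon> by (intro powr_mono) auto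
    also have "\<dots> \<le> (real X powr real (2 * D + 4)) powr (1/2 - \<epsilon>)"
      using \<epsilon> N1 le by (intro powr_mono2) auto
    finally show ?thesis by (simp only: powr_powr)
  qed
  have "2 * wks_cost (add_servers (instance_of E) xs) f \<le> ?N powr (1/2 - \<epsilon>') * (2 * wks_opt (instance_of E))"
    using xf(1) by simp
  also have "\<dots> \<le> ?N powr (1/2 - \<epsilon>') * real X ^ (D + 2)" by (intro mult_left_mono opt powr_ge_zero)
  also have "\<dots> \<le> real X powr (real (2 * D + 4) * (1/2 - \<epsilon>)) * real X ^ (D + 2)" by (intro mult_right_mono N zero_le_power of_nat_0_le_iff)
  also have "\<dots> = real X powr (real (2 * D + 4) * (1/2 - \<epsilon>) + real (D + 2))"
    using powr_realpow[of "real X" "D + 2"] X(1) by (simp only: powr_add)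
  also have "\<dots> < real X powr real (2 * D)"
  proof (rule powr_less_mono)
    have "real (2 * D + 4) * (1/2 - \<epsilon>) + real (D + 2) = real (2 * D) + (4 - 2 * (\<epsilon> * real D) - 4 * \<epsilon>)"
      by (simp add: algebra_simps)
    then show "real (2 * D + 4) * (1/2 - \<epsilon>) + real (D + 2) < real (2 * D)" using \<epsilon>(1,3) by linarith
  qed (use X in auto)
  also have "\<dots> = real (length (ticks E)) * real (length (ticks E))"
    unfolding R using powr_realpow[of "real X" "2 * D"] X(1) by (simp only: mult_2 power_add of_nat_power)
  finally show ?thesis using xf(2) by simp
qed

end

section \<open>Choice of the constants and assembly of the hardness proof\<close>

section \<open>Parameters\<close>

text \<open>With s = c \<theta> the left side is at most exp (\<beta> s) <= 1 / (1 - \<beta> s), and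
  (1 + \<beta>) (1 - \<beta> s) = 1 + \<beta> (1 - s (1 + \<beta>)) exceeds 1 once s (1 + \<beta>) <
  1. The value (1 - s) / 2 of \<beta> achieves this.\<close>

lemma powr_less_Suc:
  fixes c \<theta> \<beta> :: real
  assumes c: "c > 0" and \<theta>: "\<theta> > 0" "c * \<theta> < 1" and \<beta>: "\<beta> = (1 - c * \<theta>) / 2"
  shows "(1 + \<beta> * \<theta>) powr c < 1 + \<beta>"
proof -
  define s where "s = c * \<theta>"
  have s: "0 < s" "s < 1" "\<beta> = (1 - s) / 2" using assms by (auto simp: s_def)
  have "s * (1 + \<beta>) < 1"
  proof -
    have "1 - s * (1 + \<beta>) = (1 - s) * (1 - s / 2)" unfolding s(3) by (simp add: field_simps)
    also have "\<dots> > 0" using s by simp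
    finally show ?thesis by simp
  qed
  moreover have "\<beta> > 0" using s by simp
  ultimately have 1: "1 < (1 + \<beta>) * (1 - \<beta> * s)"
    using mult_strict_left_mono[of "s * (1 + \<beta>)" 1 \<beta>] by (simp add: algebra_simps)
  have 2: "1 - \<beta> * s > 0"
  proof (rule ccontr)
    assume "\<not> 1 - \<beta> * s > 0"
    then have "(1 + \<beta>) * (1 - \<beta> * s) \<le> 0" using \<open>\<beta> > 0\<close> by (intro mult_nonneg_nonpos) auto
    with 1 show False by simp
  qed
  have "(1 + \<beta> * \<theta>) powr c \<le> exp (\<beta> * \<theta>) powr c"
    using \<open>\<beta> > 0\<close> \<theta> c exp_ge_add_one_self[of "\<beta> * \<theta>"] by (intro powr_mono2) (auto intro: add_nonneg_nonneg)
  also have "\<dots> = exp (\<beta> * s)" by (simp add: powr_def s_def mult_ac)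
  also have "\<dots> \<le> 1 / (1 - \<beta> * s)"
  proof -
    have "exp (\<beta> * s) * (1 - \<beta> * s) \<le> exp (\<beta> * s) * exp (- (\<beta> * s))"
      using exp_ge_add_one_self[of "- (\<beta> * s)"] by (intro mult_left_mono) auto
    also have "\<dots> = 1" by (simp add: exp_minus)
    finally show ?thesis using 2 by (simp add: field_simps)
  qed
  also have "\<dots> < 1 + \<beta>" using 1 2 by (simp add: field_simps)
  finally show ?thesis .
qed

text \<open>The order of the quantifiers is forced: \<eta>, \<delta> and \<open>L\<close> determine
  the errors demanded of the conjecture, which then returns \<open>q\<close>; only \<open>k\<close>,
  \<open>h\<close>, \<open>Q\<close> and \<open>K\<close> may depend on \<open>q\<close>. By the
  choice of \<beta>, \<open>c * (1/2 + \<eta>) = 1 - 2 * \<beta>\<close>. One \<beta> serves as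
  \<delta>, and the other pays for rounding and for the light points.\<close>

lemma gap_parameters:
  fixes c :: real
  assumes c: "1 \<le> c" "c < 2"
  obtains \<eta> \<beta> \<delta> :: real and L :: nat where "\<eta> > 0" "\<beta> > 0" "\<delta> > 0" "L \<ge> 1" "real L * (2 * \<eta>\<^sup>2 * \<delta>) \<ge> 1"
    "\<And>q. q \<ge> 1 \<Longrightarrow> \<exists>k h Q K. k \<ge> 1 \<and> int h = \<lfloor>c * real k\<rfloor> + 1 \<and> q \<le> Q \<and> K \<ge> 1 \<and>
       real q * (1 + \<beta> * (1/2 + \<eta>)) ^ h < (1 + \<beta>) ^ Suc k \<and>
       c * real K + real L * real h \<le> (1 - \<delta>) * 2 ^ Q \<and> 2 ^ Q * (1/2 + \<eta>) \<le> real K"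
proof -
  define \<eta> where "\<eta> = (2 / c - 1) / 4"
  define \<beta> where "\<beta> = (1 - c * (1/2 + \<eta>)) / 2"
  define u where "u = 1 + \<beta> * (1/2 + \<eta>)"
  have \<eta>: "\<eta> > 0" using c by (simp add: \<eta>_def field_simps)
  have s: "c * (1/2 + \<eta>) < 1" using c by (simp add: \<eta>_def field_simps)
  have \<beta>: "\<beta> > 0" using s by (simp add: \<beta>_def)
  have u: "u > 1" using \<eta> \<beta> by (simp add: u_def)
  have uc: "u powr c < 1 + \<beta>"
    unfolding u_def using powr_less_Suc[OF _ _ s \<beta>_def] c \<eta> by simp
  obtain n :: nat where n: "1 / (2 * \<eta>\<^sup>2 * \<beta>) < real n" using reals_Archimedean2 by blast
  have "0 < 1 / (2 * \<eta>\<^sup>2 * \<beta>)" using \<eta> \<beta> by simp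
  with n have "0 < real n" by linarith
  then have n0: "n \<ge> 1" by simp
  show thesis
  proof (rule that[OF \<eta> \<beta> \<beta> n0])
    show "real n * (2 * \<eta>\<^sup>2 * \<beta>) \<ge> 1" using n \<eta> \<beta> by (simp add: field_simps)
    fix q :: nat assume q: "q \<ge> 1"
    have "u powr c / (1 + \<beta>) < 1" using uc \<beta> by simp
    moreover have "0 < 1 / (real q * u)" using q u by simp
    \<comment> \<open>Since \<open>u powr c < 1 + \<beta>\<close>, a large \<open>k\<close>
      outweighs the factor \<open>q\<close> from the sum over the labels. The extra \<open>u\<close>
      accounts for \<open>h\<close>, which may exceed \<open>c * k\<close> by up to 1.\<close>
    ultimately obtain k where k: "(u powr c / (1 + \<beta>)) ^ k < 1 / (real q * u)"
      using real_arch_pow_inv by blast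
    have k1: "k \<ge> 1"
    proof (rule ccontr)
      assume "\<not> k \<ge> 1"
      then have "k = 0" by simp
      with k have "real q * u < 1" using q u by (simp add: field_simps)
      moreover have "1 * 1 \<le> real q * u" using q u by (intro mult_mono) auto
      ultimately show False by simp
    qed
    define h where "h = nat (\<lfloor>c * real k\<rfloor> + 1)"
    have h: "int h = \<lfloor>c * real k\<rfloor> + 1" using c by (simp add: h_def)
    have par: "real q * u ^ h < (1 + \<beta>) ^ Suc k"
    proof -
      have "u ^ h = u powr real h" using u by (simp add: powr_realpow)
      also have "\<dots> \<le> u powr (c * real k + 1)"
      proof (rule powr_mono)
        have "real h = of_int (\<lfloor>c * real k\<rfloor> + 1)" using h by (metis of_int_of_nat_eq)
        then show "real h \<le> c * real k + 1" by simp
      qed (use u in simp)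
      also have "\<dots> = (u powr c) ^ k * u"
        using u by (simp add: powr_add powr_powr[symmetric] powr_realpow)
      finally have "real q * u ^ h \<le> real q * ((u powr c) ^ k * u)" by (rule mult_left_mono) simp
      also have "\<dots> < (1 + \<beta>) ^ k" using k q u \<beta> by (simp add: field_simps)
      also have "\<dots> \<le> (1 + \<beta>) ^ Suc k" using \<beta> by (intro power_increasing) auto
      finally show ?thesis .
    qed
    obtain m where m: "(c + real n * real h) / \<beta> < 2 ^ m"
      using real_arch_pow[of 2 "(c + real n * real h) / \<beta>"] by auto
    \<comment> \<open>\<open>m\<close> makes 2^Q absorb the constant \<open>c + n * h\<close>;
      adding \<open>q\<close> makes room for all labels.\<close>
    define Q where "Q = q + m"
    have Q: "c + real n * real h \<le> \<beta> * 2 ^ Q"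
    proof -
      have "c + real n * real h \<le> \<beta> * 2 ^ m" using m \<beta> by (simp add: field_simps)
      also have "\<dots> \<le> \<beta> * 2 ^ Q" using \<beta> by (intro mult_left_mono power_increasing) (auto simp: Q_def)
      finally show ?thesis .
    qed
    \<comment> \<open>The heavy servers per sample: half of the cube for strings with bit 0 at the
      label, and a fraction \<eta> to pay for the broken samples.\<close>
    define K where "K = nat \<lceil>2 ^ Q * (1/2 + \<eta>)\<rceil>"
    have Kpos: "2 ^ Q * (1/2 + \<eta>) > 0" using \<eta> by (intro mult_pos_pos) auto
    have K: "2 ^ Q * (1/2 + \<eta>) \<le> real K" "real K \<le> 2 ^ Q * (1/2 + \<eta>) + 1" "K \<ge> 1"
      using Kpos unfolding K_def by linarith+
    have "c * real K \<le> c * (2 ^ Q * (1/2 + \<eta>) + 1)" using K(2) c by (intro mult_left_mono) auto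
    also have "\<dots> = 2 ^ Q * (c * (1/2 + \<eta>)) + c" by (simp add: algebra_simps)
    also have "c * (1/2 + \<eta>) = 1 - 2 * \<beta>" by (simp add: \<beta>_def field_simps)
    finally have "c * real K + real n * real h \<le> (1 - \<beta>) * 2 ^ Q" using Q by (simp add: algebra_simps)
    then show "\<exists>k h Q K. k \<ge> 1 \<and> int h = \<lfloor>c * real k\<rfloor> + 1 \<and> q \<le> Q \<and> K \<ge> 1 \<and>
       real q * (1 + \<beta> * (1/2 + \<eta>)) ^ h < (1 + \<beta>) ^ Suc k \<and>
       c * real K + real n * real h \<le> (1 - \<beta>) * 2 ^ Q \<and> 2 ^ Q * (1/2 + \<eta>) \<le> real K"
      using k1 h par K(1,3) unfolding u_def by (intro exI[of _ k] exI[of _ h] exI[of _ Q] exI[of _ K]) (auto simp: Q_def)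
  qed
qed

definition code_edge :: "nat \<times> nat \<times> nat list \<Rightarrow> edge" where
  "code_edge e = (bits (fst e), bits (fst (snd e)), map bits (snd (snd e)))"

definition parse_game :: "edge list parser" where
  "parse_game = parse_list (parse_pair parse_bits (parse_pair parse_bits (parse_list parse_bits)))"

lemma parser_game: "parser parse_game"
  unfolding parse_game_def by (intro parser_list parser_pair parser_bits)

lemma parse_enc_ug: "fst (parse_game (enc_ug G)) = map code_edge G"
proof -
  let ?e = "enc_list (\<lambda>e. enc_bits (fst e) @ enc_bits (fst (snd e)) @ enc_list enc_bits (snd (snd e)))"
  have "parses parse_game ?e"
    unfolding parse_game_def by (intro parses_list parses_pair parses_bits)
  then have "parse_game (?e (map code_edge G) @ []) = (map code_edge G, [])" unfolding parses_def by blast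
  moreover have "enc_ug G = ?e (map code_edge G)"
    by (simp add: enc_ug_def enc_list_map code_edge_def enc_nats enc_nat_bits split_def)
  ultimately show ?thesis by simp
qed

lemma edge_map_code: "a < length (snd (snd e)) \<Longrightarrow> edge_map (code_edge e) a = snd (snd e) ! a"
  by (simp add: edge_map_def code_edge_def)

lemma ug_wf_edge:
  assumes "ug_wf q G" "e \<in> set G"
  shows "distinct (snd (snd e))" "set (snd (snd e)) = {..<q}" "length (snd (snd e)) = q"
proof -
  show *: "distinct (snd (snd e))" "set (snd (snd e)) = {..<q}"
    using assms by (auto simp: ug_wf_def)
  show "length (snd (snd e)) = q" using distinct_card[OF *(1)] *(2) by simp
qed

lemma gap_game_of_ug:
  assumes "reduction q Q h k check" and wf: "ug_wf q G"
    and "h \<ge> 1" "k \<ge> 1" "K \<ge> 1" "D \<ge> 1" "c0 \<ge> 2"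
  shows "gap_game q Q h k K D c0 check (map code_edge G)"
proof -
  have edge: "bij_betw (edge_map e) {..<q} {..<q}" "snd (snd e) \<in> perm_codes q" if e: "e \<in> set (map code_edge G)" for e
  proof -
    obtain e' where e': "e' \<in> set G" "e = code_edge e'" using e by auto
    note g = ug_wf_edge[OF wf e'(1)]
    have m: "edge_map e a = snd (snd e') ! a" if "a \<in> {..<q}" for a
      using edge_map_code[of a e'] g(3) e'(2) that by simp
    have "bij_betw ((!) (snd (snd e'))) {..<q} {..<q}"
      by (rule bij_betw_nth[OF g(1)]) (simp_all add: g)
    then show "bij_betw (edge_map e) {..<q} {..<q}"
      by (subst bij_betw_cong[OF m])
    show "snd (snd e) \<in> perm_codes q"
      using g e'(2) by (simp add: perm_codes_def code_edge_def)
  qed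
  show ?thesis
    by (intro gap_game.intro gap_game_axioms.intro label_game.intro assms(1,3-) edge)
      (use wf in \<open>auto simp: ug_wf_def\<close>)
qed

lemma ug_frac_le_1: "ug_frac G a b \<le> 1"
  by (simp add: ug_frac_def divide_le_eq_1)

lemma length_filter_edges:
  assumes "ug_wf q G" "\<And>u. a u < q"
  shows "length (filter (\<lambda>e. P (edge_map e (a (fst e))) (b (fst (snd e)))) (map code_edge G))
    = length (filter (\<lambda>e. P (snd (snd e) ! a (bits (fst e))) (b (bits (fst (snd e))))) G)"
proof -
  have "filter ((\<lambda>e. P (edge_map e (a (fst e))) (b (fst (snd e)))) \<circ> code_edge) G
    = filter (\<lambda>e. P (snd (snd e) ! a (bits (fst e))) (b (bits (fst (snd e))))) G"
  proof (rule filter_cong[OF refl])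
    fix e assume "e \<in> set G"
    then have "edge_map (code_edge e) (a (bits (fst e))) = snd (snd e) ! a (bits (fst e))"
      using ug_wf_edge[OF assms(1)] assms(2) by (intro edge_map_code) simp
    then show "((\<lambda>e. P (edge_map e (a (fst e))) (b (fst (snd e)))) \<circ> code_edge) e
      = P (snd (snd e) ! a (bits (fst e))) (b (bits (fst (snd e))))"
      by (simp add: code_edge_def)
  qed
  then show ?thesis by (simp add: filter_map)
qed

text \<open>The value is a supremum; doubling the error yields a labeling without showing that it is
  attained. Vertices of the coded game are bit strings, and \<open>num\<close> leads back to the
  original ones.\<close>

lemma good_labeling:
  assumes wf: "ug_wf q G" and val: "ug_value q G \<ge> 1 - z" and z: "z > 0"
  obtains A B :: "bool list \<Rightarrow> nat" where "\<And>u. A u < q" "\<And>v. B v < q"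
    "real (length (filter (\<lambda>e. edge_map e (A (fst e)) \<noteq> B (fst (snd e))) (map code_edge G)))
      \<le> 2 * z * real (length (map code_edge G))"
proof -
  have G: "real (length G) > 0" "q \<ge> 1" using wf by (auto simp: ug_wf_def)
  have ne: "{ug_frac G a b |a b. range a \<subseteq> {..<q} \<and> range b \<subseteq> {..<q}} \<noteq> {}"
    using G(2) by (auto intro!: exI[of _ "\<lambda>_. 0"])
  have lt: "1 - 2 * z < Sup {ug_frac G a b |a b. range a \<subseteq> {..<q} \<and> range b \<subseteq> {..<q}}"
    using val z by (simp add: ug_value_def)
  obtain x where "x \<in> {ug_frac G a b |a b. range a \<subseteq> {..<q} \<and> range b \<subseteq> {..<q}}" "1 - 2 * z < x"
    by (rule less_cSupE[OF lt ne])
  then obtain a b where ab: "range a \<subseteq> {..<q}" "range b \<subseteq> {..<q}" "1 - 2 * z < ug_frac G a b" by blast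
  have A: "a (num u) < q" "b (num u) < q" for u using ab by auto
  show thesis
  proof (rule that[of "\<lambda>u. a (num u)" "\<lambda>v. b (num v)"])
    let ?good = "\<lambda>e. snd (snd e) ! a (fst e) = b (fst (snd e))"
    have "real (length (filter ?good G)) = ug_frac G a b * real (length G)"
      using G by (simp add: ug_frac_def split_def)
    also have "\<dots> \<ge> (1 - 2 * z) * real (length G)" using ab(3) by (intro mult_right_mono) auto
    finally have "real (length (filter ?good G)) \<ge> real (length G) - 2 * z * real (length G)"
      by (simp add: left_diff_distrib)
    moreover have "length (filter ?good G) + length (filter (\<lambda>e. \<not> ?good e) G) = length G"
      by (rule sum_length_filter_compl)
    ultimately have "real (length (filter (\<lambda>e. \<not> ?good e) G)) \<le> 2 * z * real (length G)" by linarith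
    then show "real (length (filter (\<lambda>e. edge_map e (a (num (fst e))) \<noteq> b (num (fst (snd e)))) (map code_edge G)))
      \<le> 2 * z * real (length (map code_edge G))"
      using length_filter_edges[where a = "\<lambda>u. a (num u)" and P = "(\<noteq>)" and b = "\<lambda>v. b (num v)", OF wf A(1)] by simp
  qed (use A in auto)
qed

lemma value_ge_labeling:
  fixes A B :: "bool list \<Rightarrow> nat"
  assumes wf: "ug_wf q G" and AB: "\<And>u. A u < q" "\<And>v. B v < q"
    and good: "real (length (filter (\<lambda>e. edge_map e (A (fst e)) = B (fst (snd e))) (map code_edge G)))
      \<ge> z * real (length (map code_edge G))"
  shows "ug_value q G \<ge> z"
proof -
  have G: "real (length G) > 0" using wf by (auto simp: ug_wf_def)
  let ?a = "\<lambda>u. A (bits u)" and ?b = "\<lambda>v. B (bits v)"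
  have "z * real (length G) \<le> real (length (filter (\<lambda>e. snd (snd e) ! ?a (fst e) = ?b (fst (snd e))) G))"
    using good length_filter_edges[where a = A and P = "(=)" and b = B, OF wf AB(1)] by simp
  then have "z \<le> ug_frac G ?a ?b" using G by (simp add: ug_frac_def split_def pos_le_divide_eq)
  also have "\<dots> \<le> ug_value q G"
    unfolding ug_value_def
  proof (rule cSup_upper)
    show "ug_frac G ?a ?b \<in> {ug_frac G a b |a b. range a \<subseteq> {..<q} \<and> range b \<subseteq> {..<q}}" using AB by blast
    show "bdd_above {ug_frac G a b |a b. range a \<subseteq> {..<q} \<and> range b \<subseteq> {..<q}}"
      using ug_frac_le_1 by (intro bdd_aboveI[of _ 1]) blast
  qed
  finally show ?thesis .
qed

lemma polytime_PT_iff: "polytime f \<longleftrightarrow> PT f"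
  using polytime_imp_PT PT_imp_polytime by blast

lemma class_P_iff: "L \<in> class_P \<longleftrightarrow> PT (\<lambda>x. [x \<in> L])"
  by (simp add: class_P_def polytime_PT_iff)

lemma PT_parse_pair: "PT (\<lambda>z. fst (parse_bits z))" "PT (\<lambda>z. snd (parse_bits z))"
  using parser_bits by (auto simp: parser_def intro: PT_fst PT_snd)

lemma PT_str_pair: "PT f \<Longrightarrow> PT g \<Longrightarrow> PT (\<lambda>x. str_pair (f x) (g x))"
  unfolding str_pair_enc by (intro PT_intros)

lemma class_P_subset_NP: "class_P \<subseteq> class_NP"
proof
  fix L assume "L \<in> class_P"
  then have "{z. fst (parse_bits z) \<in> L} \<in> class_P"
    using PT_comp[OF PT_parse_pair(1), of "\<lambda>x. [x \<in> L]"] by (simp add: class_P_iff)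
  moreover have "x \<in> L \<longleftrightarrow> (\<exists>y. length y \<le> length x ^ 0 + 0 \<and> str_pair x y \<in> {z. fst (parse_bits z) \<in> L})" for x
    by (auto intro: exI[of _ "[]"])
  ultimately show "L \<in> class_NP" unfolding class_NP_def by blast
qed

text \<open>A solver answers the single query of the reduction, and the decision rule
  \<open>V\<close> then settles membership. This is where composition of arbitrary polynomial-time
  functions is used for the second conclusion.\<close>

lemma NP_hard_search_solvable:
  assumes hard: "NP_hard_search D R" and solvable: "polytime_solvable D R"
  shows "class_P = class_NP"
proof (rule antisym[OF class_P_subset_NP], rule subsetI)
  fix L assume "L \<in> class_NP"
  then obtain f V where V: "V \<in> class_P" "polytime f"
    "\<And>x. f x \<in> D" "\<And>x y. R (f x) y \<Longrightarrow> (str_pair x y \<in> V \<longleftrightarrow> x \<in> L)"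
    using hard unfolding NP_hard_search_def by metis
  obtain A where A: "polytime A" "\<And>x. x \<in> D \<Longrightarrow> R x (A x)"
    using solvable unfolding polytime_solvable_def by blast
  have "PT (\<lambda>x. A (f x))" using V(2) A(1) unfolding polytime_PT_iff by (rule PT_comp)
  then have "PT (\<lambda>x. str_pair x (A (f x)))" by (intro PT_str_pair PT_id)
  then have "PT (\<lambda>x. [str_pair x (A (f x)) \<in> V])" using V(1) unfolding class_P_iff by (rule PT_comp)
  moreover have "str_pair x (A (f x)) \<in> V \<longleftrightarrow> x \<in> L" for x using V(3,4) A(2) by blast
  ultimately show "L \<in> class_P" by (simp add: class_P_iff)
qed

lemma hardness:
  fixes \<epsilon> c :: real
  assumes ugc: "unique_games_conjecture" and \<epsilon>: "\<epsilon> > 0" and c: "1 \<le> c" "c < 2"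
  shows "NP_hard_search two_weight_instances (wks_approx c (\<lambda>N. real N powr (1/2 - \<epsilon>)))"
  unfolding NP_hard_search_def
proof
  fix Lang assume Lang: "Lang \<in> class_NP"
  obtain \<eta> \<beta> \<delta> :: real and L :: nat where par: "\<eta> > 0" "\<beta> > 0" "\<delta> > 0" "L \<ge> 1" "real L * (2 * \<eta>\<^sup>2 * \<delta>) \<ge> 1"
    and ex: "\<And>q. q \<ge> 1 \<Longrightarrow> \<exists>k h Q K. k \<ge> 1 \<and> int h = \<lfloor>c * real k\<rfloor> + 1 \<and> q \<le> Q \<and> K \<ge> 1 \<and>
       real q * (1 + \<beta> * (1/2 + \<eta>)) ^ h < (1 + \<beta>) ^ Suc k \<and>
       c * real K + real L * real h \<le> (1 - \<delta>) * 2 ^ Q \<and> 2 ^ Q * (1/2 + \<eta>) \<le> real K"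
    by (rule gap_parameters[OF c]) (rule that)
  \<comment> \<open>\<open>good_labeling\<close> doubles the error and \<open>small_cover\<close>
    multiplies it by \<open>L\<close>; the result is exactly the slack \<eta> contained in
    \<open>K\<close>.\<close>
  define z where "z = \<eta> / (2 * real L)"
  have z: "z > 0" "real L * (2 * z) = \<eta>" using par by (auto simp: z_def)
  \<comment> \<open>Half of the fraction of satisfied edges that \<open>soundness\<close>
    guarantees, so that the two contradict each other strictly.\<close>
  have \<delta>': "\<eta>\<^sup>2 * \<delta> / 4 > 0" using par by simp
  obtain q where "NP_hard_promise {enc_ug G |G. ug_wf q G \<and> ug_value q G \<ge> 1 - z}
      {enc_ug G |G. ug_wf q G \<and> ug_value q G \<le> \<eta>\<^sup>2 * \<delta> / 4}"
    using ugc[unfolded unique_games_conjecture_def, rule_format, OF conjI[OF z(1) \<delta>']] by (rule exE)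
  then obtain f where "polytime f" and F': "\<forall>x. (x \<in> Lang \<longrightarrow> f x \<in> {enc_ug G |G. ug_wf q G \<and> ug_value q G \<ge> 1 - z})
      \<and> (x \<notin> Lang \<longrightarrow> f x \<in> {enc_ug G |G. ug_wf q G \<and> ug_value q G \<le> \<eta>\<^sup>2 * \<delta> / 4})"
    using Lang unfolding NP_hard_promise_def by (elim ballE exE conjE) auto
  then have f: "polytime f"
    "\<And>x. x \<in> Lang \<Longrightarrow> f x \<in> {enc_ug G |G. ug_wf q G \<and> ug_value q G \<ge> 1 - z}"
    "\<And>x. x \<notin> Lang \<Longrightarrow> f x \<in> {enc_ug G |G. ug_wf q G \<and> ug_value q G \<le> \<eta>\<^sup>2 * \<delta> / 4}"
    by simp_all
  have game: "\<exists>G. f x = enc_ug G \<and> ug_wf q G \<and> (x \<in> Lang \<longrightarrow> ug_value q G \<ge> 1 - z)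
      \<and> (x \<notin> Lang \<longrightarrow> ug_value q G \<le> \<eta>\<^sup>2 * \<delta> / 4)" for x
    using f(2,3)[of x] by (cases "x \<in> Lang") auto
  \<comment> \<open>The conjecture states no lower bound on \<open>q\<close>, but every output of
    the reduction, such as the one for \<open>[]\<close>, is a well-formed game.\<close>
  have q: "q \<ge> 1" using game[of "[]"] by (auto simp: ug_wf_def)
  obtain k h Q K where P: "k \<ge> 1" "int h = \<lfloor>c * real k\<rfloor> + 1" "q \<le> Q" "K \<ge> 1"
    "real q * (1 + \<beta> * (1/2 + \<eta>)) ^ h < (1 + \<beta>) ^ Suc k"
    "c * real K + real L * real h \<le> (1 - \<delta>) * 2 ^ Q" "2 ^ Q * (1/2 + \<eta>) \<le> real K"
    using ex[OF q] by blast
  have h: "h \<ge> 1"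
  proof -
    have "\<lfloor>c * real k\<rfloor> \<ge> 0" using c by simp
    then show ?thesis using P(2) by linarith
  qed
  \<comment> \<open>An answer within ratio N^(1/2 - \<epsilon>) is also within N^(1/2 -
    \<epsilon>0), as N is at least 1; so \<epsilon> may be lowered to 1/4.\<close>
  define \<epsilon>0 where "\<epsilon>0 = min \<epsilon> (1/4)"
  have \<epsilon>0: "0 < \<epsilon>0" "\<epsilon>0 \<le> 1/4" "\<epsilon>0 \<le> \<epsilon>" using \<epsilon> by (auto simp: \<epsilon>0_def)
  obtain D :: nat where "2 / \<epsilon>0 < real D" using reals_Archimedean2 by blast
  then have D_ge: "2 \<le> \<epsilon>0 * real D" using \<epsilon>0(1) by (simp add: field_simps)
  have D1: "D \<ge> 1" using D_ge by (cases D) auto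
  \<comment> \<open>Dominates every constant in \<open>length_print\<close> and makes the base of
    \<open>R\<close> at least 20.\<close>
  define c0 where "c0 = 2 * Q + 10 * k + K + h + 20"
  have c0_ge: "2 * Q + 10 * k + K + h \<le> c0" "20 \<le> c0" "2 \<le> c0" by (auto simp: c0_def)
  obtain check where check: "PT check"
    "\<And>t. t \<in> {t. set t \<subseteq> perm_codes q \<times> cube Q \<and> length t = h} \<Longrightarrow> check t = tight q k t"
    by (rule PT_finite[OF finite_tight_domain]) (rule that)
  interpret reduction q L Q h k K D c0 check
    by unfold_locales (use check in auto)
  define edges where "edges x = fst (parse_game (f x))" for x
  have edges: "PT edges"
    unfolding edges_def using PT_fst[OF PT_comp[OF f(1)[unfolded polytime_PT_iff]]] parser_game
    unfolding parser_def by blast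
  \<comment> \<open>The game, and with it the printed instance, is recomputed from \<open>x\<close>;
    only the solution is taken from the answer.\<close>
  define V where "V = {z. accepts (edges (fst (parse_bits z))) (snd (parse_bits z))}"
  have V: "V \<in> class_P"
    unfolding class_P_iff V_def mem_Collect_eq
    by (intro PT_intros PT_accepts PT_comp[OF _ edges] PT_parse_pair)
  have F: "polytime (\<lambda>x. print (edges x))"
    unfolding polytime_PT_iff by (rule PT_comp[OF edges PT_print])
  have main: "print (edges x) \<in> two_weight_instances \<and>
      (\<forall>y. wks_approx c (\<lambda>N. real N powr (1/2 - \<epsilon>)) (print (edges x)) y \<longrightarrow> (str_pair x y \<in> V \<longleftrightarrow> x \<in> Lang))" for x
  proof -
    obtain G where G: "f x = enc_ug G" "ug_wf q G" "x \<in> Lang \<Longrightarrow> ug_value q G \<ge> 1 - z"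
      "x \<notin> Lang \<Longrightarrow> ug_value q G \<le> \<eta>\<^sup>2 * \<delta> / 4" using game[of x] by blast
    have E: "edges x = map code_edge G" by (simp add: edges_def G(1) parse_enc_ug)
    interpret gap_game q L Q h k K D c0 check "map code_edge G"
      by (rule gap_game_of_ug[OF reduction_axioms G(2) h P(1,4) D1 c0_ge(3)])
    have "print (edges x) \<in> two_weight_instances"
      unfolding two_weight_instances_def E print_eq using wks_wf_instance card_weights_instance by blast
    moreover have "str_pair x y \<in> V \<longleftrightarrow> x \<in> Lang"
      if y: "wks_approx c (\<lambda>N. real N powr (1/2 - \<epsilon>)) (print (edges x)) y" for y
    proof -
      have v: "str_pair x y \<in> V \<longleftrightarrow> accepts (map code_edge G) y" by (simp add: V_def E)
      show ?thesis
      proof (cases "x \<in> Lang")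
        case True
        obtain A B :: "bool list \<Rightarrow> nat" where lab: "\<And>u. A u < q" "\<And>v. B v < q"
          "real (length (filter (\<lambda>e. edge_map e (A (fst e)) \<noteq> B (fst (snd e))) (map code_edge G)))
            \<le> 2 * z * real (length (map code_edge G))"
          by (rule good_labeling[OF G(2) G(3)[OF True] z(1)]) (rule that)
        have "accepts (map code_edge G) y"
          by (rule accepts_complete[OF lab _ par(4) P(3) _ c(1) c0_ge(1,2) \<epsilon>0(1,2) D_ge \<epsilon>0(3) y[unfolded E]])
            (use z P(7) in auto)
        with v True show ?thesis by simp
      next
        case False
        have "\<not> accepts (map code_edge G) y"
        proof
          assume acc: "accepts (map code_edge G) y"
          obtain xs g where xs: "augmentation c (instance_of (map code_edge G)) xs"
            "wks_solution (add_servers (instance_of (map code_edge G)) xs) g"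
            "accepts (map code_edge G) y \<longleftrightarrow> 2 * wks_cost (add_servers (instance_of (map code_edge G)) xs) g
               < real (length (ticks (map code_edge G))) * real (length (ticks (map code_edge G)))"
            by (rule approx_answer[OF c(1) y[unfolded E]]) (rule that)
          obtain A B :: "bool list \<Rightarrow> nat" where AB: "\<And>u. A u < q" "\<And>v. B v < q"
            "real (length (filter (\<lambda>e. edge_map e (A (fst e)) = B (fst (snd e))) (map code_edge G)))
              \<ge> \<eta>\<^sup>2 * \<delta> / 2 * real (length (map code_edge G))"
            by (rule soundness[OF c(1) xs(1,2) xs(3)[THEN iffD1, OF acc] P(2,6) par(1-3) P(5) par(5) P(3)]) (rule that)
          have "\<eta>\<^sup>2 * \<delta> / 2 \<le> \<eta>\<^sup>2 * \<delta> / 4"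
            using value_ge_labeling[OF G(2) AB] G(4)[OF False] by linarith
          then show False using \<delta>' by linarith
        qed
        with v False show ?thesis by simp
      qed
    qed
    ultimately show ?thesis by blast
  qed
  show "\<exists>f. \<exists>V\<in>class_P. polytime f \<and> (\<forall>x. f x \<in> two_weight_instances \<and>
      (\<forall>y. wks_approx c (\<lambda>N. real N powr (1/2 - \<epsilon>)) (f x) y \<longrightarrow> (str_pair x y \<in> V \<longleftrightarrow> x \<in> Lang)))"
    using F V main by blast
qed

theorem theorem1p1:
  fixes \<epsilon> c :: real
  assumes "unique_games_conjecture"
    and "\<epsilon> > 0" and "1 \<le> c" and "c < 2"
  shows "NP_hard_search two_weight_instances (wks_approx c (\<lambda>N. real N powr (1/2 - \<epsilon>)))
       \<and> (polytime_solvable two_weight_instances (wks_approx c (\<lambda>N. real N powr (1/2 - \<epsilon>)))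
            \<longrightarrow> class_P = class_NP)"
  using hardness[OF assms] NP_hard_search_solvable by blast

end
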